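(* Let $F$ be a spectrally analytic functor and let $X=\partial^{\mathrm{spec}}F$ be its associated integrable derivative algebra. Assume that deformations of $F$ are transported through the equivalence $\mathsf{SpecAn}\simeq\mathsf{DerAlg}_{\mathrm{int}}$, $F\mapsto\partial^{\mathrm{spec}}F$, to deformations of the right $P$-module structure on $X$. Then: (1) first-order deformations of $F$ over $\mathbb C[\varepsilon]/(\varepsilon^2)$ are represented by first cocycles: $\mathrm{Def}_\varepsilon(F)\cong Z^1_P(X)$; (2) two first-order deformations are equivalent precisely when their difference is a first coboundary, hence $\mathrm{Def}_\varepsilon(F)/\!\sim\ \cong H^1_P(X)$; (3) consequently the formal tangent space to the moduli problem at $[F]$ is $T_{[F]}\mathcal M_{\mathrm{spec}}\cong H^1_P(\partial^{\mathrm{spec}}F)$.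
   Context: $\mathcal M$ is a normed symmetric monoidal category over $\mathbb C$ (Hom-spaces are Banach spaces; composition and tensor of morphisms bilinear and submultiplicative), with object norms, and $P$ is an operad in $\mathcal M$, kept fixed. $\mathsf{SpecAn}$ is the category of admissible, operadically compatible, spectrally analytic functors $F:\mathsf{Alg}_P(\mathcal M)\to\mathcal M$ with natural transformations: admissible means the norm of $F(A)$ is bounded by a nondecreasing function of the spectral size $\|\sigma_P(A)\|$ of the operadic spectrum $\sigma_P(A)=\mathrm{Hoch}_{\mathcal M}(A)\otimes_P\coprod_cP(c;c)$ (viewed in $\mathbb C$ by analytic realization, size $=\sup|\lambda|$); spectrally analytic means the spectral Taylor tower converges to $F(A)$ in norm; operadically compatible means the derivatives $\partial_n^{\mathrm{spec}}F=\mathrm{cr}_nF$ (cross-effects, with $\Sigma_n$ permuting inputs) carry a right $P$-module structure. A derivative algebra is a symmetric sequence $X=\{X_n\}_{n\ge0}$ with a right $P$-module structure $\mu_X:X_k\otimes P(n_1)\otimes\cdots\otimes P(n_k)\to X_n$, $n=n_1+\cdots+n_k$ (equivariant, associative, unital), and exponential norm bounds $\|X_n\|\le C\rho^n$; it is integrable if the functor $A\mapsto\bigoplus_nX_n(A,\dots,A)_{\mathrm{sym}}$ lies in $\mathsf{SpecAn}$. $\mathsf{DerAlg}_{\mathrm{int}}$ is the category of these; the paper's classification theorem says $F\mapsto\partial^{\mathrm{spec}}F=\{\partial_n^{\mathrm{spec}}F\}$ is an equivalence $\mathsf{SpecAn}\simeq\mathsf{DerAlg}_{\mathrm{int}}$.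 $\mathcal M_{\mathrm{spec}}=\pi_0(\mathsf{SpecAn})$ is the set of isomorphism classes. Deformation complex $C_P^\bullet(X)$: its cochains encode multilinear perturbations of the structure maps $\mu_X$, and its differential $d$ is obtained by linearizing the right $P$-module associativity and equivariance relations. In low degrees: $C^0_P(X)$ consists of families $h=\{h_n:X_n\to X_n\}$ of $\Sigma_n$-equivariant maps; $C^1_P(X)$ consists of families $\phi$ of maps of the same type as $\mu_X$; $dh$ is the first-order term of $T_\varepsilon^{-1}\circ\mu_X\circ(T_\varepsilon\otimes\mathrm{id}_P)$ with $T_\varepsilon=\mathrm{id}_X+\varepsilon h$, $\varepsilon^2=0$; and $d\phi=0$ iff $\mu_X+\varepsilon\phi$ satisfies the right $P$-module identities modulo $\varepsilon^2$. $Z^1_P=\ker(d:C^1_P\to C^2_P)$, $B^1_P=\mathrm{im}(d:C^0_P\to C^1_P)$, $H^1_P=Z^1_P/B^1_P$. A first-order deformation of $X$ is a structure $\mu_X+\varepsilon\phi$ over $\mathbb C[\varepsilon]/(\varepsilon^2)$ satisfying the right $P$-module identities; two are equivalent if related by transport along some $\mathrm{id}_X+\varepsilon h$. $\mathrm{Def}_\varepsilon(F)$ is the set of first-order deformations of $F$ (transported to $X$), and $T_{[F]}\mathcal M_{\mathrm{spec}}$ denotes by definition the space of first-order deformations of $F$ modulo equivalence. *)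

theory Defs
  imports
    "HOL-Analysis.Analysis"
    "HOL-Combinatorics.Permutations"
    "HOL-Library.Function_Algebras"
    "HOL-Library.FuncSet"
begin

section \<open>Linear and normed symmetric monoidal categories\<close>

text \<open>
  Morphisms live in one ambient abelian group, and each \<open>Hom A B\<close> is a complex subspace of it.
  This is no restriction: take the direct sum of all Hom-spaces, with composition and tensor
  extended bilinearly. Composition and tensor are only constrained on the Hom-spaces.
  Composition is written in the usual order: \<open>g \<cdot> f\<close> is \<open>g\<close> after \<open>f\<close>.
\<close>

record ('o, 'm) smcat =
  Obj :: "'o set"
  Hom :: "'o \<Rightarrow> 'o \<Rightarrow> 'm set"
  Idn :: "'o \<Rightarrow> 'm"
  cmp :: "'m \<Rightarrow> 'm \<Rightarrow> 'm" (infixr "\<cdot>\<index>" 65)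
  scl :: "complex \<Rightarrow> 'm \<Rightarrow> 'm"
  tob :: "'o \<Rightarrow> 'o \<Rightarrow> 'o" (infixr "\<otimes>\<index>" 70)
  tmor :: "'m \<Rightarrow> 'm \<Rightarrow> 'm" (infixr "\<odot>\<index>" 70)
  unt :: 'o
  assoc :: "'o \<Rightarrow> 'o \<Rightarrow> 'o \<Rightarrow> 'm"
  ainv :: "'o \<Rightarrow> 'o \<Rightarrow> 'o \<Rightarrow> 'm"
  lun :: "'o \<Rightarrow> 'm"
  run :: "'o \<Rightarrow> 'm"
  braid :: "'o \<Rightarrow> 'o \<Rightarrow> 'm"

record ('o, 'm) nsmcat = "('o, 'm) smcat" +
  mnorm :: "'m \<Rightarrow> real"
  onorm :: "'o \<Rightarrow> real"

definition is_iso :: "('o, 'm, 'z) smcat_scheme \<Rightarrow> 'o \<Rightarrow> 'o \<Rightarrow> 'm \<Rightarrow> bool" where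
  "is_iso M A B f \<longleftrightarrow> f \<in> Hom M A B \<and>
     (\<exists>g \<in> Hom M B A. g \<cdot>\<^bsub>M\<^esub> f = Idn M A \<and> f \<cdot>\<^bsub>M\<^esub> g = Idn M B)"

locale linear_smc =
  fixes M :: "('o, 'm::ab_group_add, 'z) smcat_scheme" (structure)
  assumes scl_vs: "vector_space (scl M)"
    and Hom_sub: "\<lbrakk>A \<in> Obj M; B \<in> Obj M\<rbrakk> \<Longrightarrow> module.subspace (scl M) (Hom M A B)"
    and Idn_in: "A \<in> Obj M \<Longrightarrow> Idn M A \<in> Hom M A A"
    and cmp_in: "\<lbrakk>A \<in> Obj M; B \<in> Obj M; C \<in> Obj M; f \<in> Hom M A B; g \<in> Hom M B C\<rbrakk>
      \<Longrightarrow> g \<cdot> f \<in> Hom M A C"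
    and cmp_Idn: "\<lbrakk>A \<in> Obj M; B \<in> Obj M; f \<in> Hom M A B\<rbrakk> \<Longrightarrow> f \<cdot> Idn M A = f"
    and Idn_cmp: "\<lbrakk>A \<in> Obj M; B \<in> Obj M; f \<in> Hom M A B\<rbrakk> \<Longrightarrow> Idn M B \<cdot> f = f"
    and cmp_assoc: "\<lbrakk>A \<in> Obj M; B \<in> Obj M; C \<in> Obj M; D \<in> Obj M;
        f \<in> Hom M A B; g \<in> Hom M B C; h \<in> Hom M C D\<rbrakk> \<Longrightarrow> (h \<cdot> g) \<cdot> f = h \<cdot> (g \<cdot> f)"
    and cmp_add_left: "\<lbrakk>A \<in> Obj M; B \<in> Obj M; C \<in> Obj M; f \<in> Hom M A B;
        g \<in> Hom M B C; g' \<in> Hom M B C\<rbrakk> \<Longrightarrow> (g + g') \<cdot> f = (g \<cdot> f) + (g' \<cdot> f)"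
    and cmp_add_right: "\<lbrakk>A \<in> Obj M; B \<in> Obj M; C \<in> Obj M; f \<in> Hom M A B; f' \<in> Hom M A B;
        g \<in> Hom M B C\<rbrakk> \<Longrightarrow> g \<cdot> (f + f') = (g \<cdot> f) + (g \<cdot> f')"
    and cmp_scl_left: "\<lbrakk>A \<in> Obj M; B \<in> Obj M; C \<in> Obj M; f \<in> Hom M A B; g \<in> Hom M B C\<rbrakk>
      \<Longrightarrow> scl M c g \<cdot> f = scl M c (g \<cdot> f)"
    and cmp_scl_right: "\<lbrakk>A \<in> Obj M; B \<in> Obj M; C \<in> Obj M; f \<in> Hom M A B; g \<in> Hom M B C\<rbrakk>
      \<Longrightarrow> g \<cdot> scl M c f = scl M c (g \<cdot> f)"
    and unt_in: "unt M \<in> Obj M"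
    and tob_in: "\<lbrakk>A \<in> Obj M; B \<in> Obj M\<rbrakk> \<Longrightarrow> A \<otimes> B \<in> Obj M"
    and tmor_in: "\<lbrakk>A \<in> Obj M; B \<in> Obj M; C \<in> Obj M; D \<in> Obj M; f \<in> Hom M A B; g \<in> Hom M C D\<rbrakk>
      \<Longrightarrow> f \<odot> g \<in> Hom M (A \<otimes> C) (B \<otimes> D)"
    and tmor_Idn: "\<lbrakk>A \<in> Obj M; B \<in> Obj M\<rbrakk> \<Longrightarrow> Idn M A \<odot> Idn M B = Idn M (A \<otimes> B)"
    and tmor_cmp: "\<lbrakk>A \<in> Obj M; B \<in> Obj M; C \<in> Obj M; A' \<in> Obj M; B' \<in> Obj M; C' \<in> Obj M;
        f \<in> Hom M A B; g \<in> Hom M B C; f' \<in> Hom M A' B'; g' \<in> Hom M B' C'\<rbrakk>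
      \<Longrightarrow> (g \<cdot> f) \<odot> (g' \<cdot> f') = (g \<odot> g') \<cdot> (f \<odot> f')"
    and tmor_add_left: "\<lbrakk>A \<in> Obj M; B \<in> Obj M; C \<in> Obj M; D \<in> Obj M;
        f \<in> Hom M A B; f' \<in> Hom M A B; g \<in> Hom M C D\<rbrakk> \<Longrightarrow> (f + f') \<odot> g = (f \<odot> g) + (f' \<odot> g)"
    and tmor_add_right: "\<lbrakk>A \<in> Obj M; B \<in> Obj M; C \<in> Obj M; D \<in> Obj M;
        f \<in> Hom M A B; g \<in> Hom M C D; g' \<in> Hom M C D\<rbrakk> \<Longrightarrow> f \<odot> (g + g') = (f \<odot> g) + (f \<odot> g')"
    and tmor_scl_left: "\<lbrakk>A \<in> Obj M; B \<in> Obj M; C \<in> Obj M; D \<in> Obj M;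
        f \<in> Hom M A B; g \<in> Hom M C D\<rbrakk> \<Longrightarrow> scl M c f \<odot> g = scl M c (f \<odot> g)"
    and tmor_scl_right: "\<lbrakk>A \<in> Obj M; B \<in> Obj M; C \<in> Obj M; D \<in> Obj M;
        f \<in> Hom M A B; g \<in> Hom M C D\<rbrakk> \<Longrightarrow> f \<odot> scl M c g = scl M c (f \<odot> g)"
    and assoc_in: "\<lbrakk>A \<in> Obj M; B \<in> Obj M; C \<in> Obj M\<rbrakk>
      \<Longrightarrow> assoc M A B C \<in> Hom M ((A \<otimes> B) \<otimes> C) (A \<otimes> (B \<otimes> C))"
    and ainv_in: "\<lbrakk>A \<in> Obj M; B \<in> Obj M; C \<in> Obj M\<rbrakk>
      \<Longrightarrow> ainv M A B C \<in> Hom M (A \<otimes> (B \<otimes> C)) ((A \<otimes> B) \<otimes> C)"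
    and ainv_assoc: "\<lbrakk>A \<in> Obj M; B \<in> Obj M; C \<in> Obj M\<rbrakk>
      \<Longrightarrow> ainv M A B C \<cdot> assoc M A B C = Idn M ((A \<otimes> B) \<otimes> C)"
    and assoc_ainv: "\<lbrakk>A \<in> Obj M; B \<in> Obj M; C \<in> Obj M\<rbrakk>
      \<Longrightarrow> assoc M A B C \<cdot> ainv M A B C = Idn M (A \<otimes> (B \<otimes> C))"
    and lun_iso: "A \<in> Obj M \<Longrightarrow> is_iso M (unt M \<otimes> A) A (lun M A)"
    and run_iso: "A \<in> Obj M \<Longrightarrow> is_iso M (A \<otimes> unt M) A (run M A)"
    and braid_in: "\<lbrakk>A \<in> Obj M; B \<in> Obj M\<rbrakk> \<Longrightarrow> braid M A B \<in> Hom M (A \<otimes> B) (B \<otimes> A)"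
    and braid_braid: "\<lbrakk>A \<in> Obj M; B \<in> Obj M\<rbrakk> \<Longrightarrow> braid M B A \<cdot> braid M A B = Idn M (A \<otimes> B)"
    and assoc_nat: "\<lbrakk>A \<in> Obj M; B \<in> Obj M; C \<in> Obj M; A' \<in> Obj M; B' \<in> Obj M; C' \<in> Obj M;
        f \<in> Hom M A A'; g \<in> Hom M B B'; h \<in> Hom M C C'\<rbrakk>
      \<Longrightarrow> assoc M A' B' C' \<cdot> ((f \<odot> g) \<odot> h) = (f \<odot> (g \<odot> h)) \<cdot> assoc M A B C"
    and lun_nat: "\<lbrakk>A \<in> Obj M; B \<in> Obj M; f \<in> Hom M A B\<rbrakk>
      \<Longrightarrow> lun M B \<cdot> (Idn M (unt M) \<odot> f) = f \<cdot> lun M A"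
    and run_nat: "\<lbrakk>A \<in> Obj M; B \<in> Obj M; f \<in> Hom M A B\<rbrakk>
      \<Longrightarrow> run M B \<cdot> (f \<odot> Idn M (unt M)) = f \<cdot> run M A"
    and braid_nat: "\<lbrakk>A \<in> Obj M; B \<in> Obj M; A' \<in> Obj M; B' \<in> Obj M;
        f \<in> Hom M A A'; g \<in> Hom M B B'\<rbrakk>
      \<Longrightarrow> braid M A' B' \<cdot> (f \<odot> g) = (g \<odot> f) \<cdot> braid M A B"
    and pentagon: "\<lbrakk>A \<in> Obj M; B \<in> Obj M; C \<in> Obj M; D \<in> Obj M\<rbrakk>
      \<Longrightarrow> assoc M A B (C \<otimes> D) \<cdot> assoc M (A \<otimes> B) C D =
          (Idn M A \<odot> assoc M B C D) \<cdot> assoc M A (B \<otimes> C) D \<cdot> (assoc M A B C \<odot> Idn M D)"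
    and triangle: "\<lbrakk>A \<in> Obj M; B \<in> Obj M\<rbrakk>
      \<Longrightarrow> (Idn M A \<odot> lun M B) \<cdot> assoc M A (unt M) B = run M A \<odot> Idn M B"
    and hexagon: "\<lbrakk>A \<in> Obj M; B \<in> Obj M; C \<in> Obj M\<rbrakk>
      \<Longrightarrow> assoc M B C A \<cdot> braid M A (B \<otimes> C) \<cdot> assoc M A B C =
          (Idn M B \<odot> braid M A C) \<cdot> assoc M B A C \<cdot> (braid M A B \<odot> Idn M C)"

locale normed_smc = linear_smc M
  for M :: "('o, 'm::ab_group_add, 'z) nsmcat_scheme" (structure) +
  assumes mnorm_nonneg: "\<lbrakk>A \<in> Obj M; B \<in> Obj M; f \<in> Hom M A B\<rbrakk> \<Longrightarrow> 0 \<le> mnorm M f"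
    and mnorm_zero: "\<lbrakk>A \<in> Obj M; B \<in> Obj M; f \<in> Hom M A B\<rbrakk> \<Longrightarrow> mnorm M f = 0 \<longleftrightarrow> f = 0"
    and mnorm_scl: "\<lbrakk>A \<in> Obj M; B \<in> Obj M; f \<in> Hom M A B\<rbrakk>
      \<Longrightarrow> mnorm M (scl M c f) = cmod c * mnorm M f"
    and mnorm_triangle: "\<lbrakk>A \<in> Obj M; B \<in> Obj M; f \<in> Hom M A B; g \<in> Hom M A B\<rbrakk>
      \<Longrightarrow> mnorm M (f + g) \<le> mnorm M f + mnorm M g"
    and Hom_complete: "\<lbrakk>A \<in> Obj M; B \<in> Obj M\<rbrakk>
      \<Longrightarrow> Metric_space.mcomplete (Hom M A B) (\<lambda>f g. mnorm M (f - g))"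
    and mnorm_cmp: "\<lbrakk>A \<in> Obj M; B \<in> Obj M; C \<in> Obj M; f \<in> Hom M A B; g \<in> Hom M B C\<rbrakk>
      \<Longrightarrow> mnorm M (g \<cdot> f) \<le> mnorm M g * mnorm M f"
    and mnorm_tmor: "\<lbrakk>A \<in> Obj M; B \<in> Obj M; C \<in> Obj M; D \<in> Obj M;
        f \<in> Hom M A B; g \<in> Hom M C D\<rbrakk> \<Longrightarrow> mnorm M (f \<odot> g) \<le> mnorm M f * mnorm M g"
    and onorm_nonneg: "A \<in> Obj M \<Longrightarrow> 0 \<le> onorm M A"


section \<open>Iterated tensor products and coherence morphisms\<close>

text \<open>Iterated tensor products are bracketed to the right and end in the unit object:
  \<open>bigT M [A, B] = A \<otimes> (B \<otimes> \<one>)\<close>.\<close>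

fun bigT :: "('o, 'm, 'z) smcat_scheme \<Rightarrow> 'o list \<Rightarrow> 'o" where
  "bigT M [] = unt M"
| "bigT M (A # As) = A \<otimes>\<^bsub>M\<^esub> bigT M As"

fun bigM :: "('o, 'm, 'z) smcat_scheme \<Rightarrow> 'm list \<Rightarrow> 'm" where
  "bigM M [] = Idn M (unt M)"
| "bigM M (f # fs) = f \<odot>\<^bsub>M\<^esub> bigM M fs"

text \<open>\<open>bigT As \<otimes> bigT Bs \<rightarrow> bigT (As @ Bs)\<close>\<close>

fun joinT :: "('o, 'm, 'z) smcat_scheme \<Rightarrow> 'o list \<Rightarrow> 'o list \<Rightarrow> 'm" where
  "joinT M [] Bs = lun M (bigT M Bs)"
| "joinT M (A # As) Bs =
     (Idn M A \<odot>\<^bsub>M\<^esub> joinT M As Bs) \<cdot>\<^bsub>M\<^esub> assoc M A (bigT M As) (bigT M Bs)"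

text \<open>\<open>bigT (map bigT Ass) \<rightarrow> bigT (concat Ass)\<close>\<close>

fun flatT :: "('o, 'm, 'z) smcat_scheme \<Rightarrow> 'o list list \<Rightarrow> 'm" where
  "flatT M [] = Idn M (unt M)"
| "flatT M (As # Ass) =
     joinT M As (concat Ass) \<cdot>\<^bsub>M\<^esub> (Idn M (bigT M As) \<odot>\<^bsub>M\<^esub> flatT M Ass)"

text \<open>Interchange \<open>(A \<otimes> B) \<otimes> (C \<otimes> D) \<rightarrow> (A \<otimes> C) \<otimes> (B \<otimes> D)\<close>\<close>

definition mid4 :: "('o, 'm, 'z) smcat_scheme \<Rightarrow> 'o \<Rightarrow> 'o \<Rightarrow> 'o \<Rightarrow> 'o \<Rightarrow> 'm" where
  "mid4 M A B C D =
     ainv M A C (B \<otimes>\<^bsub>M\<^esub> D) \<cdot>\<^bsub>M\<^esub>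
     (Idn M A \<odot>\<^bsub>M\<^esub>
        (assoc M C B D \<cdot>\<^bsub>M\<^esub> (braid M B C \<odot>\<^bsub>M\<^esub> Idn M D) \<cdot>\<^bsub>M\<^esub> ainv M B C D)) \<cdot>\<^bsub>M\<^esub>
     assoc M A B (C \<otimes>\<^bsub>M\<^esub> D)"

text \<open>\<open>bigT As \<otimes> bigT Bs \<rightarrow> bigT (map2 (\<otimes>) As Bs)\<close>, for lists of equal length\<close>

fun zipT :: "('o, 'm, 'z) smcat_scheme \<Rightarrow> 'o list \<Rightarrow> 'o list \<Rightarrow> 'm" where
  "zipT M (A # As) (B # Bs) =
     (Idn M (A \<otimes>\<^bsub>M\<^esub> B) \<odot>\<^bsub>M\<^esub> zipT M As Bs) \<cdot>\<^bsub>M\<^esub> mid4 M A (bigT M As) B (bigT M Bs)"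
| "zipT M _ _ = lun M (unt M)"

text \<open>\<open>bigT [\<one>, \<dots>, \<one>] \<rightarrow> \<one>\<close>\<close>

fun collapseT :: "('o, 'm, 'z) smcat_scheme \<Rightarrow> nat \<Rightarrow> 'm" where
  "collapseT M 0 = Idn M (unt M)"
| "collapseT M (Suc n) = collapseT M n \<cdot>\<^bsub>M\<^esub> lun M (bigT M (replicate n (unt M)))"

definition remove_nth :: "nat \<Rightarrow> 'a list \<Rightarrow> 'a list" where
  "remove_nth i xs = take i xs @ drop (Suc i) xs"

text \<open>\<open>bigT As \<rightarrow> As ! i \<otimes> bigT (remove_nth i As)\<close>\<close>

fun pullT :: "('o, 'm, 'z) smcat_scheme \<Rightarrow> nat \<Rightarrow> 'o list \<Rightarrow> 'm" where
  "pullT M 0 As = Idn M (bigT M As)"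
| "pullT M (Suc i) [] = Idn M (unt M)"
| "pullT M (Suc i) (A # As) =
     assoc M (As ! i) A (bigT M (remove_nth i As)) \<cdot>\<^bsub>M\<^esub>
     (braid M A (As ! i) \<odot>\<^bsub>M\<^esub> Idn M (bigT M (remove_nth i As))) \<cdot>\<^bsub>M\<^esub>
     ainv M A (As ! i) (bigT M (remove_nth i As)) \<cdot>\<^bsub>M\<^esub>
     (Idn M A \<odot>\<^bsub>M\<^esub> pullT M i As)"

text \<open>Symmetry \<open>bigT As \<rightarrow> bigT (map (nth As) js)\<close>, for \<open>js\<close> a rearrangement of
  \<open>[0..<length As]\<close>. The factor \<open>As ! j\<close> is pulled to the front and the remaining indices
  are renumbered.\<close>

fun permT :: "('o, 'm, 'z) smcat_scheme \<Rightarrow> 'o list \<Rightarrow> nat list \<Rightarrow> 'm" where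
  "permT M As [] = Idn M (unt M)"
| "permT M As (j # js) =
     (Idn M (As ! j) \<odot>\<^bsub>M\<^esub>
        permT M (remove_nth j As) (map (\<lambda>i. if j < i then i - 1 else i) js)) \<cdot>\<^bsub>M\<^esub>
     pullT M j As"


section \<open>Operads and right modules\<close>

text \<open>
  Inputs are numbered from 0, and \<open>\<Sigma>\<^sub>n\<close> is the set of permutations of \<open>{..<n}\<close>. It acts from
  the right, and \<open>x \<sigma>\<close> is to be read as the operation
  \<open>(x \<sigma>)(a\<^sub>0, \<dots>, a\<^sub>n\<^sub>-\<^sub>1) = x(a\<^bsub>\<sigma>\<inverse>(0)\<^esub>, \<dots>, a\<^bsub>\<sigma>\<inverse>(n-1)\<^esub>)\<close>; all equivariance conditions below follow
  from this reading.
\<close>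

type_synonym perm = "nat \<Rightarrow> nat"

definition inv_list :: "nat \<Rightarrow> perm \<Rightarrow> nat list" where
  "inv_list n \<sigma> = map (inv \<sigma>) [0..<n]"

definition offset :: "nat list \<Rightarrow> nat \<Rightarrow> nat" where
  "offset ns i = sum_list (take i ns)"

definition block_of :: "nat list \<Rightarrow> nat \<Rightarrow> nat" where
  "block_of ns p = (LEAST i. p < offset ns (Suc i))"

text \<open>\<open>block_perm ns \<sigma>\<close> moves the \<open>i\<close>-th block (of size \<open>ns ! i\<close>) to block position \<open>\<sigma> i\<close>;
  \<open>sum_perm ns \<tau>s\<close> is the block sum \<open>\<tau>\<^sub>0 \<oplus> \<dots> \<oplus> \<tau>\<^sub>k\<^sub>-\<^sub>1\<close>.\<close>

definition block_perm :: "nat list \<Rightarrow> perm \<Rightarrow> perm" where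
  "block_perm ns \<sigma> p =
     (if p < sum_list ns
      then offset (map (nth ns) (inv_list (length ns) \<sigma>)) (\<sigma> (block_of ns p))
             + (p - offset ns (block_of ns p))
      else p)"

definition sum_perm :: "nat list \<Rightarrow> perm list \<Rightarrow> perm" where
  "sum_perm ns \<tau>s p =
     (if p < sum_list ns
      then offset ns (block_of ns p) + (\<tau>s ! block_of ns p) (p - offset ns (block_of ns p))
      else p)"

definition perms_for :: "nat list \<Rightarrow> perm list \<Rightarrow> bool" where
  "perms_for ns \<tau>s \<longleftrightarrow> length \<tau>s = length ns \<and> (\<forall>i<length ns. \<tau>s ! i permutes {..<ns ! i})"

record ('o, 'm) operad =
  pob :: "nat \<Rightarrow> 'o"
  pact :: "nat \<Rightarrow> perm \<Rightarrow> 'm"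
  pgam :: "nat list \<Rightarrow> 'm"
  peta :: 'm

record ('o, 'm) seqmod =
  xob :: "nat \<Rightarrow> 'o"
  xact :: "nat \<Rightarrow> perm \<Rightarrow> 'm"
  xmu :: "nat list \<Rightarrow> 'm"

definition symmetric_sequence ::
  "('o, 'm, 'z) smcat_scheme \<Rightarrow> (nat \<Rightarrow> 'o) \<Rightarrow> (nat \<Rightarrow> perm \<Rightarrow> 'm) \<Rightarrow> bool" where
  "symmetric_sequence M X act \<longleftrightarrow>
     (\<forall>n. X n \<in> Obj M) \<and>
     (\<forall>n \<sigma>. \<sigma> permutes {..<n} \<longrightarrow> act n \<sigma> \<in> Hom M (X n) (X n)) \<and>
     (\<forall>n. act n id = Idn M (X n)) \<and>
     (\<forall>n \<sigma> \<tau>. \<sigma> permutes {..<n} \<and> \<tau> permutes {..<n} \<longrightarrow>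
        act n (\<sigma> \<circ> \<tau>) = act n \<tau> \<cdot>\<^bsub>M\<^esub> act n \<sigma>)"

text \<open>\<open>mu_dom M P X [n\<^sub>1, \<dots>, n\<^sub>k] = X\<^sub>k \<otimes> (P(n\<^sub>1) \<otimes> \<dots> \<otimes> P(n\<^sub>k))\<close>\<close>

definition mu_dom ::
  "('o, 'm, 'z) smcat_scheme \<Rightarrow> ('o, 'm) operad \<Rightarrow> ('o, 'm) seqmod \<Rightarrow> nat list \<Rightarrow> 'o" where
  "mu_dom M P X ns = xob X (length ns) \<otimes>\<^bsub>M\<^esub> bigT M (map (pob P) ns)"

text \<open>The two composites of the associativity square involve, besides the structure map of the
  module, only the following morphisms. In \<open>X\<^sub>k \<otimes> \<Otimes>\<^sub>i P(n\<^sub>i) \<otimes> \<Otimes>\<^sub>i \<Otimes>\<^sub>j P(m\<^sub>i\<^sub>j)\<close> the numbers are given by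
  the list of lists \<open>mss\<close>, and \<open>n\<^sub>i = length (mss ! i)\<close>.\<close>

definition inner_dom ::
  "('o, 'm, 'z) smcat_scheme \<Rightarrow> ('o, 'm) operad \<Rightarrow> nat list list \<Rightarrow> 'o" where
  "inner_dom M P mss = bigT M (map (\<lambda>ms. bigT M (map (pob P) ms)) mss)"

definition inner_flat ::
  "('o, 'm, 'z) smcat_scheme \<Rightarrow> ('o, 'm) operad \<Rightarrow> nat list list \<Rightarrow> 'm" where
  "inner_flat M P mss = flatT M (map (map (pob P)) mss)"

definition inner_gam ::
  "('o, 'm, 'z) smcat_scheme \<Rightarrow> ('o, 'm) operad \<Rightarrow> nat list list \<Rightarrow> 'm" where
  "inner_gam M P mss =
     bigM M (map (pgam P) mss) \<cdot>\<^bsub>M\<^esub>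
     zipT M (map (\<lambda>ms. pob P (length ms)) mss) (map (\<lambda>ms. bigT M (map (pob P) ms)) mss)"

definition right_module ::
  "('o, 'm, 'z) smcat_scheme \<Rightarrow> ('o, 'm) operad \<Rightarrow> ('o, 'm) seqmod \<Rightarrow> bool" where
  "right_module M P X \<longleftrightarrow>
     symmetric_sequence M (xob X) (xact X) \<and>
     (\<forall>ns. xmu X ns \<in> Hom M (mu_dom M P X ns) (xob X (sum_list ns))) \<and>
     \<comment> \<open>associativity\<close>
     (\<forall>mss.
        xmu X (concat mss) \<cdot>\<^bsub>M\<^esub>
          (Idn M (xob X (length (concat mss))) \<odot>\<^bsub>M\<^esub> inner_flat M P mss) \<cdot>\<^bsub>M\<^esub>
          (xmu X (map length mss) \<odot>\<^bsub>M\<^esub> Idn M (inner_dom M P mss)) =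
        xmu X (map sum_list mss) \<cdot>\<^bsub>M\<^esub>
          (Idn M (xob X (length mss)) \<odot>\<^bsub>M\<^esub> inner_gam M P mss) \<cdot>\<^bsub>M\<^esub>
          assoc M (xob X (length mss)) (bigT M (map (pob P) (map length mss)))
            (inner_dom M P mss)) \<and>
     \<comment> \<open>equivariance in \<open>X\<^sub>k\<close>\<close>
     (\<forall>ns \<sigma>. \<sigma> permutes {..<length ns} \<longrightarrow>
        xmu X ns \<cdot>\<^bsub>M\<^esub> (xact X (length ns) \<sigma> \<odot>\<^bsub>M\<^esub> Idn M (bigT M (map (pob P) ns))) =
        xact X (sum_list ns) (block_perm ns \<sigma>) \<cdot>\<^bsub>M\<^esub>
          xmu X (map (nth ns) (inv_list (length ns) \<sigma>)) \<cdot>\<^bsub>M\<^esub>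
          (Idn M (xob X (length ns)) \<odot>\<^bsub>M\<^esub>
             permT M (map (pob P) ns) (inv_list (length ns) \<sigma>))) \<and>
     \<comment> \<open>equivariance in the \<open>P(n\<^sub>i)\<close>\<close>
     (\<forall>ns \<tau>s. perms_for ns \<tau>s \<longrightarrow>
        xmu X ns \<cdot>\<^bsub>M\<^esub> (Idn M (xob X (length ns)) \<odot>\<^bsub>M\<^esub> bigM M (map2 (pact P) ns \<tau>s)) =
        xact X (sum_list ns) (sum_perm ns \<tau>s) \<cdot>\<^bsub>M\<^esub> xmu X ns) \<and>
     \<comment> \<open>unit\<close>
     (\<forall>n.
        xmu X (replicate n 1) \<cdot>\<^bsub>M\<^esub> (Idn M (xob X n) \<odot>\<^bsub>M\<^esub> bigM M (replicate n (peta P))) =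
        run M (xob X n) \<cdot>\<^bsub>M\<^esub> (Idn M (xob X n) \<odot>\<^bsub>M\<^esub> collapseT M n))"

text \<open>An operad is a symmetric sequence that is a right module over itself and satisfies the left
  unit law in addition.\<close>

definition is_operad :: "('o, 'm, 'z) smcat_scheme \<Rightarrow> ('o, 'm) operad \<Rightarrow> bool" where
  "is_operad M P \<longleftrightarrow>
     right_module M P \<lparr>xob = pob P, xact = pact P, xmu = pgam P\<rparr> \<and>
     peta P \<in> Hom M (unt M) (pob P 1) \<and>
     (\<forall>n. pgam P [n] \<cdot>\<^bsub>M\<^esub> (peta P \<odot>\<^bsub>M\<^esub> Idn M (pob P n \<otimes>\<^bsub>M\<^esub> unt M)) =
          run M (pob P n) \<cdot>\<^bsub>M\<^esub> lun M (pob P n \<otimes>\<^bsub>M\<^esub> unt M))"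


section \<open>Algebras over an operad\<close>

record ('o, 'm) palg =
  acar :: 'o
  astr :: "nat \<Rightarrow> 'm"

definition algs :: "('o, 'm, 'z) smcat_scheme \<Rightarrow> ('o, 'm) operad \<Rightarrow> ('o, 'm) palg set" where
  "algs M P = {A. acar A \<in> Obj M \<and>
     (\<forall>n. astr A n \<in> Hom M (pob P n \<otimes>\<^bsub>M\<^esub> bigT M (replicate n (acar A))) (acar A)) \<and>
     (\<forall>ns.
        astr A (sum_list ns) \<cdot>\<^bsub>M\<^esub>
          (Idn M (pob P (sum_list ns)) \<odot>\<^bsub>M\<^esub> flatT M (map (\<lambda>n. replicate n (acar A)) ns)) \<cdot>\<^bsub>M\<^esub>
          (pgam P ns \<odot>\<^bsub>M\<^esub> Idn M (bigT M (map (\<lambda>n. bigT M (replicate n (acar A))) ns))) =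
        astr A (length ns) \<cdot>\<^bsub>M\<^esub>
          (Idn M (pob P (length ns)) \<odot>\<^bsub>M\<^esub>
             (bigM M (map (astr A) ns) \<cdot>\<^bsub>M\<^esub>
              zipT M (map (pob P) ns) (map (\<lambda>n. bigT M (replicate n (acar A))) ns))) \<cdot>\<^bsub>M\<^esub>
          assoc M (pob P (length ns)) (bigT M (map (pob P) ns))
            (bigT M (map (\<lambda>n. bigT M (replicate n (acar A))) ns))) \<and>
     (\<forall>n \<sigma>. \<sigma> permutes {..<n} \<longrightarrow>
        astr A n \<cdot>\<^bsub>M\<^esub> (pact P n \<sigma> \<odot>\<^bsub>M\<^esub> Idn M (bigT M (replicate n (acar A)))) =
        astr A n \<cdot>\<^bsub>M\<^esub>
          (Idn M (pob P n) \<odot>\<^bsub>M\<^esub> permT M (replicate n (acar A)) (inv_list n \<sigma>))) \<and>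
     astr A 1 \<cdot>\<^bsub>M\<^esub> (peta P \<odot>\<^bsub>M\<^esub> Idn M (acar A \<otimes>\<^bsub>M\<^esub> unt M)) =
       run M (acar A) \<cdot>\<^bsub>M\<^esub> lun M (acar A \<otimes>\<^bsub>M\<^esub> unt M)}"

definition alghom ::
  "('o, 'm, 'z) smcat_scheme \<Rightarrow> ('o, 'm) operad \<Rightarrow> ('o, 'm) palg \<Rightarrow> ('o, 'm) palg \<Rightarrow> 'm set" where
  "alghom M P A B = {f \<in> Hom M (acar A) (acar B).
     \<forall>n. f \<cdot>\<^bsub>M\<^esub> astr A n = astr B n \<cdot>\<^bsub>M\<^esub> (Idn M (pob P n) \<odot>\<^bsub>M\<^esub> bigM M (replicate n f))}"

definition alg_list :: "('o, 'm, 'z) smcat_scheme \<Rightarrow> ('o, 'm) operad \<Rightarrow> nat \<Rightarrow> ('o, 'm) palg list set"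
  where "alg_list M P n = {As. length As = n \<and> set As \<subseteq> algs M P}"

definition is_coproduct ::
  "('o, 'm, 'z) smcat_scheme \<Rightarrow> ('o, 'm) operad \<Rightarrow> ('o, 'm) palg list
     \<Rightarrow> ('o, 'm) palg \<Rightarrow> (nat \<Rightarrow> 'm) \<Rightarrow> bool" where
  "is_coproduct M P As Q q \<longleftrightarrow>
     Q \<in> algs M P \<and> (\<forall>i<length As. q i \<in> alghom M P (As ! i) Q) \<and>
     (\<forall>B \<in> algs M P. \<forall>f. (\<forall>i<length As. f i \<in> alghom M P (As ! i) B) \<longrightarrow>
        (\<exists>!u. u \<in> alghom M P Q B \<and> (\<forall>i<length As. u \<cdot>\<^bsub>M\<^esub> q i = f i)))"

text \<open>A chosen coproduct of algebras; meaningful when one exists.\<close>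

definition cop :: "('o, 'm, 'z) smcat_scheme \<Rightarrow> ('o, 'm) operad \<Rightarrow> ('o, 'm) palg list \<Rightarrow> ('o, 'm) palg"
  where "cop M P As = fst (SOME (Q, q). is_coproduct M P As Q q)"

definition cop_in :: "('o, 'm, 'z) smcat_scheme \<Rightarrow> ('o, 'm) operad \<Rightarrow> ('o, 'm) palg list \<Rightarrow> nat \<Rightarrow> 'm"
  where "cop_in M P As = snd (SOME (Q, q). is_coproduct M P As Q q)"

definition cop_map ::
  "('o, 'm, 'z) smcat_scheme \<Rightarrow> ('o, 'm) operad \<Rightarrow> ('o, 'm) palg list \<Rightarrow> ('o, 'm) palg
     \<Rightarrow> (nat \<Rightarrow> 'm) \<Rightarrow> 'm" where
  "cop_map M P As B f = (THE u. u \<in> alghom M P (cop M P As) B \<and>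
     (\<forall>i<length As. u \<cdot>\<^bsub>M\<^esub> cop_in M P As i = f i))"

definition is_zero_alg ::
  "('o, 'm, 'z) smcat_scheme \<Rightarrow> ('o, 'm) operad \<Rightarrow> ('o, 'm) palg \<Rightarrow> bool" where
  "is_zero_alg M P Z \<longleftrightarrow> Z \<in> algs M P \<and>
     (\<forall>A \<in> algs M P. (\<exists>!f. f \<in> alghom M P A Z) \<and> (\<exists>!f. f \<in> alghom M P Z A))"

definition null_map ::
  "('o, 'm, 'z) smcat_scheme \<Rightarrow> ('o, 'm) operad \<Rightarrow> ('o, 'm) palg \<Rightarrow> ('o, 'm) palg \<Rightarrow> 'm" where
  "null_map M P A B = (THE f. \<exists>Z g h. is_zero_alg M P Z \<and> h \<in> alghom M P A Z \<and>
     g \<in> alghom M P Z B \<and> f = g \<cdot>\<^bsub>M\<^esub> h)"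


section \<open>Functors on algebras, cross-effects and derivatives\<close>

text \<open>The action on morphisms carries source and target, since the zero morphism belongs to every
  Hom-space.\<close>

record ('o, 'm) pfun =
  fo :: "('o, 'm) palg \<Rightarrow> 'o"
  fm :: "('o, 'm) palg \<Rightarrow> ('o, 'm) palg \<Rightarrow> 'm \<Rightarrow> 'm"

definition is_functor ::
  "('o, 'm, 'z) smcat_scheme \<Rightarrow> ('o, 'm) operad \<Rightarrow> ('o, 'm) pfun \<Rightarrow> bool" where
  "is_functor M P F \<longleftrightarrow>
     (\<forall>A \<in> algs M P. fo F A \<in> Obj M \<and> fm F A A (Idn M (acar A)) = Idn M (fo F A)) \<and>
     (\<forall>A \<in> algs M P. \<forall>B \<in> algs M P. \<forall>f \<in> alghom M P A B. fm F A B f \<in> Hom M (fo F A) (fo F B)) \<and>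
     (\<forall>A \<in> algs M P. \<forall>B \<in> algs M P. \<forall>C \<in> algs M P. \<forall>f \<in> alghom M P A B. \<forall>g \<in> alghom M P B C.
        fm F A C (g \<cdot>\<^bsub>M\<^esub> f) = fm F B C g \<cdot>\<^bsub>M\<^esub> fm F A B f)"

definition nat_trans ::
  "('o, 'm, 'z) smcat_scheme \<Rightarrow> ('o, 'm) operad \<Rightarrow> ('o, 'm) pfun \<Rightarrow> ('o, 'm) pfun
     \<Rightarrow> (('o, 'm) palg \<Rightarrow> 'm) set" where
  "nat_trans M P F G = {\<eta> \<in> extensional (algs M P).
     (\<forall>A \<in> algs M P. \<eta> A \<in> Hom M (fo F A) (fo G A)) \<and>
     (\<forall>A \<in> algs M P. \<forall>B \<in> algs M P. \<forall>f \<in> alghom M P A B.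
        \<eta> B \<cdot>\<^bsub>M\<^esub> fm F A B f = fm G A B f \<cdot>\<^bsub>M\<^esub> \<eta> A)}"

definition is_kernel ::
  "('o, 'm::zero, 'z) smcat_scheme \<Rightarrow> 'o \<Rightarrow> 'm set \<Rightarrow> 'o \<Rightarrow> 'm \<Rightarrow> bool" where
  "is_kernel M A S K k \<longleftrightarrow> K \<in> Obj M \<and> k \<in> Hom M K A \<and> (\<forall>f \<in> S. f \<cdot>\<^bsub>M\<^esub> k = 0) \<and>
     (\<forall>L \<in> Obj M. \<forall>l \<in> Hom M L A. (\<forall>f \<in> S. f \<cdot>\<^bsub>M\<^esub> l = 0) \<longrightarrow>
        (\<exists>!u. u \<in> Hom M L K \<and> k \<cdot>\<^bsub>M\<^esub> u = l))"

definition is_cokernel ::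
  "('o, 'm::zero, 'z) smcat_scheme \<Rightarrow> 'o \<Rightarrow> 'm \<Rightarrow> 'o \<Rightarrow> 'm \<Rightarrow> bool" where
  "is_cokernel M A f C c \<longleftrightarrow> C \<in> Obj M \<and> c \<in> Hom M A C \<and> c \<cdot>\<^bsub>M\<^esub> f = 0 \<and>
     (\<forall>D \<in> Obj M. \<forall>d \<in> Hom M A D. d \<cdot>\<^bsub>M\<^esub> f = 0 \<longrightarrow> (\<exists>!u. u \<in> Hom M C D \<and> u \<cdot>\<^bsub>M\<^esub> c = d))"

text \<open>The endomorphism of \<open>A\<^sub>0 \<squnion> \<dots> \<squnion> A\<^sub>n\<^sub>-\<^sub>1\<close> that is zero on \<open>A\<^sub>i\<close> and the inclusion on the
  other summands. It is the projection to the coproduct of the \<open>A\<^sub>j\<close> with \<open>j \<noteq> i\<close> followed by a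
  split monomorphism, hence has the same kernel under any functor as that projection.\<close>

definition kill ::
  "('o, 'm, 'z) smcat_scheme \<Rightarrow> ('o, 'm) operad \<Rightarrow> ('o, 'm) palg list \<Rightarrow> nat \<Rightarrow> 'm" where
  "kill M P As i = cop_map M P As (cop M P As)
     (\<lambda>j. if j = i then null_map M P (As ! i) (cop M P As) else cop_in M P As j)"

text \<open>The cross-effect \<open>cr\<^sub>nF(A\<^sub>0, \<dots>, A\<^sub>n\<^sub>-\<^sub>1)\<close>: the joint kernel of the maps from
  \<open>F(A\<^sub>0 \<squnion> \<dots> \<squnion> A\<^sub>n\<^sub>-\<^sub>1)\<close> to the values of \<open>F\<close> with one input omitted.\<close>

definition is_cross_effect ::
  "('o, 'm::zero, 'z) smcat_scheme \<Rightarrow> ('o, 'm) operad \<Rightarrow> ('o, 'm) pfun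
     \<Rightarrow> ('o, 'm) palg list \<Rightarrow> 'o \<Rightarrow> 'm \<Rightarrow> bool" where
  "is_cross_effect M P F As K k \<longleftrightarrow>
     is_kernel M (fo F (cop M P As))
       {fm F (cop M P As) (cop M P As) (kill M P As i) | i. i < length As} K k"

definition cr ::
  "('o, 'm::zero, 'z) smcat_scheme \<Rightarrow> ('o, 'm) operad \<Rightarrow> ('o, 'm) pfun \<Rightarrow> ('o, 'm) palg list \<Rightarrow> 'o"
  where "cr M P F As = fst (SOME (K, k). is_cross_effect M P F As K k)"

definition cr_in ::
  "('o, 'm::zero, 'z) smcat_scheme \<Rightarrow> ('o, 'm) operad \<Rightarrow> ('o, 'm) pfun \<Rightarrow> ('o, 'm) palg list \<Rightarrow> 'm"
  where "cr_in M P F As = snd (SOME (K, k). is_cross_effect M P F As K k)"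

definition has_cross_effects ::
  "('o, 'm::zero, 'z) smcat_scheme \<Rightarrow> ('o, 'm) operad \<Rightarrow> ('o, 'm) pfun \<Rightarrow> bool" where
  "has_cross_effects M P F \<longleftrightarrow> (\<exists>Z. is_zero_alg M P Z) \<and>
     (\<forall>n. \<forall>As \<in> alg_list M P n.
        (\<exists>Q q. is_coproduct M P As Q q) \<and> (\<exists>K k. is_cross_effect M P F As K k))"

text \<open>
  The cross-effect \<open>cr\<^sub>nF\<close> is a functor of \<open>n\<close> algebras, whereas the \<open>n\<close>-th derivative is an
  object \<open>X\<^sub>n\<close> of the base category, regarded as the functor
  \<open>X\<^sub>n(A\<^sub>0, \<dots>, A\<^sub>n\<^sub>-\<^sub>1) = X\<^sub>n \<otimes> A\<^sub>0 \<otimes> \<dots> \<otimes> A\<^sub>n\<^sub>-\<^sub>1\<close>.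
  The passage from one to the other is by universal property: \<open>X\<^sub>n\<close> represents the natural
  transformations from functors of this form to \<open>cr\<^sub>nF\<close>, that is, \<open>X\<^sub>n\<close> is the coefficient of
  the multilinear part of \<open>cr\<^sub>nF\<close>.
\<close>

definition multilinear_map ::
  "('o, 'm::zero, 'z) smcat_scheme \<Rightarrow> ('o, 'm) operad \<Rightarrow> ('o, 'm) pfun \<Rightarrow> nat
     \<Rightarrow> 'o \<Rightarrow> (('o, 'm) palg list \<Rightarrow> 'm) \<Rightarrow> bool" where
  "multilinear_map M P F n Y t \<longleftrightarrow> Y \<in> Obj M \<and>
     (\<forall>As \<in> alg_list M P n. t As \<in> Hom M (Y \<otimes>\<^bsub>M\<^esub> bigT M (map acar As)) (cr M P F As)) \<and>
     (\<forall>As \<in> alg_list M P n. \<forall>Bs \<in> alg_list M P n. \<forall>fs.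
        length fs = n \<and> (\<forall>i<n. fs ! i \<in> alghom M P (As ! i) (Bs ! i)) \<longrightarrow>
        cr_in M P F Bs \<cdot>\<^bsub>M\<^esub> t Bs \<cdot>\<^bsub>M\<^esub> (Idn M Y \<odot>\<^bsub>M\<^esub> bigM M fs) =
        fm F (cop M P As) (cop M P Bs)
            (cop_map M P As (cop M P Bs) (\<lambda>i. cop_in M P Bs i \<cdot>\<^bsub>M\<^esub> fs ! i))
          \<cdot>\<^bsub>M\<^esub> cr_in M P F As \<cdot>\<^bsub>M\<^esub> t As)"

definition is_derivative ::
  "('o, 'm::zero, 'z) smcat_scheme \<Rightarrow> ('o, 'm) operad \<Rightarrow> ('o, 'm) pfun \<Rightarrow> nat
     \<Rightarrow> 'o \<Rightarrow> (('o, 'm) palg list \<Rightarrow> 'm) \<Rightarrow> bool" where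
  "is_derivative M P F n X k \<longleftrightarrow> multilinear_map M P F n X k \<and>
     (\<forall>Y t. multilinear_map M P F n Y t \<longrightarrow>
        (\<exists>!u. u \<in> Hom M Y X \<and>
           (\<forall>As \<in> alg_list M P n. t As = k As \<cdot>\<^bsub>M\<^esub> (u \<odot>\<^bsub>M\<^esub> Idn M (bigT M (map acar As))))))"

definition der_ob ::
  "('o, 'm::zero, 'z) smcat_scheme \<Rightarrow> ('o, 'm) operad \<Rightarrow> ('o, 'm) pfun \<Rightarrow> nat \<Rightarrow> 'o" where
  "der_ob M P F n = fst (SOME (X, k). is_derivative M P F n X k)"

text \<open>The universal map, continued to \<open>F(A\<^sub>0 \<squnion> \<dots> \<squnion> A\<^sub>n\<^sub>-\<^sub>1)\<close>\<close>

definition der_in ::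
  "('o, 'm::zero, 'z) smcat_scheme \<Rightarrow> ('o, 'm) operad \<Rightarrow> ('o, 'm) pfun \<Rightarrow> nat
     \<Rightarrow> ('o, 'm) palg list \<Rightarrow> 'm" where
  "der_in M P F n As =
     cr_in M P F As \<cdot>\<^bsub>M\<^esub> (snd (SOME (X, k). is_derivative M P F n X k)) As"

text \<open>The action of \<open>\<Sigma>\<^sub>n\<close> on the derivative by permuting the inputs of the cross-effect\<close>

definition der_act ::
  "('o, 'm::zero, 'z) smcat_scheme \<Rightarrow> ('o, 'm) operad \<Rightarrow> ('o, 'm) pfun \<Rightarrow> nat \<Rightarrow> perm \<Rightarrow> 'm" where
  "der_act M P F n \<sigma> = (THE a. a \<in> Hom M (der_ob M P F n) (der_ob M P F n) \<and>
     (\<forall>As \<in> alg_list M P n.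
        let As' = map (nth As) (inv_list n \<sigma>) in
        der_in M P F n As \<cdot>\<^bsub>M\<^esub> (a \<odot>\<^bsub>M\<^esub> Idn M (bigT M (map acar As))) =
        fm F (cop M P As') (cop M P As)
            (cop_map M P As' (cop M P As) (\<lambda>i. cop_in M P As (inv \<sigma> i)))
          \<cdot>\<^bsub>M\<^esub> der_in M P F n As'
          \<cdot>\<^bsub>M\<^esub> (Idn M (der_ob M P F n) \<odot>\<^bsub>M\<^esub> permT M (map acar As) (inv_list n \<sigma>))))"

definition der_seq ::
  "('o, 'm::zero, 'z) smcat_scheme \<Rightarrow> ('o, 'm) operad \<Rightarrow> ('o, 'm) pfun \<Rightarrow> (nat list \<Rightarrow> 'm)
     \<Rightarrow> ('o, 'm) seqmod" where
  "der_seq M P F \<mu> = \<lparr>xob = der_ob M P F, xact = der_act M P F, xmu = \<mu>\<rparr>"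

definition operadically_compatible ::
  "('o, 'm::zero, 'z) smcat_scheme \<Rightarrow> ('o, 'm) operad \<Rightarrow> ('o, 'm) pfun \<Rightarrow> bool" where
  "operadically_compatible M P F \<longleftrightarrow> has_cross_effects M P F \<and>
     (\<forall>n. \<exists>X k. is_derivative M P F n X k) \<and>
     (\<exists>\<mu>. right_module M P (der_seq M P F \<mu>))"


section \<open>Spectrally analytic functors\<close>

text \<open>
  The Hochschild object \<open>Hoch(A)\<close>, the relative tensor product \<open>\<otimes>\<^sub>P\<close> and the analytic realization
  of objects as subsets of the complex plane are data of the base category. The operadic spectrum
  and its size are built from them.
\<close>

record ('o, 'm) spectral_data =
  hoch :: "('o, 'm) palg \<Rightarrow> 'o"
  tensP :: "'o \<Rightarrow> 'o \<Rightarrow> 'o"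
  realize :: "'o \<Rightarrow> complex set"

text \<open>The operad has a single colour \<open>c\<close>, with \<open>P(c;c) = P(1)\<close>.\<close>

definition op_spectrum ::
  "('o, 'm) operad \<Rightarrow> ('o, 'm) spectral_data \<Rightarrow> ('o, 'm) palg \<Rightarrow> complex set" where
  "op_spectrum P S A = realize S (tensP S (hoch S A) (pob P 1))"

text \<open>An empty spectrum has size 0.\<close>

definition spectral_size ::
  "('o, 'm) operad \<Rightarrow> ('o, 'm) spectral_data \<Rightarrow> ('o, 'm) palg \<Rightarrow> real" where
  "spectral_size P S A = Sup (insert 0 (cmod ` op_spectrum P S A))"

text \<open>If the spectrum is unbounded its size is infinite and the bound is void.\<close>

definition admissible ::
  "('o, 'm, 'z) nsmcat_scheme \<Rightarrow> ('o, 'm) operad \<Rightarrow> ('o, 'm) spectral_data \<Rightarrow> ('o, 'm) pfun \<Rightarrow> bool"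
  where "admissible M P S F \<longleftrightarrow>
     (\<exists>b :: real \<Rightarrow> real. mono_on {0..} b \<and>
        (\<forall>A \<in> algs M P. bounded (op_spectrum P S A) \<longrightarrow> onorm M (fo F A) \<le> b (spectral_size P S A)))"

text \<open>The composite \<open>cr\<^sub>nF(A, \<dots>, A) \<rightarrow> F(A \<squnion> \<dots> \<squnion> A) \<rightarrow> F(A)\<close> with the fold map\<close>

definition cr_fold ::
  "('o, 'm::zero, 'z) smcat_scheme \<Rightarrow> ('o, 'm) operad \<Rightarrow> ('o, 'm) pfun \<Rightarrow> nat \<Rightarrow> ('o, 'm) palg \<Rightarrow> 'm"
  where "cr_fold M P F n A =
     fm F (cop M P (replicate n A)) A (cop_map M P (replicate n A) A (\<lambda>i. Idn M (acar A)))
       \<cdot>\<^bsub>M\<^esub> cr_in M P F (replicate n A)"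

text \<open>
  The \<open>n\<close>-th stage \<open>F(A) \<rightarrow> T\<^sub>n\<close> of the Taylor tower is the cokernel of
  \<open>cr\<^sub>n\<^sub>+\<^sub>1F(A, \<dots>, A) \<rightarrow> F(A)\<close>, the universal quotient of degree at most \<open>n\<close>. The tower converges in
  norm when the norm of the remainder, the kernel of \<open>F(A) \<rightarrow> T\<^sub>n\<close>, tends to 0.
\<close>

definition spectrally_analytic ::
  "('o, 'm::zero, 'z) nsmcat_scheme \<Rightarrow> ('o, 'm) operad \<Rightarrow> ('o, 'm) pfun \<Rightarrow> bool" where
  "spectrally_analytic M P F \<longleftrightarrow> has_cross_effects M P F \<and>
     (\<forall>A \<in> algs M P. \<exists>T q R r.
        (\<forall>n. is_cokernel M (fo F A) (cr_fold M P F (Suc n) A) (T n) (q n) \<and>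
             is_kernel M (fo F A) {q n} (R n) (r n)) \<and>
        (\<lambda>n. onorm M (R n)) \<longlonglongrightarrow> 0)"

definition SpecAn ::
  "('o, 'm::zero, 'z) nsmcat_scheme \<Rightarrow> ('o, 'm) operad \<Rightarrow> ('o, 'm) spectral_data
     \<Rightarrow> ('o, 'm) pfun set" where
  "SpecAn M P S = {F. is_functor M P F \<and> admissible M P S F \<and>
     operadically_compatible M P F \<and> spectrally_analytic M P F}"


section \<open>Derivative algebras\<close>

definition derivative_algebra ::
  "('o, 'm, 'z) nsmcat_scheme \<Rightarrow> ('o, 'm) operad \<Rightarrow> ('o, 'm) seqmod \<Rightarrow> bool" where
  "derivative_algebra M P X \<longleftrightarrow> right_module M P X \<and>
     (\<exists>C \<rho>. 0 < C \<and> 0 < \<rho> \<and> (\<forall>n. onorm M (xob X n) \<le> C * \<rho> ^ n))"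

text \<open>\<open>c : X\<^sub>n \<otimes> A \<otimes> \<dots> \<otimes> A \<rightarrow> Y\<close> is invariant under \<open>\<Sigma>\<^sub>n\<close>.\<close>

definition sym_invariant ::
  "('o, 'm, 'z) smcat_scheme \<Rightarrow> ('o, 'm) seqmod \<Rightarrow> nat \<Rightarrow> ('o, 'm) palg \<Rightarrow> 'm \<Rightarrow> bool" where
  "sym_invariant M X n A c \<longleftrightarrow> (\<forall>\<sigma>. \<sigma> permutes {..<n} \<longrightarrow>
     c \<cdot>\<^bsub>M\<^esub> (xact X n \<sigma> \<odot>\<^bsub>M\<^esub> Idn M (bigT M (replicate n (acar A)))) =
     c \<cdot>\<^bsub>M\<^esub> (Idn M (xob X n) \<odot>\<^bsub>M\<^esub> permT M (replicate n (acar A)) (inv_list n \<sigma>)))"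

definition is_coinvariants ::
  "('o, 'm, 'z) smcat_scheme \<Rightarrow> ('o, 'm) seqmod \<Rightarrow> nat \<Rightarrow> ('o, 'm) palg \<Rightarrow> 'o \<Rightarrow> 'm \<Rightarrow> bool" where
  "is_coinvariants M X n A C c \<longleftrightarrow> C \<in> Obj M \<and>
     c \<in> Hom M (xob X n \<otimes>\<^bsub>M\<^esub> bigT M (replicate n (acar A))) C \<and> sym_invariant M X n A c \<and>
     (\<forall>D \<in> Obj M. \<forall>d \<in> Hom M (xob X n \<otimes>\<^bsub>M\<^esub> bigT M (replicate n (acar A))) D.
        sym_invariant M X n A d \<longrightarrow> (\<exists>!u. u \<in> Hom M C D \<and> u \<cdot>\<^bsub>M\<^esub> c = d))"

text \<open>The countable direct sum in the normed sense: it is universal for families of morphisms of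
  bounded norm. With unbounded families allowed, infinite sums would hardly ever exist.\<close>

definition is_direct_sum ::
  "('o, 'm, 'z) nsmcat_scheme \<Rightarrow> (nat \<Rightarrow> 'o) \<Rightarrow> 'o \<Rightarrow> (nat \<Rightarrow> 'm) \<Rightarrow> bool" where
  "is_direct_sum M C G j \<longleftrightarrow> G \<in> Obj M \<and> (\<forall>n. j n \<in> Hom M (C n) G) \<and>
     bdd_above (range (\<lambda>n. mnorm M (j n))) \<and>
     (\<forall>D \<in> Obj M. \<forall>f. (\<forall>n. f n \<in> Hom M (C n) D) \<and> bdd_above (range (\<lambda>n. mnorm M (f n))) \<longrightarrow>
        (\<exists>!u. u \<in> Hom M G D \<and> (\<forall>n. u \<cdot>\<^bsub>M\<^esub> j n = f n)))"

text \<open>\<open>G\<close> is the functor \<open>A \<mapsto> \<Oplus>\<^sub>n X\<^sub>n(A, \<dots>, A)\<^sub>s\<^sub>y\<^sub>m\<close>.\<close>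

definition is_series_functor ::
  "('o, 'm, 'z) nsmcat_scheme \<Rightarrow> ('o, 'm) operad \<Rightarrow> ('o, 'm) seqmod \<Rightarrow> ('o, 'm) pfun \<Rightarrow> bool" where
  "is_series_functor M P X G \<longleftrightarrow> is_functor M P G \<and>
     (\<exists>C c j.
        (\<forall>A \<in> algs M P. (\<forall>n. is_coinvariants M X n A (C A n) (c A n)) \<and>
           is_direct_sum M (C A) (fo G A) (j A)) \<and>
        (\<forall>A \<in> algs M P. \<forall>B \<in> algs M P. \<forall>f \<in> alghom M P A B. \<forall>n.
           fm G A B f \<cdot>\<^bsub>M\<^esub> j A n \<cdot>\<^bsub>M\<^esub> c A n =
           j B n \<cdot>\<^bsub>M\<^esub> c B n \<cdot>\<^bsub>M\<^esub> (Idn M (xob X n) \<odot>\<^bsub>M\<^esub> bigM M (replicate n f))))"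

definition DerAlg_int ::
  "('o, 'm::zero, 'z) nsmcat_scheme \<Rightarrow> ('o, 'm) operad \<Rightarrow> ('o, 'm) spectral_data
     \<Rightarrow> ('o, 'm) seqmod set" where
  "DerAlg_int M P S = {X. derivative_algebra M P X \<and>
     (\<exists>G \<in> SpecAn M P S. is_series_functor M P X G)}"

text \<open>Families of \<open>\<Sigma>\<^sub>n\<close>-equivariant maps \<open>X\<^sub>n \<rightarrow> Y\<^sub>n\<close>\<close>

definition equivariant_maps ::
  "('o, 'm, 'z) smcat_scheme \<Rightarrow> ('o, 'm) seqmod \<Rightarrow> ('o, 'm) seqmod \<Rightarrow> (nat \<Rightarrow> 'm) set" where
  "equivariant_maps M X Y = {h. (\<forall>n. h n \<in> Hom M (xob X n) (xob Y n)) \<and>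
     (\<forall>n \<sigma>. \<sigma> permutes {..<n} \<longrightarrow> h n \<cdot>\<^bsub>M\<^esub> xact X n \<sigma> = xact Y n \<sigma> \<cdot>\<^bsub>M\<^esub> h n)}"

definition module_hom ::
  "('o, 'm, 'z) smcat_scheme \<Rightarrow> ('o, 'm) operad \<Rightarrow> ('o, 'm) seqmod \<Rightarrow> ('o, 'm) seqmod
     \<Rightarrow> (nat \<Rightarrow> 'm) set" where
  "module_hom M P X Y = {h \<in> equivariant_maps M X Y.
     \<forall>ns. h (sum_list ns) \<cdot>\<^bsub>M\<^esub> xmu X ns =
       xmu Y ns \<cdot>\<^bsub>M\<^esub> (h (length ns) \<odot>\<^bsub>M\<^esub> Idn M (bigT M (map (pob P) ns)))}"


section \<open>The spectral derivative as an equivalence of categories\<close>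

text \<open>The symmetric sequence of derivatives is determined by \<open>F\<close>; the right module structure that
  \<open>F\<close> carries is given by the family \<open>\<mu>\<close>.\<close>

definition spec_deriv ::
  "('o, 'm::zero, 'z) smcat_scheme \<Rightarrow> ('o, 'm) operad \<Rightarrow> (('o, 'm) pfun \<Rightarrow> nat list \<Rightarrow> 'm)
     \<Rightarrow> ('o, 'm) pfun \<Rightarrow> ('o, 'm) seqmod" where
  "spec_deriv M P \<mu> F = der_seq M P F (\<mu> F)"

definition spec_deriv_map ::
  "('o, 'm::zero, 'z) smcat_scheme \<Rightarrow> ('o, 'm) operad \<Rightarrow> ('o, 'm) pfun \<Rightarrow> ('o, 'm) pfun
     \<Rightarrow> (('o, 'm) palg \<Rightarrow> 'm) \<Rightarrow> nat \<Rightarrow> 'm" where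
  "spec_deriv_map M P F G \<eta> n = (THE h. h \<in> Hom M (der_ob M P F n) (der_ob M P G n) \<and>
     (\<forall>As \<in> alg_list M P n.
        der_in M P G n As \<cdot>\<^bsub>M\<^esub> (h \<odot>\<^bsub>M\<^esub> Idn M (bigT M (map acar As))) =
        \<eta> (cop M P As) \<cdot>\<^bsub>M\<^esub> der_in M P F n As))"

text \<open>\<open>F \<mapsto> spec_deriv M P \<mu> F\<close> is well defined, fully faithful and essentially surjective.
  It preserves identities and composites because \<open>spec_deriv_map\<close> is given by a universal
  property.\<close>

definition spec_deriv_equivalence ::
  "('o, 'm::zero, 'z) nsmcat_scheme \<Rightarrow> ('o, 'm) operad \<Rightarrow> ('o, 'm) spectral_data
     \<Rightarrow> (('o, 'm) pfun \<Rightarrow> nat list \<Rightarrow> 'm) \<Rightarrow> bool" where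
  "spec_deriv_equivalence M P S \<mu> \<longleftrightarrow>
     (\<forall>F \<in> SpecAn M P S. spec_deriv M P \<mu> F \<in> DerAlg_int M P S) \<and>
     (\<forall>F \<in> SpecAn M P S. \<forall>G \<in> SpecAn M P S.
        bij_betw (spec_deriv_map M P F G) (nat_trans M P F G)
          (module_hom M P (spec_deriv M P \<mu> F) (spec_deriv M P \<mu> G))) \<and>
     (\<forall>Y \<in> DerAlg_int M P S. \<exists>F \<in> SpecAn M P S. \<exists>h \<in> module_hom M P (spec_deriv M P \<mu> F) Y.
        \<forall>n. is_iso M (xob (spec_deriv M P \<mu> F) n) (xob Y n) (h n))"


section \<open>Dual numbers and first-order deformations\<close>

text \<open>Extension of scalars to \<open>\<complex>[\<epsilon>]/(\<epsilon>\<^sup>2)\<close>: the pair \<open>(f, f')\<close> stands for \<open>f + \<epsilon> f'\<close>.\<close>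

definition dual :: "('o, 'm::ab_group_add, 'z) smcat_scheme \<Rightarrow> ('o, 'm \<times> 'm) smcat" where
  "dual M = \<lparr>Obj = Obj M,
     Hom = (\<lambda>A B. Hom M A B \<times> Hom M A B),
     Idn = (\<lambda>A. (Idn M A, 0)),
     cmp = (\<lambda>(g, g') (f, f'). (g \<cdot>\<^bsub>M\<^esub> f, (g \<cdot>\<^bsub>M\<^esub> f') + (g' \<cdot>\<^bsub>M\<^esub> f))),
     scl = (\<lambda>c (f, f'). (scl M c f, scl M c f')),
     tob = tob M,
     tmor = (\<lambda>(f, f') (g, g'). (f \<odot>\<^bsub>M\<^esub> g, (f \<odot>\<^bsub>M\<^esub> g') + (f' \<odot>\<^bsub>M\<^esub> g))),
     unt = unt M,
     assoc = (\<lambda>A B C. (assoc M A B C, 0)),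
     ainv = (\<lambda>A B C. (ainv M A B C, 0)),
     lun = (\<lambda>A. (lun M A, 0)),
     run = (\<lambda>A. (run M A, 0)),
     braid = (\<lambda>A B. (braid M A B, 0))\<rparr>"

definition dual_operad :: "('o, 'm::zero) operad \<Rightarrow> ('o, 'm \<times> 'm) operad" where
  "dual_operad P = \<lparr>pob = pob P, pact = (\<lambda>n \<sigma>. (pact P n \<sigma>, 0)),
     pgam = (\<lambda>ns. (pgam P ns, 0)), peta = (peta P, 0)\<rparr>"

definition dual_seq ::
  "('o, 'm::zero) seqmod \<Rightarrow> (nat list \<Rightarrow> 'm \<times> 'm) \<Rightarrow> ('o, 'm \<times> 'm) seqmod" where
  "dual_seq X \<nu> = \<lparr>xob = xob X, xact = (\<lambda>n \<sigma>. (xact X n \<sigma>, 0)), xmu = \<nu>\<rparr>"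

definition deformations ::
  "('o, 'm::ab_group_add, 'z) smcat_scheme \<Rightarrow> ('o, 'm) operad \<Rightarrow> ('o, 'm) seqmod
     \<Rightarrow> (nat list \<Rightarrow> 'm \<times> 'm) set" where
  "deformations M P X = {\<nu>. (\<forall>ns. fst (\<nu> ns) = xmu X ns) \<and>
     right_module (dual M) (dual_operad P) (dual_seq X \<nu>)}"

definition cochain0 ::
  "('o, 'm, 'z) smcat_scheme \<Rightarrow> ('o, 'm) seqmod \<Rightarrow> (nat \<Rightarrow> 'm) set" where
  "cochain0 M X = equivariant_maps M X X"

text \<open>\<open>T\<^sub>\<epsilon>\<inverse> \<circ> \<nu> \<circ> (T\<^sub>\<epsilon> \<otimes> id)\<close> for \<open>T\<^sub>\<epsilon> = id + \<epsilon> h\<close>, whose inverse is \<open>id - \<epsilon> h\<close>\<close>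

definition transport ::
  "('o, 'm::ab_group_add, 'z) smcat_scheme \<Rightarrow> ('o, 'm) operad \<Rightarrow> ('o, 'm) seqmod
     \<Rightarrow> (nat \<Rightarrow> 'm) \<Rightarrow> (nat list \<Rightarrow> 'm \<times> 'm) \<Rightarrow> nat list \<Rightarrow> 'm \<times> 'm" where
  "transport M P X h \<nu> ns =
     (Idn M (xob X (sum_list ns)), - h (sum_list ns)) \<cdot>\<^bsub>dual M\<^esub> \<nu> ns \<cdot>\<^bsub>dual M\<^esub>
     ((Idn M (xob X (length ns)), h (length ns)) \<odot>\<^bsub>dual M\<^esub>
        Idn (dual M) (bigT (dual M) (map (pob P) ns)))"

definition deformation_equiv ::
  "('o, 'm::ab_group_add, 'z) smcat_scheme \<Rightarrow> ('o, 'm) operad \<Rightarrow> ('o, 'm) seqmod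
     \<Rightarrow> ((nat list \<Rightarrow> 'm \<times> 'm) \<times> (nat list \<Rightarrow> 'm \<times> 'm)) set" where
  "deformation_equiv M P X = {(\<nu>, \<nu>'). \<nu> \<in> deformations M P X \<and> \<nu>' \<in> deformations M P X \<and>
     (\<exists>h \<in> cochain0 M X. \<nu>' = transport M P X h \<nu>)}"


section \<open>The deformation complex in low degrees\<close>

definition cochain1 ::
  "('o, 'm, 'z) smcat_scheme \<Rightarrow> ('o, 'm) operad \<Rightarrow> ('o, 'm) seqmod \<Rightarrow> (nat list \<Rightarrow> 'm) set" where
  "cochain1 M P X = {\<phi>. \<forall>ns. \<phi> ns \<in> Hom M (mu_dom M P X ns) (xob X (sum_list ns))}"

text \<open>A 2-cochain has one component for each instance of a right module identity.\<close>

datatype identity_index =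
    Assoc "nat list list"
  | EquivX "nat list" perm
  | EquivP "nat list" "perm list"
  | Unit nat

fun identity_hom ::
  "('o, 'm, 'z) smcat_scheme \<Rightarrow> ('o, 'm) operad \<Rightarrow> ('o, 'm) seqmod \<Rightarrow> identity_index \<Rightarrow> 'm set"
  where
  "identity_hom M P X (Assoc mss) =
     Hom M (mu_dom M P X (map length mss) \<otimes>\<^bsub>M\<^esub> inner_dom M P mss) (xob X (sum_list (concat mss)))"
| "identity_hom M P X (EquivX ns \<sigma>) = Hom M (mu_dom M P X ns) (xob X (sum_list ns))"
| "identity_hom M P X (EquivP ns \<tau>s) = Hom M (mu_dom M P X ns) (xob X (sum_list ns))"
| "identity_hom M P X (Unit n) =
     Hom M (xob X n \<otimes>\<^bsub>M\<^esub> bigT M (replicate n (unt M))) (xob X n)"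

definition cochain2 ::
  "('o, 'm, 'z) smcat_scheme \<Rightarrow> ('o, 'm) operad \<Rightarrow> ('o, 'm) seqmod
     \<Rightarrow> (identity_index \<Rightarrow> 'm) set" where
  "cochain2 M P X = {\<psi>. \<forall>r. \<psi> r \<in> identity_hom M P X r}"

definition diff0 ::
  "('o, 'm::ab_group_add, 'z) smcat_scheme \<Rightarrow> ('o, 'm) operad \<Rightarrow> ('o, 'm) seqmod
     \<Rightarrow> (nat \<Rightarrow> 'm) \<Rightarrow> nat list \<Rightarrow> 'm" where
  "diff0 M P X h ns = snd (transport M P X h (\<lambda>ns. (xmu X ns, 0)) ns)"

text \<open>The linearization at \<open>xmu X\<close> of the difference of the two sides of each identity in
  \<open>right_module\<close>. The right hand side of the unit identity does not involve the structure map.\<close>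

fun diff1 ::
  "('o, 'm::ab_group_add, 'z) smcat_scheme \<Rightarrow> ('o, 'm) operad \<Rightarrow> ('o, 'm) seqmod
     \<Rightarrow> (nat list \<Rightarrow> 'm) \<Rightarrow> identity_index \<Rightarrow> 'm" where
  "diff1 M P X \<phi> (Assoc mss) =
     (\<phi> (concat mss) \<cdot>\<^bsub>M\<^esub>
        (Idn M (xob X (length (concat mss))) \<odot>\<^bsub>M\<^esub> inner_flat M P mss) \<cdot>\<^bsub>M\<^esub>
        (xmu X (map length mss) \<odot>\<^bsub>M\<^esub> Idn M (inner_dom M P mss)))
     + (xmu X (concat mss) \<cdot>\<^bsub>M\<^esub>
        (Idn M (xob X (length (concat mss))) \<odot>\<^bsub>M\<^esub> inner_flat M P mss) \<cdot>\<^bsub>M\<^esub>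
        (\<phi> (map length mss) \<odot>\<^bsub>M\<^esub> Idn M (inner_dom M P mss)))
     - (\<phi> (map sum_list mss) \<cdot>\<^bsub>M\<^esub>
        (Idn M (xob X (length mss)) \<odot>\<^bsub>M\<^esub> inner_gam M P mss) \<cdot>\<^bsub>M\<^esub>
        assoc M (xob X (length mss)) (bigT M (map (pob P) (map length mss)))
          (inner_dom M P mss))"
| "diff1 M P X \<phi> (EquivX ns \<sigma>) =
     (if \<sigma> permutes {..<length ns} then
        (\<phi> ns \<cdot>\<^bsub>M\<^esub> (xact X (length ns) \<sigma> \<odot>\<^bsub>M\<^esub> Idn M (bigT M (map (pob P) ns))))
        - (xact X (sum_list ns) (block_perm ns \<sigma>) \<cdot>\<^bsub>M\<^esub>
            \<phi> (map (nth ns) (inv_list (length ns) \<sigma>)) \<cdot>\<^bsub>M\<^esub>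
            (Idn M (xob X (length ns)) \<odot>\<^bsub>M\<^esub>
               permT M (map (pob P) ns) (inv_list (length ns) \<sigma>)))
      else 0)"
| "diff1 M P X \<phi> (EquivP ns \<tau>s) =
     (if perms_for ns \<tau>s then
        (\<phi> ns \<cdot>\<^bsub>M\<^esub> (Idn M (xob X (length ns)) \<odot>\<^bsub>M\<^esub> bigM M (map2 (pact P) ns \<tau>s)))
        - (xact X (sum_list ns) (sum_perm ns \<tau>s) \<cdot>\<^bsub>M\<^esub> \<phi> ns)
      else 0)"
| "diff1 M P X \<phi> (Unit n) =
     \<phi> (replicate n 1) \<cdot>\<^bsub>M\<^esub> (Idn M (xob X n) \<odot>\<^bsub>M\<^esub> bigM M (replicate n (peta P)))"

definition Z1 ::
  "('o, 'm::ab_group_add, 'z) smcat_scheme \<Rightarrow> ('o, 'm) operad \<Rightarrow> ('o, 'm) seqmod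
     \<Rightarrow> (nat list \<Rightarrow> 'm) set" where
  "Z1 M P X = {\<phi> \<in> cochain1 M P X. diff1 M P X \<phi> = 0}"

definition B1 ::
  "('o, 'm::ab_group_add, 'z) smcat_scheme \<Rightarrow> ('o, 'm) operad \<Rightarrow> ('o, 'm) seqmod
     \<Rightarrow> (nat list \<Rightarrow> 'm) set" where
  "B1 M P X = diff0 M P X ` cochain0 M X"

definition cohomologous ::
  "('o, 'm::ab_group_add, 'z) smcat_scheme \<Rightarrow> ('o, 'm) operad \<Rightarrow> ('o, 'm) seqmod
     \<Rightarrow> ((nat list \<Rightarrow> 'm) \<times> (nat list \<Rightarrow> 'm)) set" where
  "cohomologous M P X = {(\<phi>, \<psi>). \<phi> \<in> Z1 M P X \<and> \<psi> \<in> Z1 M P X \<and> \<phi> - \<psi> \<in> B1 M P X}"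

definition H1 ::
  "('o, 'm::ab_group_add, 'z) smcat_scheme \<Rightarrow> ('o, 'm) operad \<Rightarrow> ('o, 'm) seqmod
     \<Rightarrow> (nat list \<Rightarrow> 'm) set set" where
  "H1 M P X = Z1 M P X // cohomologous M P X"


section \<open>Vector space structures and the tangent space\<close>

definition cochain_scl ::
  "('o, 'm, 'z) smcat_scheme \<Rightarrow> complex \<Rightarrow> ('i \<Rightarrow> 'm) \<Rightarrow> 'i \<Rightarrow> 'm" where
  "cochain_scl M c \<phi> = (\<lambda>i. scl M c (\<phi> i))"

text \<open>Deformations form a vector space with the undeformed structure as origin:
  \<open>(\<mu> + \<epsilon> \<phi>) + (\<mu> + \<epsilon> \<psi>) = \<mu> + \<epsilon> (\<phi> + \<psi>)\<close>, and likewise for scalar multiples.\<close>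

definition deformation_add ::
  "('o, 'm::plus) seqmod \<Rightarrow> (nat list \<Rightarrow> 'm \<times> 'm) \<Rightarrow> (nat list \<Rightarrow> 'm \<times> 'm)
     \<Rightarrow> nat list \<Rightarrow> 'm \<times> 'm" where
  "deformation_add X \<nu> \<nu>' = (\<lambda>ns. (xmu X ns, snd (\<nu> ns) + snd (\<nu>' ns)))"

definition deformation_scl ::
  "('o, 'm, 'z) smcat_scheme \<Rightarrow> ('o, 'm) seqmod \<Rightarrow> complex \<Rightarrow> (nat list \<Rightarrow> 'm \<times> 'm)
     \<Rightarrow> nat list \<Rightarrow> 'm \<times> 'm" where
  "deformation_scl M X c \<nu> = (\<lambda>ns. (xmu X ns, scl M c (snd (\<nu> ns))))"

text \<open>Operations induced on equivalence classes\<close>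

definition class_op1 :: "('a \<times> 'a) set \<Rightarrow> ('a \<Rightarrow> 'a) \<Rightarrow> 'a set \<Rightarrow> 'a set" where
  "class_op1 R f a = (\<Union>x \<in> a. R `` {f x})"

definition class_op2 :: "('a \<times> 'a) set \<Rightarrow> ('a \<Rightarrow> 'a \<Rightarrow> 'a) \<Rightarrow> 'a set \<Rightarrow> 'a set \<Rightarrow> 'a set" where
  "class_op2 R f a b = (\<Union>x \<in> a. \<Union>y \<in> b. R `` {f x y})"

text \<open>First-order deformations of \<open>F\<close>, transported to its spectral derivative\<close>

definition Def_eps ::
  "('o, 'm::ab_group_add, 'z) smcat_scheme \<Rightarrow> ('o, 'm) operad
     \<Rightarrow> (('o, 'm) pfun \<Rightarrow> nat list \<Rightarrow> 'm) \<Rightarrow> ('o, 'm) pfun \<Rightarrow> (nat list \<Rightarrow> 'm \<times> 'm) set" where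
  "Def_eps M P \<mu> F = deformations M P (spec_deriv M P \<mu> F)"

definition Def_equiv ::
  "('o, 'm::ab_group_add, 'z) smcat_scheme \<Rightarrow> ('o, 'm) operad
     \<Rightarrow> (('o, 'm) pfun \<Rightarrow> nat list \<Rightarrow> 'm) \<Rightarrow> ('o, 'm) pfun
     \<Rightarrow> ((nat list \<Rightarrow> 'm \<times> 'm) \<times> (nat list \<Rightarrow> 'm \<times> 'm)) set" where
  "Def_equiv M P \<mu> F = deformation_equiv M P (spec_deriv M P \<mu> F)"

definition tangent_space ::
  "('o, 'm::ab_group_add, 'z) smcat_scheme \<Rightarrow> ('o, 'm) operad
     \<Rightarrow> (('o, 'm) pfun \<Rightarrow> nat list \<Rightarrow> 'm) \<Rightarrow> ('o, 'm) pfun \<Rightarrow> (nat list \<Rightarrow> 'm \<times> 'm) set set" where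
  "tangent_space M P \<mu> F = Def_eps M P \<mu> F // Def_equiv M P \<mu> F"

end

theory Submission
  imports Defs
begin

text \<open>
  Over the dual numbers each module identity for \<open>\<mu> + \<epsilon> \<phi>\<close> splits into the identity for \<open>\<mu>\<close> and its
  linearization, which is the corresponding component of \<open>d\<phi> = 0\<close>; this needs that the coherence
  morphisms over the dual numbers have no \<open>\<epsilon>\<close>-part. Transport along \<open>id + \<epsilon> h\<close> adds
  \<open>dh = \<mu> (h \<otimes> id) - h \<mu>\<close> to \<open>\<phi>\<close>, and \<open>d(dh) = 0\<close> follows from the module identities for \<open>\<mu>\<close> and the
  naturality of the associator and the right unitor.
\<close>

subsection \<open>Block permutations\<close>

text \<open>The category axioms constrain composition and tensor only on Hom-spaces of one ambient
  group, so even \<open>0 \<cdot> f = 0\<close> is available only for a typed \<open>f\<close>.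
  Every factor of a module identity must therefore be typed before anything is expanded. For the
  actions by \<open>block_perm\<close> and \<open>sum_perm\<close> this means showing that they
  permute the right initial segment, since a symmetric sequence promises nothing about other
  functions; hence the combinatorics at the start. Associativity is quadratic in the structure map:
  it occurs twice on the left and once on the right, which produces the three terms of the
  corresponding component of \<open>diff1\<close>. The other identities contain it at most once on
  each side. Transports are never composed or inverted. Equivalence of deformations is pulled back
  along the bijection with cocycles, where reflexivity, symmetry and transitivity say that the
  coboundaries contain 0 and are closed under negation and addition. The same bijection, applied to
  whole classes by direct image, gives the isomorphism with \<open>H1\<close>.\<close>

lemma offset_Suc: "i < length ns \<Longrightarrow> offset ns (Suc i) = offset ns i + ns ! i"
  by (simp add: offset_def take_Suc_conv_app_nth)

lemma offset_mono: "i \<le> j \<Longrightarrow> offset ns i \<le> offset ns j"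
  unfolding offset_def by (metis le_add1 le_add_diff_inverse sum_list_append take_add)

lemma offset_length: "length ns \<le> i \<Longrightarrow> offset ns i = sum_list ns"
  by (simp add: offset_def)

text \<open>Any earlier block ends at or before \<open>offset ns i\<close>, which the position has
  already reached. The bound on \<open>r\<close> also excludes empty blocks.\<close>

lemma block_of_offset:
  assumes "i < length ns" "r < ns ! i"
  shows "block_of ns (offset ns i + r) = i"
  unfolding block_of_def
proof (rule Least_equality)
  show "offset ns i + r < offset ns (Suc i)"
    using assms by (simp add: offset_Suc)
  show "i \<le> j" if "offset ns i + r < offset ns (Suc j)" for j
  proof (rule ccontr)
    assume "\<not> i \<le> j"
    then have "offset ns (Suc j) \<le> offset ns i"
      by (intro offset_mono) simp
    with that show False by simp
  qed
qed

lemma offset_add_less: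
  assumes "i < length ns" "r < ns ! i"
  shows "offset ns i + r < sum_list ns"
proof -
  have "offset ns i + r < offset ns (Suc i)"
    using assms by (simp add: offset_Suc)
  also have "\<dots> \<le> offset ns (length ns)"
    using assms by (intro offset_mono) simp
  finally show ?thesis by (simp add: offset_length)
qed

text \<open>Together with \<open>block_of_offset\<close> this identifies positions with pairs of a
  block and a place in it, the coordinates in which both permutation lemmas below compute.\<close>

lemma block_decomposition:
  assumes "p < sum_list ns"
  obtains i r where "i < length ns" "r < ns ! i" "p = offset ns i + r"
proof -
  have "\<exists>i<length ns. offset ns i \<le> p \<and> p < offset ns (Suc i)"
  proof -
    \<comment> \<open>\<open>Suc (length ns - 1)\<close> is at least \<open>length ns\<close> even
      for empty \<open>ns\<close>, so the truncated subtraction is harmless and the offset is the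
      full sum.\<close>
    have ex: "p < offset ns (Suc (length ns - 1))"
      using assms by (simp add: offset_length)
    define i where "i = (LEAST i. p < offset ns (Suc i))"
    have 1: "p < offset ns (Suc i)"
      unfolding i_def by (rule LeastI[of "\<lambda>i. p < offset ns (Suc i)", OF ex])
    have 2: "offset ns i \<le> p"
    proof (cases i)
      case 0
      then show ?thesis by (simp add: offset_def)
    next
      case (Suc j)
      then show ?thesis
        using not_less_Least[of j "\<lambda>i. p < offset ns (Suc i)"] i_def by simp
    qed
    have "i < length ns"
      using 2 assms offset_length[of ns i] by (cases "i < length ns") auto
    with 1 2 show ?thesis by blast
  qed
  then obtain i where i: "i < length ns" "offset ns i \<le> p" "p < offset ns (Suc i)"
    by blast
  show thesis
    by (rule that[of i "p - offset ns i"]) (use i in \<open>auto simp: offset_Suc\<close>)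
qed

text \<open>An injective self-map of a finite set is onto, so surjectivity never has to be checked
  by hand.\<close>

lemma permutes_lessThanI:
  fixes f :: "nat \<Rightarrow> nat"
  assumes "\<And>p. p < N \<Longrightarrow> f p < N" "inj_on f {..<N}" "\<And>p. \<not> p < N \<Longrightarrow> f p = p"
  shows "f permutes {..<N}"
proof (rule bij_imp_permutes)
  have "f ` {..<N} = {..<N}"
    using assms(1,2) by (intro endo_inj_surj) auto
  with assms(2) show "bij_betw f {..<N} {..<N}" by (simp add: bij_betw_def)
qed (use assms(3) in auto)

text \<open>Each block is mapped to itself, so equal images lie in the same block, and there
  injectivity of the component of \<open>\<tau>s\<close> decides.\<close>

lemma sum_perm_permutes:
  assumes "perms_for ns \<tau>s"
  shows "sum_perm ns \<tau>s permutes {..<sum_list ns}"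
proof -
  have \<tau>: "\<tau>s ! i permutes {..<ns ! i}" if "i < length ns" for i
    using assms that by (simp add: perms_for_def)
  have bound: "(\<tau>s ! i) r < ns ! i" if "i < length ns" "r < ns ! i" for i r
    using permutes_in_image[OF \<tau>[OF that(1)], of r] that by simp
  have val: "sum_perm ns \<tau>s (offset ns i + r) = offset ns i + (\<tau>s ! i) r"
    if "i < length ns" "r < ns ! i" for i r
    using that by (simp add: sum_perm_def block_of_offset offset_add_less)
  show ?thesis
  proof (rule permutes_lessThanI)
    fix p assume "p < sum_list ns"
    then obtain i r where "i < length ns" "r < ns ! i" "p = offset ns i + r"
      by (rule block_decomposition)
    then show "sum_perm ns \<tau>s p < sum_list ns"
      by (simp add: val offset_add_less bound)
  next
    show "inj_on (sum_perm ns \<tau>s) {..<sum_list ns}"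
    proof (rule inj_onI)
      fix p q
      assume p: "p \<in> {..<sum_list ns}" and q: "q \<in> {..<sum_list ns}"
        and eq: "sum_perm ns \<tau>s p = sum_perm ns \<tau>s q"
      obtain i r where i: "i < length ns" "r < ns ! i" "p = offset ns i + r"
        using p by (auto elim: block_decomposition)
      obtain j s where j: "j < length ns" "s < ns ! j" "q = offset ns j + s"
        using q by (auto elim: block_decomposition)
      have e: "offset ns i + (\<tau>s ! i) r = offset ns j + (\<tau>s ! j) s"
        using eq i j by (simp add: val)
      then have "i = j"
        using block_of_offset[OF i(1) bound[OF i(1,2)]] block_of_offset[OF j(1) bound[OF j(1,2)]]
        by simp
      with e have "(\<tau>s ! i) r = (\<tau>s ! i) s" by simp
      then have "r = s"
        using permutes_inj[OF \<tau>[OF i(1)]] by (simp add: inj_eq)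
      with \<open>i = j\<close> i j show "p = q" by simp
    qed
  qed (simp add: sum_perm_def)
qed

lemma length_inv_list [simp]: "length (inv_list n \<sigma>) = n"
  by (simp add: inv_list_def)

lemma set_inv_list: "\<sigma> permutes {..<n} \<Longrightarrow> set (inv_list n \<sigma>) = {..<n}"
  by (simp add: inv_list_def permutes_inv permutes_image atLeast0LessThan)

lemma distinct_inv_list: "\<sigma> permutes {..<n} \<Longrightarrow> distinct (inv_list n \<sigma>)"
  by (simp add: inv_list_def distinct_map inj_on_subset[OF permutes_inj[OF permutes_inv]])

lemma sum_list_inv_list:
  fixes ns :: "nat list"
  assumes "\<sigma> permutes {..<length ns}"
  shows "sum_list (map (nth ns) (inv_list (length ns) \<sigma>)) = sum_list ns"
proof -
  have "sum_list (map (nth ns) (inv_list (length ns) \<sigma>)) = (\<Sum>i<length ns. ns ! i)"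
    using assms by (simp add: sum_list_distinct_conv_sum_set distinct_inv_list set_inv_list)
  then show ?thesis
    by (simp add: sum_list_sum_nth lessThan_atLeast0)
qed

text \<open>In the rearranged list \<open>ns'\<close> the block at position
  \<open>\<sigma> i\<close> has size \<open>ns ! i\<close>. The image of block \<open>i\<close> thus
  fits exactly into block \<open>\<sigma> i\<close> of \<open>ns'\<close>, and the block index of an
  image recovers \<open>\<sigma> i\<close>, hence \<open>i\<close>.\<close>

lemma block_perm_permutes:
  assumes \<sigma>: "\<sigma> permutes {..<length ns}"
  shows "block_perm ns \<sigma> permutes {..<sum_list ns}"
proof -
  define ns' where "ns' = map (nth ns) (inv_list (length ns) \<sigma>)"
  have len: "length ns' = length ns" by (simp add: ns'_def)
  have sum: "sum_list ns' = sum_list ns"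
    unfolding ns'_def by (rule sum_list_inv_list[OF \<sigma>])
  have bound: "\<sigma> i < length ns'" if "i < length ns" for i
    using permutes_in_image[OF \<sigma>, of i] that len by simp
  have nth: "ns' ! \<sigma> i = ns ! i" if "i < length ns" for i
    using bound[OF that] len permutes_inverses(2)[OF \<sigma>]
    by (simp add: ns'_def inv_list_def)
  have val: "block_perm ns \<sigma> (offset ns i + r) = offset ns' (\<sigma> i) + r"
    if "i < length ns" "r < ns ! i" for i r
    using that by (simp add: block_perm_def block_of_offset offset_add_less ns'_def)
  show ?thesis
  proof (rule permutes_lessThanI)
    fix p assume "p < sum_list ns"
    then obtain i r where "i < length ns" "r < ns ! i" "p = offset ns i + r"
      by (rule block_decomposition)
    then show "block_perm ns \<sigma> p < sum_list ns"
      using offset_add_less[of "\<sigma> i" ns' r] by (simp add: val nth bound sum)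
  next
    show "inj_on (block_perm ns \<sigma>) {..<sum_list ns}"
    proof (rule inj_onI)
      fix p q
      assume p: "p \<in> {..<sum_list ns}" and q: "q \<in> {..<sum_list ns}"
        and eq: "block_perm ns \<sigma> p = block_perm ns \<sigma> q"
      obtain i r where i: "i < length ns" "r < ns ! i" "p = offset ns i + r"
        using p by (auto elim: block_decomposition)
      obtain j s where j: "j < length ns" "s < ns ! j" "q = offset ns j + s"
        using q by (auto elim: block_decomposition)
      have e: "offset ns' (\<sigma> i) + r = offset ns' (\<sigma> j) + s"
        using eq i j by (simp add: val)
      then have "\<sigma> i = \<sigma> j"
        using block_of_offset[of "\<sigma> i" ns' r] block_of_offset[of "\<sigma> j" ns' s] i j
        by (simp add: bound nth)
      moreover from this have "i = j"
        using permutes_inj[OF \<sigma>] by (simp add: inj_eq)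
      ultimately show "p = q" using e i j by simp
    qed
  qed (simp add: block_perm_def)
qed

section \<open>Renumbering indices after one list entry is removed\<close>

lemma nth_remove_nth:
  assumes "j < length xs" "i < length xs" "i \<noteq> j"
  shows "remove_nth j xs ! (if j < i then i - 1 else i) = xs ! i"
  using assms by (auto simp: remove_nth_def nth_append min_def)

lemma length_remove_nth: "j < length xs \<Longrightarrow> length (remove_nth j xs) = length xs - 1"
  by (simp add: remove_nth_def min_def)

lemma set_remove_nth: "set (remove_nth j xs) \<subseteq> set xs"
  by (auto simp: remove_nth_def dest: in_set_takeD in_set_dropD)

lemma remove_nth_0 [simp]: "remove_nth 0 (x # xs) = xs"
  and remove_nth_Suc [simp]: "remove_nth (Suc i) (x # xs) = x # remove_nth i xs"
  by (simp_all add: remove_nth_def)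

text \<open>This keeps the recursive call of \<open>permT\<close> meaningful. Shifting down the
  indices above \<open>j\<close> could only collide with \<open>j\<close> itself, which does not
  occur in \<open>js\<close>; counting then turns the inclusion of the new indices in the shorter
  segment into equality.\<close>

lemma renumber_arrangement:
  fixes js :: "nat list"
  defines "f j \<equiv> \<lambda>i. if j < i then i - 1 else i"
  assumes dist: "distinct (j # js)" and set: "set (j # js) = {..<Suc n}"
  shows "distinct (map (f j) js)" "set (map (f j) js) = {..<n}"
proof -
  have inj: "inj_on (f j) (set js)"
  proof (rule inj_onI)
    fix x y assume "x \<in> set js" "y \<in> set js" "f j x = f j y"
    moreover from this have "x \<noteq> j" "y \<noteq> j" using dist by auto
    ultimately show "x = y" by (simp add: f_def split: if_splits)
  qed
  show d: "distinct (map (f j) js)"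
    using dist inj by (simp add: distinct_map)
  have "card (set (j # js)) = Suc n" using set by simp
  then have "length js = n" using dist by (metis distinct_card length_Cons nat.inject)
  moreover have "set (map (f j) js) \<subseteq> {..<n}"
  proof
    fix k assume "k \<in> set (map (f j) js)"
    then obtain i where i: "i \<in> set js" "k = f j i" by auto
    have "i < Suc n" "j < Suc n" "i \<noteq> j" using i set dist by auto
    then show "k \<in> {..<n}" using i by (auto simp: f_def)
  qed
  ultimately show "set (map (f j) js) = {..<n}"
    using d by (intro card_subset_eq) (auto simp: distinct_card simp del: set_map)
qed

subsection \<open>Well-typed composites\<close>

context linear_smc
begin

sublocale vs: vector_space "scl M"
  by (rule scl_vs)

text \<open>The axioms ask separately for the objects and for membership in the Hom-space. With
  these bundled, each algebraic law needs one premise per morphism.\<close>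

definition arr :: "'m \<Rightarrow> 'o \<Rightarrow> 'o \<Rightarrow> bool" where
  "arr f A B \<longleftrightarrow> A \<in> Obj M \<and> B \<in> Obj M \<and> f \<in> Hom M A B"

lemma arr_dom: "arr f A B \<Longrightarrow> A \<in> Obj M"
  and arr_cod: "arr f A B \<Longrightarrow> B \<in> Obj M"
  and arr_Hom: "arr f A B \<Longrightarrow> f \<in> Hom M A B"
  by (simp_all add: arr_def)

lemma arr_zero: "A \<in> Obj M \<Longrightarrow> B \<in> Obj M \<Longrightarrow> arr 0 A B"
  and arr_add: "arr f A B \<Longrightarrow> arr g A B \<Longrightarrow> arr (f + g) A B"
  and arr_diff: "arr f A B \<Longrightarrow> arr g A B \<Longrightarrow> arr (f - g) A B"
  and arr_neg: "arr f A B \<Longrightarrow> arr (- f) A B"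
  and arr_scl: "arr f A B \<Longrightarrow> arr (scl M c f) A B"
  using Hom_sub[of A B]
  by (auto simp: arr_def intro: vs.subspace_0 vs.subspace_add vs.subspace_diff vs.subspace_neg
      vs.subspace_scale)

lemma arr_cmp: "arr f A B \<Longrightarrow> arr g B C \<Longrightarrow> arr (g \<cdot> f) A C"
  by (auto simp: arr_def intro: cmp_in)

lemma arr_tmor: "arr f A B \<Longrightarrow> arr g C D \<Longrightarrow> arr (f \<odot> g) (A \<otimes> C) (B \<otimes> D)"
  by (auto simp: arr_def intro: tmor_in tob_in)

lemma arr_Idn: "A \<in> Obj M \<Longrightarrow> arr (Idn M A) A A"
  by (simp add: arr_def Idn_in)

lemma arr_assoc: "\<lbrakk>A \<in> Obj M; B \<in> Obj M; C \<in> Obj M\<rbrakk>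
    \<Longrightarrow> arr (assoc M A B C) ((A \<otimes> B) \<otimes> C) (A \<otimes> (B \<otimes> C))"
  and arr_ainv: "\<lbrakk>A \<in> Obj M; B \<in> Obj M; C \<in> Obj M\<rbrakk>
    \<Longrightarrow> arr (ainv M A B C) (A \<otimes> (B \<otimes> C)) ((A \<otimes> B) \<otimes> C)"
  and arr_braid: "\<lbrakk>A \<in> Obj M; B \<in> Obj M\<rbrakk> \<Longrightarrow> arr (braid M A B) (A \<otimes> B) (B \<otimes> A)"
  and arr_lun: "A \<in> Obj M \<Longrightarrow> arr (lun M A) (unt M \<otimes> A) A"
  and arr_run: "A \<in> Obj M \<Longrightarrow> arr (run M A) (A \<otimes> unt M) A"
  using lun_iso[of A] run_iso[of A]
  by (auto simp: arr_def assoc_in ainv_in braid_in unt_in is_iso_def intro!: tob_in)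

lemma add_cmp: "arr f A B \<Longrightarrow> arr g B C \<Longrightarrow> arr g' B C \<Longrightarrow> (g + g') \<cdot> f = (g \<cdot> f) + (g' \<cdot> f)"
  and cmp_add: "arr f A B \<Longrightarrow> arr f' A B \<Longrightarrow> arr g B C \<Longrightarrow> g \<cdot> (f + f') = (g \<cdot> f) + (g \<cdot> f')"
  and add_tmor: "arr f A B \<Longrightarrow> arr f' A B \<Longrightarrow> arr g C D \<Longrightarrow> (f + f') \<odot> g = (f \<odot> g) + (f' \<odot> g)"
  and scl_cmp: "arr f A B \<Longrightarrow> arr g B C \<Longrightarrow> scl M c g \<cdot> f = scl M c (g \<cdot> f)"
  and cmp_scl: "arr f A B \<Longrightarrow> arr g B C \<Longrightarrow> g \<cdot> scl M c f = scl M c (g \<cdot> f)"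
  and scl_tmor: "arr f A B \<Longrightarrow> arr g C D \<Longrightarrow> scl M c f \<odot> g = scl M c (f \<odot> g)"
  and tmor_scl: "arr f A B \<Longrightarrow> arr g C D \<Longrightarrow> f \<odot> scl M c g = scl M c (f \<odot> g)"
  by (auto simp: arr_def cmp_add_left cmp_add_right tmor_add_left cmp_scl_left cmp_scl_right
      tmor_scl_left tmor_scl_right)

text \<open>Absorption is not an axiom. It follows by pulling the scalar 0 out of a composite, with
  0 read as an endomorphism so that it has a type; the three laws below use the same device.\<close>

lemma zero_cmp: "arr f A B \<Longrightarrow> 0 \<cdot> f = 0"
  using scl_cmp[of f A B 0 B 0] by (simp add: arr_zero arr_cod)

lemma cmp_zero: "arr g B C \<Longrightarrow> g \<cdot> 0 = 0"
  using cmp_scl[of 0 B B g C 0] by (simp add: arr_zero arr_dom)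

lemma zero_tmor: "arr g C D \<Longrightarrow> 0 \<odot> g = 0"
  using scl_tmor[of 0 C C g C D 0] by (simp add: arr_zero arr_dom)

lemma tmor_zero: "arr g C D \<Longrightarrow> g \<odot> 0 = 0"
  using tmor_scl[of g C D 0 C C 0] by (simp add: arr_zero arr_dom)

lemma neg_cmp: "arr f A B \<Longrightarrow> arr g B C \<Longrightarrow> (- g) \<cdot> f = - (g \<cdot> f)"
  using add_cmp[of f A B g C "- g"] by (simp add: arr_neg zero_cmp add_eq_0_iff)

lemma cmp_neg: "arr f A B \<Longrightarrow> arr g B C \<Longrightarrow> g \<cdot> (- f) = - (g \<cdot> f)"
  using cmp_add[of f A B "- f" g C] by (simp add: arr_neg cmp_zero add_eq_0_iff)

lemma neg_tmor: "arr f A B \<Longrightarrow> arr g C D \<Longrightarrow> (- f) \<odot> g = - (f \<odot> g)"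
  using add_tmor[of f A B "- f" g C D] by (simp add: arr_neg zero_tmor add_eq_0_iff)

lemma diff_cmp: "arr f A B \<Longrightarrow> arr g B C \<Longrightarrow> arr g' B C \<Longrightarrow> (g - g') \<cdot> f = (g \<cdot> f) - (g' \<cdot> f)"
  using add_cmp[of f A B g C "- g'"] by (simp add: arr_neg neg_cmp)

lemma cmp_diff: "arr f A B \<Longrightarrow> arr f' A B \<Longrightarrow> arr g B C \<Longrightarrow> g \<cdot> (f - f') = (g \<cdot> f) - (g \<cdot> f')"
  using cmp_add[of f A B "- f'" g C] by (simp add: arr_neg cmp_neg)

lemma diff_tmor: "arr f A B \<Longrightarrow> arr f' A B \<Longrightarrow> arr g C D \<Longrightarrow> (f - f') \<odot> g = (f \<odot> g) - (f' \<odot> g)"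
  using add_tmor[of f A B "- f'" g C D] by (simp add: arr_neg neg_tmor)

lemma cmp_cmp: "arr f A B \<Longrightarrow> arr g B C \<Longrightarrow> arr h C D \<Longrightarrow> (h \<cdot> g) \<cdot> f = h \<cdot> g \<cdot> f"
  by (auto simp: arr_def intro: cmp_assoc)

lemma cmp_Idn_arr: "arr f A B \<Longrightarrow> f \<cdot> Idn M A = f"
  and Idn_cmp_arr: "arr f A B \<Longrightarrow> Idn M B \<cdot> f = f"
  by (auto simp: arr_def intro: cmp_Idn Idn_cmp)

lemma tmor_cmp_arr: "\<lbrakk>arr f A B; arr g B C; arr f' A' B'; arr g' B' C'\<rbrakk>
    \<Longrightarrow> (g \<cdot> f) \<odot> (g' \<cdot> f') = (g \<odot> g') \<cdot> (f \<odot> f')"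
  unfolding arr_def using tmor_cmp by blast

text \<open>Both sides equal \<open>f \<odot> g\<close>. This is what later lets a map on the module
  factor slide past any map on the operad factors.\<close>

lemma tmor_interchange:
  assumes "arr f A B" "arr g C D"
  shows "(f \<odot> Idn M D) \<cdot> (Idn M A \<odot> g) = (Idn M B \<odot> g) \<cdot> (f \<odot> Idn M C)"
  using tmor_cmp_arr[of "Idn M A" A A f B g C D "Idn M D" D]
    tmor_cmp_arr[of f A B "Idn M B" B "Idn M C" C C g D] assms
  by (simp add: arr_Idn arr_dom arr_cod cmp_Idn_arr Idn_cmp_arr)

lemma tmor_Idn_cmp:
  assumes "arr f A B" "arr g B C" "D \<in> Obj M"
  shows "(g \<cdot> f) \<odot> Idn M D = (g \<odot> Idn M D) \<cdot> (f \<odot> Idn M D)"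
  using tmor_cmp_arr[OF assms(1,2), of "Idn M D" D D "Idn M D" D] assms(3)
  by (simp add: arr_Idn Idn_cmp_arr[OF arr_Idn])

end

subsection \<open>Coherence morphisms over the dual numbers\<close>

lemma dual_simps [simp]:
  "Obj (dual M) = Obj M" "Hom (dual M) A B = Hom M A B \<times> Hom M A B"
  "Idn (dual M) A = (Idn M A, 0)" "tob (dual M) = tob M" "unt (dual M) = unt M"
  "assoc (dual M) A B C = (assoc M A B C, 0)" "ainv (dual M) A B C = (ainv M A B C, 0)"
  "lun (dual M) A = (lun M A, 0)" "run (dual M) A = (run M A, 0)"
  "braid (dual M) A B = (braid M A B, 0)"
  "(g, g') \<cdot>\<^bsub>dual M\<^esub> (f, f') = (g \<cdot>\<^bsub>M\<^esub> f, (g \<cdot>\<^bsub>M\<^esub> f') + (g' \<cdot>\<^bsub>M\<^esub> f))"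
  "(f, f') \<odot>\<^bsub>dual M\<^esub> (h, h') = (f \<odot>\<^bsub>M\<^esub> h, (f \<odot>\<^bsub>M\<^esub> h') + (f' \<odot>\<^bsub>M\<^esub> h))"
  by (simp_all add: dual_def)

lemma bigT_dual [simp]: "bigT (dual M) As = bigT M As"
  by (induction As) simp_all

context linear_smc
begin

text \<open>The zero components of composites over the dual numbers vanish only on well-typed arguments,
  so typing and scalar extension are established together.\<close>

definition lifts :: "'m \<times> 'm \<Rightarrow> 'm \<Rightarrow> 'o \<Rightarrow> 'o \<Rightarrow> bool" where
  "lifts f' f A B \<longleftrightarrow> f' = (f, 0) \<and> arr f A B"

lemma liftsI: "arr f A B \<Longrightarrow> lifts (f, 0) f A B"
  and lifts_eq: "lifts f' f A B \<Longrightarrow> f' = (f, 0)"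
  and lifts_arr: "lifts f' f A B \<Longrightarrow> arr f A B"
  by (simp_all add: lifts_def)

lemma lifts_cmp: "lifts f' f A B \<Longrightarrow> lifts g' g B C \<Longrightarrow> lifts (g' \<cdot>\<^bsub>dual M\<^esub> f') (g \<cdot> f) A C"
  by (auto simp: lifts_def zero_cmp cmp_zero intro: arr_cmp)

lemma lifts_tmor:
  "lifts f' f A B \<Longrightarrow> lifts g' g C D \<Longrightarrow> lifts (f' \<odot>\<^bsub>dual M\<^esub> g') (f \<odot> g) (A \<otimes> C) (B \<otimes> D)"
  by (auto simp: lifts_def zero_tmor tmor_zero intro: arr_tmor)

lemmas lifts_Idn = liftsI[OF arr_Idn]
  and lifts_assoc = liftsI[OF arr_assoc]
  and lifts_ainv = liftsI[OF arr_ainv]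
  and lifts_braid = liftsI[OF arr_braid]
  and lifts_lun = liftsI[OF arr_lun]
  and lifts_run = liftsI[OF arr_run]

lemma bigT_obj: "set As \<subseteq> Obj M \<Longrightarrow> bigT M As \<in> Obj M"
  by (induction As) (auto simp: unt_in tob_in)

text \<open>Stated for families over an arbitrary index list, so that one induction serves
  \<open>pgam\<close> over lists of arities, \<open>pact\<close> over zipped lists and the constant
  family \<open>peta\<close>.\<close>

lemma lifts_bigM:
  assumes "\<And>x. x \<in> set xs \<Longrightarrow> lifts (f' x) (f x) (A x) (B x)"
  shows "lifts (bigM (dual M) (map f' xs)) (bigM M (map f xs)) (bigT M (map A xs)) (bigT M (map B xs))"
  using assms by (induction xs) (auto simp: lifts_Idn unt_in lifts_tmor)

lemma lifts_joinT:
  assumes "set As \<subseteq> Obj M" "set Bs \<subseteq> Obj M"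
  shows "lifts (joinT (dual M) As Bs) (joinT M As Bs) (bigT M As \<otimes> bigT M Bs) (bigT M (As @ Bs))"
  using assms(1)
proof (induction As)
  case Nil
  then show ?case using assms(2) by (simp add: lifts_lun bigT_obj)
next
  case (Cons A As)
  then show ?case using assms(2)
    by (auto simp del: dual_simps(11,12)
        intro!: lifts_cmp[OF lifts_assoc] lifts_tmor lifts_Idn bigT_obj)
qed

lemma lifts_flatT:
  assumes "\<And>As. As \<in> set Ass \<Longrightarrow> set As \<subseteq> Obj M"
  shows "lifts (flatT (dual M) Ass) (flatT M Ass) (bigT M (map (bigT M) Ass)) (bigT M (concat Ass))"
  using assms
proof (induction Ass)
  case (Cons As Ass)
  then have "set As \<subseteq> Obj M" "set (concat Ass) \<subseteq> Obj M"
    and IH: "lifts (flatT (dual M) Ass) (flatT M Ass)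
      (bigT M (map (bigT M) Ass)) (bigT M (concat Ass))"
    by auto
  then show ?case
    by (auto intro!: lifts_cmp[OF lifts_tmor[OF lifts_Idn IH] lifts_joinT] bigT_obj)
qed (simp add: lifts_Idn unt_in)

lemma lifts_mid4:
  assumes "A \<in> Obj M" "B \<in> Obj M" "C \<in> Obj M" "D \<in> Obj M"
  shows "lifts (mid4 (dual M) A B C D) (mid4 M A B C D)
    ((A \<otimes> B) \<otimes> (C \<otimes> D)) ((A \<otimes> C) \<otimes> (B \<otimes> D))"
  unfolding mid4_def dual_simps(1-10) using assms
  by (intro lifts_cmp[OF lifts_cmp[OF lifts_assoc lifts_tmor[OF lifts_Idn
            lifts_cmp[OF lifts_cmp[OF lifts_ainv lifts_tmor[OF lifts_braid lifts_Idn]] lifts_assoc]]]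
        lifts_ainv] tob_in)

lemma lifts_zipT:
  assumes "length As = length Bs" "set As \<subseteq> Obj M" "set Bs \<subseteq> Obj M"
  shows "lifts (zipT (dual M) As Bs) (zipT M As Bs)
    (bigT M As \<otimes> bigT M Bs) (bigT M (map2 (tob M) As Bs))"
  using assms
proof (induction As Bs rule: list_induct2)
  case (Cons A As B Bs)
  then show ?case
    by (auto simp del: dual_simps(11,12)
        intro!: lifts_cmp[OF lifts_mid4] lifts_tmor lifts_Idn tob_in bigT_obj)
qed (simp add: lifts_lun unt_in)

lemma bigT_replicate_obj: "A \<in> Obj M \<Longrightarrow> bigT M (replicate n A) \<in> Obj M"
  by (rule bigT_obj) auto

lemma lifts_collapseT:
  "lifts (collapseT (dual M) n) (collapseT M n) (bigT M (replicate n (unt M))) (unt M)"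
  by (induction n) (auto intro: lifts_Idn unt_in lifts_cmp[OF lifts_lun] bigT_replicate_obj)

lemma lifts_pullT:
  assumes "i < length As" "set As \<subseteq> Obj M"
  shows "lifts (pullT (dual M) i As) (pullT M i As)
    (bigT M As) ((As ! i) \<otimes> bigT M (remove_nth i As))"
  using assms
proof (induction i arbitrary: As)
  case 0
  then show ?case by (cases As) (auto intro!: lifts_Idn tob_in bigT_obj)
next
  case (Suc i)
  then obtain B Bs where As: "As = B # Bs" "i < length Bs" "B \<in> Obj M" "set Bs \<subseteq> Obj M"
    by (cases As) auto
  then have "Bs ! i \<in> Obj M" "bigT M (remove_nth i Bs) \<in> Obj M"
    using set_remove_nth[of i Bs] by (auto intro: bigT_obj)
  then show ?case using As Suc.IH[of Bs]
    by (auto simp del: dual_simps(11,12)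
        intro!: lifts_cmp[OF lifts_cmp[OF lifts_cmp[OF lifts_tmor[OF lifts_Idn] lifts_ainv]
            lifts_tmor[OF lifts_braid lifts_Idn]] lifts_assoc])
qed

lemma nth_renumber:
  assumes "distinct (j # js)" "set (j # js) = {..<length xs}"
  shows "map (nth (remove_nth j xs)) (map (\<lambda>i. if j < i then i - 1 else i) js) = map (nth xs) js"
proof -
  have "remove_nth j xs ! (if j < i then i - 1 else i) = xs ! i" if "i \<in> set js" for i
  proof (rule nth_remove_nth)
    show "j < length xs" using assms(2) by auto
    show "i < length xs" "i \<noteq> j" using assms that by auto
  qed
  then show ?thesis by simp
qed

text \<open>The recursion of \<open>permT\<close> changes both arguments: one factor is removed from
  \<open>As\<close> and the remaining indices are renumbered. The induction therefore runs over the
  common length with both arbitrary, and \<open>nth_renumber\<close> shows that the codomain of the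
  recursive call is the tail of the required one.\<close>

lemma lifts_permT:
  assumes "distinct js" "set js = {..<length As}" "set As \<subseteq> Obj M"
  shows "lifts (permT (dual M) As js) (permT M As js) (bigT M As) (bigT M (map (nth As) js))"
  using assms
proof (induction "length js" arbitrary: js As)
  case 0
  then have "js = []" "As = []" by (auto simp: lessThan_empty_iff)
  then show ?case by (simp add: lifts_Idn unt_in)
next
  case (Suc n)
  then obtain j js0 where js: "js = j # js0" "length js0 = n"
    by (cases js) auto
  note prems = Suc.prems[unfolded js(1)]
  define As' where "As' = remove_nth j As"
  define js' where "js' = map (\<lambda>i. if j < i then i - 1 else i) js0"
  have j: "j < length As" using prems(2) by auto
  then have len: "length As = Suc (length As')"
    by (simp add: As'_def length_remove_nth)
  have js': "distinct js'" "set js' = {..<length As'}"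
    unfolding js'_def using prems(1) prems(2)[unfolded len] by (rule renumber_arrangement)+
  have As': "set As' \<subseteq> Obj M"
    unfolding As'_def using set_remove_nth prems(3) by (rule order_trans)
  have map: "map (nth As') js' = map (nth As) js0"
    unfolding As'_def js'_def using prems(1,2) by (rule nth_renumber)
  have pull: "lifts (pullT (dual M) j As) (pullT M j As) (bigT M As) ((As ! j) \<otimes> bigT M As')"
    using lifts_pullT[OF j prems(3)] by (simp add: As'_def)
  have perm: "lifts (permT (dual M) As' js') (permT M As' js')
      (bigT M As') (bigT M (map (nth As) js0))"
    using Suc.hyps(1)[OF _ js' As', unfolded map] js Suc.hyps(2) by (simp add: js'_def)
  have "As ! j \<in> Obj M" using j prems(3) by auto
  then show ?case
    unfolding js(1) permT.simps As'_def[symmetric] js'_def[symmetric] list.map bigT.simps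
      dual_simps(3)
    by (intro lifts_cmp[OF pull lifts_tmor[OF lifts_Idn[unfolded dual_simps] perm]])
qed

end

subsection \<open>The constituents of the module identities\<close>

lemma dual_operad_simps [simp]:
  "pob (dual_operad P) = pob P" "pact (dual_operad P) n \<sigma> = (pact P n \<sigma>, 0)"
  "pgam (dual_operad P) ns = (pgam P ns, 0)" "peta (dual_operad P) = (peta P, 0)"
  by (simp_all add: dual_operad_def)

lemma dual_seq_simps [simp]:
  "xob (dual_seq X \<nu>) = xob X" "xact (dual_seq X \<nu>) n \<sigma> = (xact X n \<sigma>, 0)"
  "xmu (dual_seq X \<nu>) = \<nu>"
  by (simp_all add: dual_seq_def)

lemma mu_dom_dual [simp]: "mu_dom (dual M) (dual_operad P) (dual_seq X \<nu>) ns = mu_dom M P X ns"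
  by (simp add: mu_dom_def)

lemma inner_dom_dual [simp]: "inner_dom (dual M) (dual_operad P) mss = inner_dom M P mss"
  by (simp add: inner_dom_def)

text \<open>The algebraic core is carried out for an arbitrary right module \<open>X\<close>; the
  spectral derivative of \<open>F\<close> is substituted in the final theorem.\<close>

locale module_smc = linear_smc M
  for M :: "('o, 'm::ab_group_add, 'z) smcat_scheme" (structure) +
  fixes P :: "('o, 'm) operad" and X :: "('o, 'm) seqmod"
  assumes operad: "is_operad M P" and module: "right_module M P X"
begin

abbreviation P_tensor :: "nat list \<Rightarrow> 'o" where
  "P_tensor ns \<equiv> bigT M (map (pob P) ns)"

lemma pob_obj: "pob P n \<in> Obj M"
  and arr_pact: "\<sigma> permutes {..<n} \<Longrightarrow> arr (pact P n \<sigma>) (pob P n) (pob P n)"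
  and arr_pgam: "arr (pgam P ns) (pob P (length ns) \<otimes> P_tensor ns) (pob P (sum_list ns))"
  and arr_peta: "arr (peta P) (unt M) (pob P 1)"
proof -
  have P: "right_module M P \<lparr>xob = pob P, xact = pact P, xmu = pgam P\<rparr>"
    and eta: "peta P \<in> Hom M (unt M) (pob P 1)"
    using operad by (simp_all add: is_operad_def)
  have sym: "symmetric_sequence M (pob P) (pact P)"
    and gam: "pgam P ns \<in> Hom M (pob P (length ns) \<otimes> P_tensor ns) (pob P (sum_list ns))" for ns
    using P by (simp_all add: right_module_def mu_dom_def)
  show obj: "pob P n \<in> Obj M" for n
    using sym by (simp add: symmetric_sequence_def)
  show "\<sigma> permutes {..<n} \<Longrightarrow> arr (pact P n \<sigma>) (pob P n) (pob P n)"
    using sym by (simp add: symmetric_sequence_def arr_def)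
  show "arr (pgam P ns) (pob P (length ns) \<otimes> P_tensor ns) (pob P (sum_list ns))"
    using gam obj by (auto simp: arr_def intro!: tob_in bigT_obj)
  show "arr (peta P) (unt M) (pob P 1)"
    using eta obj by (simp add: arr_def unt_in)
qed

lemma P_tensor_obj: "P_tensor ns \<in> Obj M"
  by (rule bigT_obj) (auto simp: pob_obj)

lemma inner_dom_obj: "inner_dom M P mss \<in> Obj M"
  unfolding inner_dom_def by (rule bigT_obj) (auto simp: P_tensor_obj)

lemma symmetric_X: "symmetric_sequence M (xob X) (xact X)"
  using module by (simp add: right_module_def)

lemma xob_obj: "xob X n \<in> Obj M"
  and arr_xact: "\<sigma> permutes {..<n} \<Longrightarrow> arr (xact X n \<sigma>) (xob X n) (xob X n)"
  using symmetric_X by (simp_all add: symmetric_sequence_def arr_def)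

lemma mu_dom_obj: "mu_dom M P X ns \<in> Obj M"
  unfolding mu_dom_def by (intro tob_in xob_obj P_tensor_obj)

lemma xmu_cochain1: "xmu X \<in> cochain1 M P X"
  using module by (simp add: right_module_def cochain1_def)

lemma arr_cochain1: "\<phi> \<in> cochain1 M P X \<Longrightarrow> arr (\<phi> ns) (mu_dom M P X ns) (xob X (sum_list ns))"
  by (simp add: cochain1_def arr_def xob_obj mu_dom_obj)

lemma lifts_inner_flat:
  "lifts (inner_flat (dual M) (dual_operad P) mss) (inner_flat M P mss)
     (inner_dom M P mss) (P_tensor (concat mss))"
proof -
  let ?Ass = "map (map (pob P)) mss"
  have "lifts (flatT (dual M) ?Ass) (flatT M ?Ass) (bigT M (map (bigT M) ?Ass)) (bigT M (concat ?Ass))"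
    by (rule lifts_flatT) (auto simp: pob_obj)
  then show ?thesis
    by (simp add: inner_flat_def inner_dom_def comp_def map_concat)
qed

lemma lifts_inner_gam:
  "lifts (inner_gam (dual M) (dual_operad P) mss) (inner_gam M P mss)
     (P_tensor (map length mss) \<otimes> inner_dom M P mss) (P_tensor (map sum_list mss))"
proof -
  let ?A = "\<lambda>ms. pob P (length ms)" and ?B = "\<lambda>ms. P_tensor ms"
  have zip: "lifts (zipT (dual M) (map ?A mss) (map ?B mss)) (zipT M (map ?A mss) (map ?B mss))
     (P_tensor (map length mss) \<otimes> inner_dom M P mss) (bigT M (map (\<lambda>ms. ?A ms \<otimes> ?B ms) mss))"
    using lifts_zipT[of "map ?A mss" "map ?B mss"]
    by (simp add: image_subset_iff pob_obj P_tensor_obj inner_dom_def comp_def map2_map_map)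
  have "lifts (bigM (dual M) (map (\<lambda>ms. (pgam P ms, 0)) mss)) (bigM M (map (pgam P) mss))
     (bigT M (map (\<lambda>ms. ?A ms \<otimes> ?B ms) mss)) (bigT M (map (\<lambda>ms. pob P (sum_list ms)) mss))"
    by (intro lifts_bigM liftsI arr_pgam)
  then show ?thesis
    unfolding inner_gam_def using lifts_cmp[OF zip]
    by (simp add: comp_def dual_operad_def)
qed

abbreviation (input) reorder :: "nat list \<Rightarrow> perm \<Rightarrow> nat list" where
  "reorder ns \<sigma> \<equiv> map (nth ns) (inv_list (length ns) \<sigma>)"

lemma lifts_permT_inv_list:
  assumes "\<sigma> permutes {..<length ns}"
  shows "lifts (permT (dual M) (map (pob P) ns) (inv_list (length ns) \<sigma>))
     (permT M (map (pob P) ns) (inv_list (length ns) \<sigma>)) (P_tensor ns) (P_tensor (reorder ns \<sigma>))"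
proof -
  have "map (nth (map (pob P) ns)) (inv_list (length ns) \<sigma>) = map (pob P) (reorder ns \<sigma>)"
    using set_inv_list[OF assms] by auto
  moreover have "lifts (permT (dual M) (map (pob P) ns) (inv_list (length ns) \<sigma>))
     (permT M (map (pob P) ns) (inv_list (length ns) \<sigma>)) (P_tensor ns)
     (bigT M (map (nth (map (pob P) ns)) (inv_list (length ns) \<sigma>)))"
    using assms
    by (intro lifts_permT) (auto simp: set_inv_list distinct_inv_list pob_obj)
  ultimately show ?thesis by (simp only:)
qed

lemma lifts_bigM_pact:
  assumes "perms_for ns \<tau>s"
  shows "lifts (bigM (dual M) (map2 (pact (dual_operad P)) ns \<tau>s)) (bigM M (map2 (pact P) ns \<tau>s))
     (P_tensor ns) (P_tensor ns)"
proof -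
  have len: "length ns = length \<tau>s" using assms by (simp add: perms_for_def)
  have "lifts (pact (dual_operad P) (fst x) (snd x)) (pact P (fst x) (snd x))
      (pob P (fst x)) (pob P (fst x))" if "x \<in> set (zip ns \<tau>s)" for x
    using that assms by (auto simp: set_zip perms_for_def intro!: liftsI arr_pact)
  then have "lifts (bigM (dual M) (map2 (pact (dual_operad P)) ns \<tau>s)) (bigM M (map2 (pact P) ns \<tau>s))
      (bigT M (map (\<lambda>x. pob P (fst x)) (zip ns \<tau>s))) (bigT M (map (\<lambda>x. pob P (fst x)) (zip ns \<tau>s)))"
    unfolding case_prod_beta' by (rule lifts_bigM)
  moreover have "map (\<lambda>x. pob P (fst x)) (zip ns \<tau>s) = map (pob P) ns"
    using arg_cong[OF map_fst_zip[OF len], of "map (pob P)"] by (simp add: comp_def)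
  ultimately show ?thesis by simp
qed

lemma lifts_bigM_peta:
  "lifts (bigM (dual M) (replicate n (peta (dual_operad P)))) (bigM M (replicate n (peta P)))
     (bigT M (replicate n (unt M))) (P_tensor (replicate n 1))"
  \<comment> \<open>The list \<open>[0..<n]\<close> serves only to count factors; all four families
    are constant.\<close>
  using lifts_bigM[of "[0..<n]" "\<lambda>_. peta (dual_operad P)" "\<lambda>_. peta P" "\<lambda>_. unt M" "\<lambda>_. pob P 1"]
  by (simp add: map_replicate_const liftsI arr_peta del: One_nat_def)

text \<open>These abbreviations name factors of the module identities that do not contain the
  structure map. Such factors are constant in \<epsilon>, so each identity over the dual numbers can
  be expanded once they are known to lift.\<close>

abbreviation (input) assoc_left :: "nat list list \<Rightarrow> 'm" where
  "assoc_left mss \<equiv> Idn M (xob X (length (concat mss))) \<odot> inner_flat M P mss"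

abbreviation (input) assoc_right :: "nat list list \<Rightarrow> 'm" where
  "assoc_right mss \<equiv> (Idn M (xob X (length mss)) \<odot> inner_gam M P mss) \<cdot>
     assoc M (xob X (length mss)) (bigT M (map (pob P) (map length mss))) (inner_dom M P mss)"

abbreviation (input) equivX_left :: "nat list \<Rightarrow> perm \<Rightarrow> 'm" where
  "equivX_left ns \<sigma> \<equiv> xact X (length ns) \<sigma> \<odot> Idn M (bigT M (map (pob P) ns))"

abbreviation (input) equivX_right :: "nat list \<Rightarrow> perm \<Rightarrow> 'm" where
  "equivX_right ns \<sigma> \<equiv>
     Idn M (xob X (length ns)) \<odot> permT M (map (pob P) ns) (inv_list (length ns) \<sigma>)"

abbreviation (input) equivP_left :: "nat list \<Rightarrow> perm list \<Rightarrow> 'm" where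
  "equivP_left ns \<tau>s \<equiv> Idn M (xob X (length ns)) \<odot> bigM M (map2 (pact P) ns \<tau>s)"

abbreviation (input) unit_left :: "nat \<Rightarrow> 'm" where
  "unit_left n \<equiv> Idn M (xob X n) \<odot> bigM M (replicate n (peta P))"

abbreviation (input) unit_right :: "nat \<Rightarrow> 'm" where
  "unit_right n \<equiv> run M (xob X n) \<cdot> (Idn M (xob X n) \<odot> collapseT M n)"

lemma lifts_assoc_left:
  "lifts (Idn (dual M) (xob X (length (concat mss))) \<odot>\<^bsub>dual M\<^esub>
       inner_flat (dual M) (dual_operad P) mss)
     (assoc_left mss) (xob X (length (concat mss)) \<otimes> inner_dom M P mss) (mu_dom M P X (concat mss))"
  unfolding mu_dom_def dual_simps(3)
  by (intro lifts_tmor lifts_Idn lifts_inner_flat xob_obj)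

lemma lifts_assoc_right:
  "lifts ((Idn (dual M) (xob X (length mss)) \<odot>\<^bsub>dual M\<^esub> inner_gam (dual M) (dual_operad P) mss) \<cdot>\<^bsub>dual M\<^esub>
       assoc (dual M) (xob X (length mss)) (bigT M (map (pob P) (map length mss))) (inner_dom M P mss))
     (assoc_right mss) (mu_dom M P X (map length mss) \<otimes> inner_dom M P mss)
     (mu_dom M P X (map sum_list mss))"
  unfolding mu_dom_def length_map dual_simps(3,6)
  by (intro lifts_cmp[OF lifts_assoc] lifts_tmor lifts_Idn lifts_inner_gam xob_obj inner_dom_obj
      P_tensor_obj)

lemma lifts_equivX_left:
  assumes "\<sigma> permutes {..<length ns}"
  shows "lifts ((xact X (length ns) \<sigma>, 0) \<odot>\<^bsub>dual M\<^esub> Idn (dual M) (bigT M (map (pob P) ns)))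
     (equivX_left ns \<sigma>) (mu_dom M P X ns) (mu_dom M P X ns)"
  unfolding mu_dom_def dual_simps(3)
  by (intro lifts_tmor lifts_Idn liftsI arr_xact assms P_tensor_obj)

lemma lifts_equivX_right:
  assumes "\<sigma> permutes {..<length ns}"
  shows "lifts (Idn (dual M) (xob X (length ns)) \<odot>\<^bsub>dual M\<^esub>
       permT (dual M) (map (pob P) ns) (inv_list (length ns) \<sigma>))
     (equivX_right ns \<sigma>) (mu_dom M P X ns) (mu_dom M P X (reorder ns \<sigma>))"
  unfolding mu_dom_def length_map length_inv_list dual_simps(3)
  by (intro lifts_tmor lifts_Idn lifts_permT_inv_list assms xob_obj)

lemma lifts_equivP_left:
  assumes "perms_for ns \<tau>s"
  shows "lifts (Idn (dual M) (xob X (length ns)) \<odot>\<^bsub>dual M\<^esub>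
       bigM (dual M) (map2 (pact (dual_operad P)) ns \<tau>s))
     (equivP_left ns \<tau>s) (mu_dom M P X ns) (mu_dom M P X ns)"
  unfolding mu_dom_def dual_simps(3)
  by (intro lifts_tmor lifts_Idn lifts_bigM_pact assms xob_obj)

lemma lifts_unit_left:
  "lifts (Idn (dual M) (xob X n) \<odot>\<^bsub>dual M\<^esub> bigM (dual M) (replicate n (peta (dual_operad P))))
     (unit_left n) (xob X n \<otimes> bigT M (replicate n (unt M))) (mu_dom M P X (replicate n 1))"
  unfolding mu_dom_def dual_simps(3) length_replicate
  by (intro lifts_tmor lifts_Idn lifts_bigM_peta xob_obj)

lemma lifts_unit_right:
  "lifts (run (dual M) (xob X n) \<cdot>\<^bsub>dual M\<^esub>
       (Idn (dual M) (xob X n) \<odot>\<^bsub>dual M\<^esub> collapseT (dual M) n))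
     (unit_right n) (xob X n \<otimes> bigT M (replicate n (unt M))) (xob X n)"
  unfolding dual_simps(3,9)
  by (intro lifts_cmp[OF lifts_tmor[OF lifts_Idn lifts_collapseT] lifts_run] xob_obj)

lemmas arr_assoc_left = lifts_arr[OF lifts_assoc_left]
  and arr_assoc_right = lifts_arr[OF lifts_assoc_right]
  and arr_equivX_left = lifts_arr[OF lifts_equivX_left]
  and arr_equivX_right = lifts_arr[OF lifts_equivX_right]
  and arr_equivP_left = lifts_arr[OF lifts_equivP_left]
  and arr_unit_left = lifts_arr[OF lifts_unit_left]
  and arr_unit_right = lifts_arr[OF lifts_unit_right]

lemma arr_block_perm: "\<sigma> permutes {..<length ns} \<Longrightarrow>
    arr (xact X (sum_list ns) (block_perm ns \<sigma>)) (xob X (sum_list ns)) (xob X (sum_list ns))"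
  by (intro arr_xact block_perm_permutes)

lemma arr_sum_perm: "perms_for ns \<tau>s \<Longrightarrow>
    arr (xact X (sum_list ns) (sum_perm ns \<tau>s)) (xob X (sum_list ns)) (xob X (sum_list ns))"
  by (intro arr_xact sum_perm_permutes)

end

subsection \<open>First-order deformations and cocycles\<close>

context linear_smc
begin

text \<open>The zero \<epsilon>-part of the constant factor meets only the main part of the other
  one, so only the main part has to be typed. For this reason the equivalences below can be stated
  for an arbitrary family \<phi>.\<close>

lemma dual_cmp_left:
  "lifts G g B C \<Longrightarrow> arr f A B \<Longrightarrow> G \<cdot>\<^bsub>dual M\<^esub> (f, f') = (g \<cdot> f, g \<cdot> f')"
  by (auto simp: lifts_def zero_cmp)

lemma dual_cmp_right:
  "lifts F f A B \<Longrightarrow> arr g B C \<Longrightarrow> (g, g') \<cdot>\<^bsub>dual M\<^esub> F = (g \<cdot> f, g' \<cdot> f)"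
  by (auto simp: lifts_def cmp_zero)

lemma dual_tmor_Idn:
  "arr f A B \<Longrightarrow> (f, f') \<odot>\<^bsub>dual M\<^esub> Idn (dual M) C = (f \<odot> Idn M C, f' \<odot> Idn M C)"
  by (simp add: tmor_zero)

end

lemma sum_list_map_sum_list: "sum_list (map sum_list xss) = sum_list (concat xss)"
  by (induction xss) simp_all

context module_smc
begin

lemma module_assoc:
    "xmu X (concat mss) \<cdot> assoc_left mss \<cdot> (xmu X (map length mss) \<odot> Idn M (inner_dom M P mss)) =
     xmu X (map sum_list mss) \<cdot> assoc_right mss"
  and module_equivX: "\<sigma> permutes {..<length ns} \<Longrightarrow>
     xmu X ns \<cdot> equivX_left ns \<sigma> =
     xact X (sum_list ns) (block_perm ns \<sigma>) \<cdot> xmu X (reorder ns \<sigma>) \<cdot> equivX_right ns \<sigma>"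
  and module_equivP: "perms_for ns \<tau>s \<Longrightarrow>
     xmu X ns \<cdot> equivP_left ns \<tau>s = xact X (sum_list ns) (sum_perm ns \<tau>s) \<cdot> xmu X ns"
  and module_unit: "xmu X (replicate n 1) \<cdot> unit_left n = unit_right n"
  using module unfolding right_module_def by blast+

text \<open>The type of a cochain carries the index \<open>sum_list (map length mss)\<close>,
  whereas the next factor in the associativity square starts at \<open>length (concat mss)\<close>.
  This lemma and the next three replace such indices by the form in which they have to be
  composed.\<close>

lemma arr_cochain1_length:
  "\<phi> \<in> cochain1 M P X \<Longrightarrow>
    arr (\<phi> (map length mss)) (mu_dom M P X (map length mss)) (xob X (length (concat mss)))"
  using arr_cochain1[of \<phi> "map length mss"] by (simp add: length_concat)

lemma arr_cochain1_sum:
  "\<phi> \<in> cochain1 M P X \<Longrightarrow>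
    arr (\<phi> (map sum_list mss)) (mu_dom M P X (map sum_list mss)) (xob X (sum_list (concat mss)))"
  using arr_cochain1[of \<phi> "map sum_list mss"] by (simp only: sum_list_map_sum_list)

lemma arr_cochain1_reorder:
  "\<phi> \<in> cochain1 M P X \<Longrightarrow> \<sigma> permutes {..<length ns} \<Longrightarrow>
    arr (\<phi> (reorder ns \<sigma>)) (mu_dom M P X (reorder ns \<sigma>)) (xob X (sum_list ns))"
  using arr_cochain1[of \<phi> "reorder ns \<sigma>"] by (simp only: sum_list_inv_list)

lemma arr_cochain1_unit:
  "\<phi> \<in> cochain1 M P X \<Longrightarrow>
    arr (\<phi> (replicate n 1)) (mu_dom M P X (replicate n 1)) (xob X n)"
  using arr_cochain1[of \<phi> "replicate n 1"] by (simp add: sum_list_replicate)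

lemma arr_cochain1_tmor:
  "\<phi> \<in> cochain1 M P X \<Longrightarrow>
    arr (\<phi> (map length mss) \<odot> Idn M (inner_dom M P mss))
      (mu_dom M P X (map length mss) \<otimes> inner_dom M P mss)
      (xob X (length (concat mss)) \<otimes> inner_dom M P mss)"
  by (intro arr_tmor arr_cochain1_length arr_Idn inner_dom_obj)

lemma diff1_cochain2:
  assumes "\<phi> \<in> cochain1 M P X"
  shows "diff1 M P X \<phi> \<in> cochain2 M P X"
proof -
  note ar = arr_cochain1[OF assms] arr_cochain1[OF xmu_cochain1] arr_cochain1_tmor[OF assms]
    arr_cochain1_tmor[OF xmu_cochain1] arr_cochain1_sum[OF assms] arr_cochain1_reorder[OF assms]
    arr_cochain1_unit[OF assms]
  have "diff1 M P X \<phi> r \<in> identity_hom M P X r" for r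
  proof (cases r)
    case (Assoc mss)
    have "arr (diff1 M P X \<phi> (Assoc mss))
        (mu_dom M P X (map length mss) \<otimes> inner_dom M P mss) (xob X (sum_list (concat mss)))"
      unfolding diff1.simps
      by (intro arr_diff arr_add arr_cmp[OF arr_cmp[OF ar(4) arr_assoc_left] ar(1)]
          arr_cmp[OF arr_cmp[OF ar(3) arr_assoc_left] ar(2)] arr_cmp[OF arr_assoc_right ar(5)])
    then show ?thesis by (simp add: Assoc arr_Hom del: diff1.simps)
  next
    case (EquivX ns \<sigma>)
    \<comment> \<open>If \<sigma> is not a permutation the component is 0 by definition, whence the
      appeal to \<open>arr_zero\<close>.\<close>
    have "arr (diff1 M P X \<phi> (EquivX ns \<sigma>)) (mu_dom M P X ns) (xob X (sum_list ns))"
      by (auto intro!: arr_diff arr_zero mu_dom_obj xob_obj arr_cmp[OF arr_equivX_left ar(1)]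
          arr_cmp[OF arr_cmp[OF arr_equivX_right ar(6)] arr_block_perm])
    then show ?thesis by (simp add: EquivX arr_Hom del: diff1.simps)
  next
    case (EquivP ns \<tau>s)
    have "arr (diff1 M P X \<phi> (EquivP ns \<tau>s)) (mu_dom M P X ns) (xob X (sum_list ns))"
      by (auto intro!: arr_diff arr_zero mu_dom_obj xob_obj arr_cmp[OF arr_equivP_left ar(1)]
          arr_cmp[OF ar(1) arr_sum_perm])
    then show ?thesis by (simp add: EquivP arr_Hom del: diff1.simps)
  next
    case (Unit n)
    have "arr (diff1 M P X \<phi> (Unit n)) (xob X n \<otimes> bigT M (replicate n (unt M))) (xob X n)"
      unfolding diff1.simps by (rule arr_cmp[OF arr_unit_left ar(7)])
    then show ?thesis by (simp add: Unit arr_Hom del: diff1.simps)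
  qed
  then show ?thesis by (simp add: cochain2_def)
qed

text \<open>The main parts agree by \<open>module_assoc\<close>, so only the \<epsilon>-parts are
  compared. The two occurrences of the structure map on the left give two terms by the Leibniz
  rule.\<close>

lemma dual_assoc_iff:
  fixes \<phi> :: "nat list \<Rightarrow> 'm"
  defines "\<nu> \<equiv> \<lambda>ns. (xmu X ns, \<phi> ns)"
  shows "\<nu> (concat mss) \<cdot>\<^bsub>dual M\<^esub>
      (Idn (dual M) (xob X (length (concat mss))) \<odot>\<^bsub>dual M\<^esub>
        inner_flat (dual M) (dual_operad P) mss) \<cdot>\<^bsub>dual M\<^esub>
      (\<nu> (map length mss) \<odot>\<^bsub>dual M\<^esub> Idn (dual M) (inner_dom M P mss)) =
    \<nu> (map sum_list mss) \<cdot>\<^bsub>dual M\<^esub>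
      (Idn (dual M) (xob X (length mss)) \<odot>\<^bsub>dual M\<^esub> inner_gam (dual M) (dual_operad P) mss) \<cdot>\<^bsub>dual M\<^esub>
      assoc (dual M) (xob X (length mss)) (bigT M (map (pob P) (map length mss)))
        (inner_dom M P mss)
    \<longleftrightarrow> diff1 M P X \<phi> (Assoc mss) = 0"
proof -
  note mu = xmu_cochain1
  show ?thesis
    unfolding \<nu>_def dual_tmor_Idn[OF arr_cochain1_length[OF mu]]
      dual_cmp_left[OF lifts_assoc_left arr_cochain1_tmor[OF mu]]
      dual_cmp_right[OF lifts_assoc_right arr_cochain1_sum[OF mu]] dual_simps(11)
      module_assoc diff1.simps
    by (simp add: add.commute)
qed

lemma dual_equivX_iff:
  fixes \<phi> :: "nat list \<Rightarrow> 'm"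
  assumes \<sigma>: "\<sigma> permutes {..<length ns}"
  defines "\<nu> \<equiv> \<lambda>ns. (xmu X ns, \<phi> ns)"
  shows "\<nu> ns \<cdot>\<^bsub>dual M\<^esub>
      ((xact X (length ns) \<sigma>, 0) \<odot>\<^bsub>dual M\<^esub> Idn (dual M) (bigT M (map (pob P) ns))) =
    (xact X (sum_list ns) (block_perm ns \<sigma>), 0) \<cdot>\<^bsub>dual M\<^esub> \<nu> (reorder ns \<sigma>) \<cdot>\<^bsub>dual M\<^esub>
      (Idn (dual M) (xob X (length ns)) \<odot>\<^bsub>dual M\<^esub>
        permT (dual M) (map (pob P) ns) (inv_list (length ns) \<sigma>))
    \<longleftrightarrow> diff1 M P X \<phi> (EquivX ns \<sigma>) = 0"
proof -
  note mu = xmu_cochain1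
  show ?thesis
    unfolding \<nu>_def dual_cmp_right[OF lifts_equivX_left[OF \<sigma>] arr_cochain1[OF mu]]
      dual_cmp_right[OF lifts_equivX_right[OF \<sigma>] arr_cochain1_reorder[OF mu \<sigma>]]
      dual_cmp_left[OF liftsI[OF arr_block_perm[OF \<sigma>]]
        arr_cmp[OF arr_equivX_right[OF \<sigma>] arr_cochain1_reorder[OF mu \<sigma>]]]
      module_equivX[OF \<sigma>] diff1.simps
    by (simp add: \<sigma>)
qed

lemma dual_equivP_iff:
  fixes \<phi> :: "nat list \<Rightarrow> 'm"
  assumes \<tau>s: "perms_for ns \<tau>s"
  defines "\<nu> \<equiv> \<lambda>ns. (xmu X ns, \<phi> ns)"
  shows "\<nu> ns \<cdot>\<^bsub>dual M\<^esub>
      (Idn (dual M) (xob X (length ns)) \<odot>\<^bsub>dual M\<^esub>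
        bigM (dual M) (map2 (pact (dual_operad P)) ns \<tau>s)) =
    (xact X (sum_list ns) (sum_perm ns \<tau>s), 0) \<cdot>\<^bsub>dual M\<^esub> \<nu> ns
    \<longleftrightarrow> diff1 M P X \<phi> (EquivP ns \<tau>s) = 0"
proof -
  note mu = xmu_cochain1
  show ?thesis
    unfolding \<nu>_def dual_cmp_right[OF lifts_equivP_left[OF \<tau>s] arr_cochain1[OF mu]]
      dual_cmp_left[OF liftsI[OF arr_sum_perm[OF \<tau>s]] arr_cochain1[OF mu]]
      module_equivP[OF \<tau>s] diff1.simps
    by (simp add: \<tau>s)
qed

text \<open>The right side is constant in \<epsilon>, so the \<epsilon>-part of the left side must
  vanish by itself.\<close>

lemma dual_unit_iff:
  fixes \<phi> :: "nat list \<Rightarrow> 'm"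
  defines "\<nu> \<equiv> \<lambda>ns. (xmu X ns, \<phi> ns)"
  shows "\<nu> (replicate n 1) \<cdot>\<^bsub>dual M\<^esub>
      (Idn (dual M) (xob X n) \<odot>\<^bsub>dual M\<^esub> bigM (dual M) (replicate n (peta (dual_operad P)))) =
    run (dual M) (xob X n) \<cdot>\<^bsub>dual M\<^esub>
      (Idn (dual M) (xob X n) \<odot>\<^bsub>dual M\<^esub> collapseT (dual M) n)
    \<longleftrightarrow> diff1 M P X \<phi> (Unit n) = 0"
  unfolding \<nu>_def dual_cmp_right[OF lifts_unit_left arr_cochain1_unit[OF xmu_cochain1]]
    lifts_eq[OF lifts_unit_right] module_unit diff1.simps
  by simp

lemma symmetric_dual: "symmetric_sequence (dual M) (xob X) (\<lambda>n \<sigma>. (xact X n \<sigma>, 0))"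
proof -
  have "xact X n \<sigma> \<cdot> 0 = 0" "0 \<cdot> xact X n \<sigma> = 0" if "\<sigma> permutes {..<n}" for n \<sigma>
    using arr_xact[OF that] by (auto intro: cmp_zero zero_cmp)
  moreover have "0 \<in> Hom M (xob X n) (xob X n)" for n
    by (intro arr_Hom arr_zero xob_obj)
  ultimately show ?thesis
    using symmetric_X by (simp add: symmetric_sequence_def)
qed

text \<open>The four equivalences above settle the case of a cochain. A family outside
  \<open>cochain1\<close> fails on both sides, because the typing of the structure map is part of
  being a right module.\<close>

lemma deformation_iff_cocycle:
  "(\<lambda>ns. (xmu X ns, \<phi> ns)) \<in> deformations M P X \<longleftrightarrow> \<phi> \<in> Z1 M P X"
proof (cases "\<phi> \<in> cochain1 M P X")
  case True
  have "\<phi> \<in> Z1 M P X \<longleftrightarrow> (\<forall>r. diff1 M P X \<phi> r = 0)"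
    using True by (simp add: Z1_def fun_eq_iff)
  \<comment> \<open>Components of \<open>diff1\<close> at indices that are not permutations are 0 by
    definition, so the cocycle condition concerns exactly the instances quantified over in
    \<open>right_module\<close>.\<close>
  also have "\<dots> \<longleftrightarrow> (\<forall>mss. diff1 M P X \<phi> (Assoc mss) = 0)
      \<and> (\<forall>ns \<sigma>. \<sigma> permutes {..<length ns} \<longrightarrow> diff1 M P X \<phi> (EquivX ns \<sigma>) = 0)
      \<and> (\<forall>ns \<tau>s. perms_for ns \<tau>s \<longrightarrow> diff1 M P X \<phi> (EquivP ns \<tau>s) = 0)
      \<and> (\<forall>n. diff1 M P X \<phi> (Unit n) = 0)" (is "?L = ?R")
  proof
    assume R: ?R
    show ?L
    proof
      fix r show "diff1 M P X \<phi> r = 0"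
        using R by (cases r) (metis, metis diff1.simps(2), metis diff1.simps(3), metis)
    qed
  qed blast
  finally have Z: "\<phi> \<in> Z1 M P X \<longleftrightarrow> ?R" .
  have hom: "(\<forall>ns. (xmu X ns, \<phi> ns) \<in> Hom (dual M) (mu_dom M P X ns) (xob X (sum_list ns)))"
    using True xmu_cochain1 by (simp add: cochain1_def)
  show ?thesis
    unfolding Z deformations_def right_module_def mem_Collect_eq dual_seq_simps mu_dom_dual
      inner_dom_dual bigT_dual dual_operad_simps(1) fst_conv
    using symmetric_dual hom dual_assoc_iff dual_equivX_iff dual_equivP_iff dual_unit_iff
    by (simp add: dual_seq_def del: dual_simps diff1.simps dual_operad_simps)
next
  case False
  then show ?thesis
    by (auto simp: Z1_def deformations_def right_module_def cochain1_def)
qed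

end

subsection \<open>Linearity of the differentials\<close>

lemma vector_space_cochain_scl:
  assumes "vector_space (scl M)"
  shows "vector_space (cochain_scl M)"
proof -
  interpret vs: vector_space "scl M" by (rule assms)
  show ?thesis
    by unfold_locales
      (auto simp: cochain_scl_def fun_eq_iff vs.scale_right_distrib vs.scale_left_distrib)
qed

context module_smc
begin

text \<open>The index type is left free because 0-cochains are indexed by numbers and 1-cochains by
  lists.\<close>

sublocale cochains: vector_space "cochain_scl M :: complex \<Rightarrow> ('i \<Rightarrow> 'm) \<Rightarrow> 'i \<Rightarrow> 'm"
  by (rule vector_space_cochain_scl[OF scl_vs])

lemma subspace_cochain1: "cochains.subspace (cochain1 M P X)"
  unfolding cochains.subspace_def
  using arr_zero[OF mu_dom_obj xob_obj] arr_add arr_scl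
  by (auto simp: cochain1_def cochain_scl_def arr_def mu_dom_obj xob_obj)

lemma subspace_cochain0: "cochains.subspace (cochain0 M X)"
proof -
  have iff: "h \<in> cochain0 M X \<longleftrightarrow> (\<forall>n. arr (h n) (xob X n) (xob X n)) \<and>
      (\<forall>n \<sigma>. \<sigma> permutes {..<n} \<longrightarrow> h n \<cdot> xact X n \<sigma> = xact X n \<sigma> \<cdot> h n)" for h
    by (simp add: cochain0_def equivariant_maps_def arr_def xob_obj)
  have add: "(x + y) \<cdot> xact X n \<sigma> = xact X n \<sigma> \<cdot> (x + y)"
    if "arr x (xob X n) (xob X n)" "arr y (xob X n) (xob X n)" "\<sigma> permutes {..<n}"
      "x \<cdot> xact X n \<sigma> = xact X n \<sigma> \<cdot> x" "y \<cdot> xact X n \<sigma> = xact X n \<sigma> \<cdot> y" for x y n \<sigma>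
    using that(4,5) add_cmp[OF arr_xact[OF that(3)] that(1,2)]
      cmp_add[OF that(1,2) arr_xact[OF that(3)]] by simp
  have scl: "scl M c x \<cdot> xact X n \<sigma> = xact X n \<sigma> \<cdot> scl M c x"
    if "arr x (xob X n) (xob X n)" "\<sigma> permutes {..<n}"
      "x \<cdot> xact X n \<sigma> = xact X n \<sigma> \<cdot> x" for c x n \<sigma>
    using that(3) scl_cmp[OF arr_xact[OF that(2)] that(1)]
      cmp_scl[OF that(1) arr_xact[OF that(2)]] by simp
  show ?thesis
    unfolding cochains.subspace_def
    by (auto simp: iff cochain_scl_def xob_obj arr_zero zero_cmp[OF arr_xact] cmp_zero[OF arr_xact]
        intro: arr_add arr_scl add scl)
qed

text \<open>Every term of the linearization contains \<phi> exactly once, so this is bilinearity of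
  composition and tensor, applied layer by layer with the type of each layer supplied.\<close>

lemma diff1_add:
  assumes \<phi>: "\<phi> \<in> cochain1 M P X" and \<psi>: "\<psi> \<in> cochain1 M P X"
  shows "diff1 M P X (\<phi> + \<psi>) r = diff1 M P X \<phi> r + diff1 M P X \<psi> r"
proof (cases r)
  case (Assoc mss)
  note mu = xmu_cochain1
  let ?I = "Idn M (inner_dom M P mss)"
  have "(\<phi> (map length mss) + \<psi> (map length mss)) \<odot> ?I =
      (\<phi> (map length mss) \<odot> ?I) + (\<psi> (map length mss) \<odot> ?I)"
    by (intro add_tmor[OF arr_cochain1_length arr_cochain1_length arr_Idn] \<phi> \<psi> inner_dom_obj)
  moreover note cmp_add[OF arr_cochain1_tmor[OF \<phi>] arr_cochain1_tmor[OF \<psi>] arr_assoc_left]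
    cmp_add[OF arr_cmp[OF arr_cochain1_tmor[OF \<phi>] arr_assoc_left]
      arr_cmp[OF arr_cochain1_tmor[OF \<psi>] arr_assoc_left] arr_cochain1[OF mu]]
    add_cmp[OF arr_cmp[OF arr_cochain1_tmor[OF mu] arr_assoc_left]
      arr_cochain1[OF \<phi>] arr_cochain1[OF \<psi>]]
    add_cmp[OF arr_assoc_right arr_cochain1_sum[OF \<phi>] arr_cochain1_sum[OF \<psi>]]
  ultimately show ?thesis
    unfolding Assoc diff1.simps plus_fun_def by simp
next
  case (EquivX ns \<sigma>)
  show ?thesis
  proof (cases "\<sigma> permutes {..<length ns}")
    case True
    note add_cmp[OF arr_equivX_left[OF True] arr_cochain1[OF \<phi>] arr_cochain1[OF \<psi>]]
      add_cmp[OF arr_equivX_right[OF True] arr_cochain1_reorder[OF \<phi> True]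
        arr_cochain1_reorder[OF \<psi> True]]
      cmp_add[OF arr_cmp[OF arr_equivX_right[OF True] arr_cochain1_reorder[OF \<phi> True]]
        arr_cmp[OF arr_equivX_right[OF True] arr_cochain1_reorder[OF \<psi> True]]
        arr_block_perm[OF True]]
    then show ?thesis
      unfolding EquivX diff1.simps plus_fun_def by simp
  qed (simp add: EquivX)
next
  case (EquivP ns \<tau>s)
  show ?thesis
  proof (cases "perms_for ns \<tau>s")
    case True
    note add_cmp[OF arr_equivP_left[OF True] arr_cochain1[OF \<phi>] arr_cochain1[OF \<psi>]]
      cmp_add[OF arr_cochain1[OF \<phi>] arr_cochain1[OF \<psi>] arr_sum_perm[OF True]]
    then show ?thesis
      unfolding EquivP diff1.simps plus_fun_def by simp
  qed (simp add: EquivP)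
next
  case (Unit n)
  show ?thesis
    unfolding Unit diff1.simps plus_fun_def
    by (rule add_cmp[OF arr_unit_left arr_cochain1_unit[OF \<phi>] arr_cochain1_unit[OF \<psi>]])
qed

lemma diff1_scl:
  assumes \<phi>: "\<phi> \<in> cochain1 M P X"
  shows "diff1 M P X (cochain_scl M c \<phi>) r = scl M c (diff1 M P X \<phi> r)"
proof (cases r)
  case (Assoc mss)
  note mu = xmu_cochain1
  let ?I = "Idn M (inner_dom M P mss)"
  have "scl M c (\<phi> (map length mss)) \<odot> ?I = scl M c (\<phi> (map length mss) \<odot> ?I)"
    by (intro scl_tmor[OF arr_cochain1_length arr_Idn] \<phi> inner_dom_obj)
  moreover note cmp_scl[OF arr_cochain1_tmor[OF \<phi>] arr_assoc_left]
    cmp_scl[OF arr_cmp[OF arr_cochain1_tmor[OF \<phi>] arr_assoc_left] arr_cochain1[OF mu]]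
    scl_cmp[OF arr_cmp[OF arr_cochain1_tmor[OF mu] arr_assoc_left] arr_cochain1[OF \<phi>]]
    scl_cmp[OF arr_assoc_right arr_cochain1_sum[OF \<phi>]]
  ultimately show ?thesis
    unfolding Assoc diff1.simps cochain_scl_def
    by (simp add: vs.scale_right_distrib vs.scale_right_diff_distrib)
next
  case (EquivX ns \<sigma>)
  show ?thesis
  proof (cases "\<sigma> permutes {..<length ns}")
    case True
    note scl_cmp[OF arr_equivX_left[OF True] arr_cochain1[OF \<phi>]]
      scl_cmp[OF arr_equivX_right[OF True] arr_cochain1_reorder[OF \<phi> True]]
      cmp_scl[OF arr_cmp[OF arr_equivX_right[OF True] arr_cochain1_reorder[OF \<phi> True]]
        arr_block_perm[OF True]]
    then show ?thesis
      unfolding EquivX diff1.simps cochain_scl_def by (simp add: vs.scale_right_diff_distrib)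
  qed (simp add: EquivX)
next
  case (EquivP ns \<tau>s)
  show ?thesis
  proof (cases "perms_for ns \<tau>s")
    case True
    note scl_cmp[OF arr_equivP_left[OF True] arr_cochain1[OF \<phi>]]
      cmp_scl[OF arr_cochain1[OF \<phi>] arr_sum_perm[OF True]]
    then show ?thesis
      unfolding EquivP diff1.simps cochain_scl_def by (simp add: vs.scale_right_diff_distrib)
  qed (simp add: EquivP)
next
  case (Unit n)
  show ?thesis
    unfolding Unit diff1.simps cochain_scl_def
    by (rule scl_cmp[OF arr_unit_left arr_cochain1_unit[OF \<phi>]])
qed

lemma subspace_Z1: "cochains.subspace (Z1 M P X)"
proof -
  have "diff1 M P X 0 = 0"
    using diff1_scl[of 0 0] cochains.subspace_0[OF subspace_cochain1] by (simp add: fun_eq_iff)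
  then show ?thesis
    using subspace_cochain1
    unfolding cochains.subspace_def Z1_def
    by (auto simp: fun_eq_iff diff1_add diff1_scl)
qed

section \<open>Transport of deformations and the differential in degree 0\<close>

abbreviation (input) act_left :: "(nat \<Rightarrow> 'm) \<Rightarrow> nat list \<Rightarrow> 'm" where
  "act_left h ns \<equiv> h (length ns) \<odot> Idn M (bigT M (map (pob P) ns))"

lemma arr_cochain0: "h \<in> cochain0 M X \<Longrightarrow> arr (h n) (xob X n) (xob X n)"
  by (simp add: cochain0_def equivariant_maps_def arr_def xob_obj)

lemma cochain0_xact:
  "h \<in> cochain0 M X \<Longrightarrow> \<sigma> permutes {..<n} \<Longrightarrow> h n \<cdot> xact X n \<sigma> = xact X n \<sigma> \<cdot> h n"
  by (simp add: cochain0_def equivariant_maps_def)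

lemma arr_act_left: "h \<in> cochain0 M X \<Longrightarrow> arr (act_left h ns) (mu_dom M P X ns) (mu_dom M P X ns)"
  unfolding mu_dom_def by (intro arr_tmor arr_cochain0 arr_Idn P_tensor_obj)

text \<open>Products of \<open>h\<close> with \<phi> are of second order and disappear, so the
  increment depends on \<open>h\<close> and the undeformed structure alone. This is what turns
  equivalence into a coset relation.\<close>

lemma transport_eq:
  assumes h: "h \<in> cochain0 M X" and \<phi>: "\<phi> \<in> cochain1 M P X"
  shows "transport M P X h (\<lambda>ns. (xmu X ns, \<phi> ns)) =
    (\<lambda>ns. (xmu X ns, \<phi> ns + ((xmu X ns \<cdot> act_left h ns) - (h (sum_list ns) \<cdot> xmu X ns))))"
proof
  fix ns
  note mu = arr_cochain1[OF xmu_cochain1, of ns] and f = arr_cochain1[OF \<phi>, of ns]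
    and hl = arr_act_left[OF h, of ns] and hn = arr_cochain0[OF h, of "sum_list ns"]
  have one: "Idn M (xob X (length ns)) \<odot> Idn M (P_tensor ns) = Idn M (mu_dom M P X ns)"
    unfolding mu_dom_def by (intro tmor_Idn xob_obj P_tensor_obj)
  have "transport M P X h (\<lambda>ns. (xmu X ns, \<phi> ns)) ns =
      (Idn M (xob X (sum_list ns)), - h (sum_list ns)) \<cdot>\<^bsub>dual M\<^esub>
      ((xmu X ns, \<phi> ns) \<cdot>\<^bsub>dual M\<^esub> (Idn M (mu_dom M P X ns), act_left h ns))"
    unfolding transport_def bigT_dual by (simp only: dual_tmor_Idn[OF arr_Idn[OF xob_obj]] one)
  also have "\<dots> = (xmu X ns, (xmu X ns \<cdot> act_left h ns) + \<phi> ns - (h (sum_list ns) \<cdot> xmu X ns))"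
    using arr_add[OF arr_cmp[OF hl mu] f]
    by (simp add: cmp_Idn_arr[OF mu] cmp_Idn_arr[OF f] Idn_cmp_arr[OF mu] neg_cmp[OF mu hn] Idn_cmp_arr)
  finally show "transport M P X h (\<lambda>ns. (xmu X ns, \<phi> ns)) ns =
    (xmu X ns, \<phi> ns + ((xmu X ns \<cdot> act_left h ns) - (h (sum_list ns) \<cdot> xmu X ns)))"
    by (simp add: algebra_simps)
qed

lemma diff0_eq:
  assumes "h \<in> cochain0 M X"
  shows "diff0 M P X h = (\<lambda>ns. (xmu X ns \<cdot> act_left h ns) - (h (sum_list ns) \<cdot> xmu X ns))"
proof -
  have "0 \<in> cochain1 M P X"
    by (rule cochains.subspace_0[OF subspace_cochain1])
  from transport_eq[OF assms this] show ?thesis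
    by (auto simp: diff0_def fun_eq_iff)
qed

lemma transport_eq_diff0:
  assumes "h \<in> cochain0 M X" "\<phi> \<in> cochain1 M P X"
  shows "transport M P X h (\<lambda>ns. (xmu X ns, \<phi> ns)) = (\<lambda>ns. (xmu X ns, \<phi> ns + diff0 M P X h ns))"
  by (simp add: transport_eq[OF assms] diff0_eq[OF assms(1)])

lemma diff0_cochain1:
  assumes h: "h \<in> cochain0 M X"
  shows "diff0 M P X h \<in> cochain1 M P X"
proof -
  have "arr (diff0 M P X h ns) (mu_dom M P X ns) (xob X (sum_list ns))" for ns
    unfolding diff0_eq[OF h]
    by (intro arr_diff arr_cmp[OF arr_act_left[OF h] arr_cochain1[OF xmu_cochain1]]
        arr_cmp[OF arr_cochain1[OF xmu_cochain1] arr_cochain0[OF h]])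
  then show ?thesis by (simp add: cochain1_def arr_Hom)
qed

lemma diff0_add:
  assumes h: "h \<in> cochain0 M X" and k: "k \<in> cochain0 M X"
  shows "diff0 M P X (h + k) = diff0 M P X h + diff0 M P X k"
proof
  fix ns
  have hk: "h + k \<in> cochain0 M X" by (rule cochains.subspace_add[OF subspace_cochain0 h k])
  note mu = arr_cochain1[OF xmu_cochain1]
  show "diff0 M P X (h + k) ns = (diff0 M P X h + diff0 M P X k) ns"
    unfolding diff0_eq[OF hk] diff0_eq[OF h] diff0_eq[OF k]
    unfolding plus_fun_def
      add_tmor[OF arr_cochain0[OF h] arr_cochain0[OF k] arr_Idn[OF P_tensor_obj]]
      cmp_add[OF arr_act_left[OF h] arr_act_left[OF k] mu]
      add_cmp[OF mu arr_cochain0[OF h] arr_cochain0[OF k]]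
    by simp
qed

lemma diff0_scl:
  assumes h: "h \<in> cochain0 M X"
  shows "diff0 M P X (cochain_scl M c h) = cochain_scl M c (diff0 M P X h)"
proof
  fix ns
  have ch: "cochain_scl M c h \<in> cochain0 M X"
    by (rule cochains.subspace_scale[OF subspace_cochain0 h])
  note mu = arr_cochain1[OF xmu_cochain1]
  show "diff0 M P X (cochain_scl M c h) ns = cochain_scl M c (diff0 M P X h) ns"
    unfolding diff0_eq[OF ch] diff0_eq[OF h]
    unfolding cochain_scl_def
      scl_tmor[OF arr_cochain0[OF h] arr_Idn[OF P_tensor_obj]]
      cmp_scl[OF arr_act_left[OF h] mu] scl_cmp[OF mu arr_cochain0[OF h]]
    by (simp add: vs.scale_right_diff_distrib)
qed

lemma subspace_B1: "cochains.subspace (B1 M P X)"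
proof -
  have zero: "diff0 M P X 0 = 0"
    using diff0_scl[of 0 0] cochains.subspace_0[OF subspace_cochain0] by simp
  show ?thesis
    unfolding cochains.subspace_def B1_def
    using subspace_cochain0[unfolded cochains.subspace_def] zero
    by (auto simp flip: diff0_add diff0_scl)
qed

end

subsection \<open>Coboundaries are cocycles\<close>

context linear_smc
begin

text \<open>The letters \<open>mc\<close>, \<open>ml\<close>, \<open>ms\<close> stand for the
  structure map at \<open>concat mss\<close>, \<open>map length mss\<close> and
  \<open>map sum_list mss\<close>, and \<open>fl\<close>, \<open>a\<close> for the constant factors
  of the square. The six terms cancel in pairs: the one with \<open>hc\<close> against the one with
  \<open>hY\<close>, since \<open>h\<close> slides past \<open>fl\<close>; the one with
  \<open>hl\<close> against the one with \<open>hs\<close>, by \<open>mod\<close> and since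
  \<open>h\<close> slides past \<open>a\<close>; and the two with \<open>hN\<close>, by
  \<open>mod\<close>.\<close>

lemma coboundary_assoc:
  assumes mc: "arr mc C N" and fl: "arr fl (Y \<otimes> I) C" and ml: "arr ml L Y"
    and ms: "arr ms S N" and a: "arr a (L \<otimes> I) S"
    and hc: "arr hc C C" and hl: "arr hl L L" and hs: "arr hs S S" and hY: "arr hY Y Y"
    and hN: "arr hN N N" and I: "I \<in> Obj M"
    and fl_h: "fl \<cdot> (hY \<odot> Idn M I) = hc \<cdot> fl"
    and a_h: "a \<cdot> (hl \<odot> Idn M I) = hs \<cdot> a"
    and mod: "mc \<cdot> fl \<cdot> (ml \<odot> Idn M I) = ms \<cdot> a"
  shows "(((mc \<cdot> hc) - (hN \<cdot> mc)) \<cdot> fl \<cdot> (ml \<odot> Idn M I))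
    + (mc \<cdot> fl \<cdot> (((ml \<cdot> hl) - (hY \<cdot> ml)) \<odot> Idn M I))
    - (((ms \<cdot> hs) - (hN \<cdot> ms)) \<cdot> a) = 0"
proof -
  note i = arr_Idn[OF I]
  note mlI = arr_tmor[OF ml i] and hlI = arr_tmor[OF hl i] and hYI = arr_tmor[OF hY i]
  note f = arr_cmp[OF mlI fl]
  have 1: "((mc \<cdot> hc) - (hN \<cdot> mc)) \<cdot> fl \<cdot> (ml \<odot> Idn M I) =
      (mc \<cdot> hc \<cdot> fl \<cdot> (ml \<odot> Idn M I)) - (hN \<cdot> ms \<cdot> a)"
    by (simp add: diff_cmp[OF f arr_cmp[OF hc mc] arr_cmp[OF mc hN]] cmp_cmp[OF f hc mc]
        cmp_cmp[OF f mc hN] mod)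
  have 2: "mc \<cdot> fl \<cdot> ((hY \<cdot> ml) \<odot> Idn M I) = mc \<cdot> hc \<cdot> fl \<cdot> (ml \<odot> Idn M I)"
    by (simp add: tmor_Idn_cmp[OF ml hY I] cmp_cmp[OF mlI hYI fl, symmetric] fl_h
        cmp_cmp[OF mlI fl hc])
  have "mc \<cdot> fl \<cdot> ((ml \<cdot> hl) \<odot> Idn M I) = (mc \<cdot> fl \<cdot> (ml \<odot> Idn M I)) \<cdot> (hl \<odot> Idn M I)"
    by (simp add: tmor_Idn_cmp[OF hl ml I] cmp_cmp[OF hlI f mc] cmp_cmp[OF hlI mlI fl])
  then have 3: "mc \<cdot> fl \<cdot> ((ml \<cdot> hl) \<odot> Idn M I) = ms \<cdot> hs \<cdot> a"
    by (simp add: mod cmp_cmp[OF hlI a ms] a_h)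
  have "mc \<cdot> fl \<cdot> (((ml \<cdot> hl) - (hY \<cdot> ml)) \<odot> Idn M I) =
      (mc \<cdot> fl \<cdot> ((ml \<cdot> hl) \<odot> Idn M I)) - (mc \<cdot> fl \<cdot> ((hY \<cdot> ml) \<odot> Idn M I))"
    using arr_tmor[OF arr_cmp[OF hl ml] i] arr_tmor[OF arr_cmp[OF ml hY] i]
    by (simp add: diff_tmor[OF arr_cmp[OF hl ml] arr_cmp[OF ml hY] i] cmp_diff[OF _ _ fl]
        cmp_diff[OF arr_cmp[OF _ fl] arr_cmp[OF _ fl] mc])
  moreover have "((ms \<cdot> hs) - (hN \<cdot> ms)) \<cdot> a = (ms \<cdot> hs \<cdot> a) - (hN \<cdot> ms \<cdot> a)"
    by (simp add: diff_cmp[OF a arr_cmp[OF hs ms] arr_cmp[OF ms hN]] cmp_cmp[OF a hs ms]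
        cmp_cmp[OF a ms hN])
  ultimately show ?thesis
    by (simp add: 1 2 3)
qed

text \<open>Covers both equivariance identities. For the action on \<open>X\<close> the map
  \<open>m'\<close> is the structure map at the reordered arities and \<open>r\<close> is the
  symmetry; for the action on the operad factors \<open>m'\<close> is \<open>m\<close> and
  \<open>r\<close> is an identity. In either case \<open>h\<close> commutes with every constant
  factor, so \<open>mod\<close> matches the terms.\<close>

lemma coboundary_equivariance:
  assumes m: "arr m D N" and m': "arr m' D' N" and e: "arr e D D" and r: "arr r D D'"
    and b: "arr b N N" and h: "arr h D D" and h': "arr h' D' D'" and hN: "arr hN N N"
    and e_h: "h \<cdot> e = e \<cdot> h" and r_h: "h' \<cdot> r = r \<cdot> h" and b_h: "hN \<cdot> b = b \<cdot> hN"
    and mod: "m \<cdot> e = b \<cdot> m' \<cdot> r"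
  shows "(((m \<cdot> h) - (hN \<cdot> m)) \<cdot> e) - (b \<cdot> ((m' \<cdot> h') - (hN \<cdot> m')) \<cdot> r) = 0"
proof -
  note m'r = arr_cmp[OF r m']
  have "((m \<cdot> h) - (hN \<cdot> m)) \<cdot> e = ((m \<cdot> e) \<cdot> h) - (hN \<cdot> m \<cdot> e)"
    by (simp add: diff_cmp[OF e arr_cmp[OF h m] arr_cmp[OF m hN]] cmp_cmp[OF e h m]
        cmp_cmp[OF e m hN] cmp_cmp[OF h e m] e_h)
  also have "(m \<cdot> e) \<cdot> h = b \<cdot> m' \<cdot> h' \<cdot> r"
    by (simp add: mod cmp_cmp[OF h m'r b] cmp_cmp[OF h r m'] r_h)
  also have "hN \<cdot> m \<cdot> e = b \<cdot> hN \<cdot> m' \<cdot> r"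
    by (simp add: mod cmp_cmp[OF m'r b hN, symmetric] b_h cmp_cmp[OF m'r hN b])
  finally have 1: "((m \<cdot> h) - (hN \<cdot> m)) \<cdot> e = (b \<cdot> m' \<cdot> h' \<cdot> r) - (b \<cdot> hN \<cdot> m' \<cdot> r)" .
  have "((m' \<cdot> h') - (hN \<cdot> m')) \<cdot> r = (m' \<cdot> h' \<cdot> r) - (hN \<cdot> m' \<cdot> r)"
    by (simp add: diff_cmp[OF r arr_cmp[OF h' m'] arr_cmp[OF m' hN]] cmp_cmp[OF r h' m']
        cmp_cmp[OF r m' hN])
  then show ?thesis
    by (simp add: 1 cmp_diff[OF arr_cmp[OF arr_cmp[OF r h'] m'] arr_cmp[OF m'r hN] b])
qed

text \<open>Both summands become \<open>hN \<cdot> r\<close>: in the first, \<open>h\<close> passes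
  through \<open>e\<close> to the source and then through \<open>r\<close> to the target.\<close>

lemma coboundary_unit:
  assumes m: "arr m D N" and e: "arr e U D" and h: "arr h D D" and hU: "arr hU U U"
    and hN: "arr hN N N" and r: "arr r U N"
    and e_h: "h \<cdot> e = e \<cdot> hU" and r_h: "r \<cdot> hU = hN \<cdot> r" and mod: "m \<cdot> e = r"
  shows "((m \<cdot> h) - (hN \<cdot> m)) \<cdot> e = 0"
proof -
  have "(m \<cdot> h) \<cdot> e = hN \<cdot> r"
    by (simp add: cmp_cmp[OF e h m] e_h cmp_cmp[OF hU e m, symmetric] mod r_h)
  then show ?thesis
    by (simp add: diff_cmp[OF e arr_cmp[OF h m] arr_cmp[OF m hN]] cmp_cmp[OF e m hN] mod)
qed

end

context module_smc
begin

text \<open>What remains is to verify that \<open>h\<close> commutes with the constant factors of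
  each identity. Maps on the operad factors are passed by interchange, the associator and the right
  unitor by naturality, and the symmetric group actions by equivariance of \<open>h\<close>.\<close>

lemma diff1_diff0:
  assumes h: "h \<in> cochain0 M X"
  shows "diff1 M P X (diff0 M P X h) r = 0"
proof (cases r)
  case (Assoc mss)
  note mu = xmu_cochain1 and I = inner_dom_obj[of mss] and k = arr_cochain0[OF h]
  have L: "mu_dom M P X (map length mss) = xob X (length mss) \<otimes> P_tensor (map length mss)"
    and S: "mu_dom M P X (map sum_list mss) = xob X (length mss) \<otimes> P_tensor (map sum_list mss)"
    by (simp_all add: mu_dom_def)
  note hl = arr_act_left[OF h, of "map length mss", unfolded length_map]
    and hs = arr_act_left[OF h, of "map sum_list mss", unfolded length_map]
  have fl_h: "assoc_left mss \<cdot> (h (length (concat mss)) \<odot> Idn M (inner_dom M P mss)) =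
      act_left h (concat mss) \<cdot> assoc_left mss"
    by (rule tmor_interchange[OF k lifts_arr[OF lifts_inner_flat], symmetric])
  have gam: "(h (length mss) \<odot> Idn M (P_tensor (map sum_list mss))) \<cdot>
        (Idn M (xob X (length mss)) \<odot> inner_gam M P mss) =
      (Idn M (xob X (length mss)) \<odot> inner_gam M P mss) \<cdot>
        (h (length mss) \<odot> Idn M (P_tensor (map length mss) \<otimes> inner_dom M P mss))"
    by (rule tmor_interchange[OF k lifts_arr[OF lifts_inner_gam]])
  let ?a = "assoc M (xob X (length mss)) (P_tensor (map length mss)) (inner_dom M P mss)"
  \<comment> \<open>Naturality of the associator in its first argument; the two identities at the
    other arguments merge into the identity of their tensor product.\<close>
  have assoc: "?a \<cdot> ((h (length mss) \<odot> Idn M (P_tensor (map length mss))) \<odot> Idn M (inner_dom M P mss)) =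
      (h (length mss) \<odot> Idn M (P_tensor (map length mss) \<otimes> inner_dom M P mss)) \<cdot> ?a"
    using assoc_nat[OF xob_obj P_tensor_obj I xob_obj P_tensor_obj I arr_Hom[OF k]
        Idn_in[OF P_tensor_obj] Idn_in[OF I]]
    by (simp only: tmor_Idn[OF P_tensor_obj I])
  have g: "arr (Idn M (xob X (length mss)) \<odot> inner_gam M P mss)
      (xob X (length mss) \<otimes> P_tensor (map length mss) \<otimes> inner_dom M P mss)
      (mu_dom M P X (map sum_list mss))"
    unfolding S by (intro arr_tmor arr_Idn xob_obj lifts_arr[OF lifts_inner_gam])
  have ha: "arr (h (length mss) \<odot> Idn M (P_tensor (map length mss) \<otimes> inner_dom M P mss))
      (xob X (length mss) \<otimes> P_tensor (map length mss) \<otimes> inner_dom M P mss)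
      (xob X (length mss) \<otimes> P_tensor (map length mss) \<otimes> inner_dom M P mss)"
    by (intro arr_tmor arr_Idn k tob_in P_tensor_obj I)
  note a = arr_assoc[OF xob_obj P_tensor_obj I]
  have a_h: "assoc_right mss \<cdot>
        ((h (length mss) \<odot> Idn M (P_tensor (map length mss))) \<odot> Idn M (inner_dom M P mss)) =
      (h (length mss) \<odot> Idn M (P_tensor (map sum_list mss))) \<cdot> assoc_right mss"
    by (simp only: cmp_cmp[OF arr_tmor[OF hl[unfolded L] arr_Idn[OF I]] a g] assoc
        cmp_cmp[OF a ha g, symmetric] gam[symmetric] cmp_cmp[OF a g hs])
  show ?thesis
    using coboundary_assoc[OF arr_cochain1[OF mu] arr_assoc_left arr_cochain1_length[OF mu]
        arr_cochain1_sum[OF mu] arr_assoc_right arr_act_left[OF h] hl hs k k I fl_h a_h module_assoc]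
    unfolding Assoc diff1.simps diff0_eq[OF h]
    by (simp add: length_concat sum_list_map_sum_list)
next
  case (EquivX ns \<sigma>)
  show ?thesis
  proof (cases "\<sigma> permutes {..<length ns}")
    case True
    note mu = xmu_cochain1 and k = arr_cochain0[OF h]
    have e_h: "act_left h ns \<cdot> equivX_left ns \<sigma> = equivX_left ns \<sigma> \<cdot> act_left h ns"
      using cochain0_xact[OF h True]
      by (simp flip: tmor_Idn_cmp[OF arr_xact[OF True] k P_tensor_obj]
          tmor_Idn_cmp[OF k arr_xact[OF True] P_tensor_obj])
    have r_h: "act_left h (reorder ns \<sigma>) \<cdot> equivX_right ns \<sigma> = equivX_right ns \<sigma> \<cdot> act_left h ns"
      using tmor_interchange[OF k lifts_arr[OF lifts_permT_inv_list[OF True]]]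
      unfolding length_map length_inv_list .
    from coboundary_equivariance[OF arr_cochain1[OF mu] arr_cochain1_reorder[OF mu True]
        arr_equivX_left[OF True] arr_equivX_right[OF True] arr_block_perm[OF True]
        arr_act_left[OF h] arr_act_left[OF h] k e_h r_h cochain0_xact[OF h block_perm_permutes[OF True]]
        module_equivX[OF True]]
    show ?thesis
      unfolding EquivX diff1.simps diff0_eq[OF h] sum_list_inv_list[OF True] by (simp add: True)
  qed (simp add: EquivX)
next
  case (EquivP ns \<tau>s)
  show ?thesis
  proof (cases "perms_for ns \<tau>s")
    case True
    note mu = arr_cochain1[OF xmu_cochain1] and k = arr_cochain0[OF h]
      and hn = arr_act_left[OF h] and D = arr_Idn[OF mu_dom_obj]
    have e_h: "act_left h ns \<cdot> equivP_left ns \<tau>s = equivP_left ns \<tau>s \<cdot> act_left h ns"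
      by (rule tmor_interchange[OF k lifts_arr[OF lifts_bigM_pact[OF True]]])
    \<comment> \<open>No arities are reordered here, so the identity is inserted in place of the
      symmetry in order to fit \<open>coboundary_equivariance\<close>.\<close>
    have r_h: "act_left h ns \<cdot> Idn M (mu_dom M P X ns) = Idn M (mu_dom M P X ns) \<cdot> act_left h ns"
      by (simp add: cmp_Idn_arr[OF hn] Idn_cmp_arr[OF hn])
    have mod: "xmu X ns \<cdot> equivP_left ns \<tau>s =
        xact X (sum_list ns) (sum_perm ns \<tau>s) \<cdot> xmu X ns \<cdot> Idn M (mu_dom M P X ns)"
      by (simp add: module_equivP[OF True] cmp_Idn_arr[OF mu])
    have d: "diff0 M P X h ns \<cdot> Idn M (mu_dom M P X ns) = diff0 M P X h ns"
      by (rule cmp_Idn_arr[OF arr_cochain1[OF diff0_cochain1[OF h]]])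
    from coboundary_equivariance[OF mu mu arr_equivP_left[OF True] D arr_sum_perm[OF True]
        hn hn k e_h r_h cochain0_xact[OF h sum_perm_permutes[OF True]] mod]
    show ?thesis
      using d unfolding EquivP diff1.simps diff0_eq[OF h] by (simp add: True)
  qed (simp add: EquivP)
next
  case (Unit n)
  note k = arr_cochain0[OF h]
  have U: "bigT M (replicate n (unt M)) \<in> Obj M"
    by (rule bigT_replicate_obj[OF unt_in])
  have e_h: "(h n \<odot> Idn M (P_tensor (replicate n 1))) \<cdot> unit_left n =
      unit_left n \<cdot> (h n \<odot> Idn M (bigT M (replicate n (unt M))))"
    by (rule tmor_interchange[OF k lifts_arr[OF lifts_bigM_peta]])
  have c: "arr (Idn M (xob X n) \<odot> collapseT M n)
      (xob X n \<otimes> bigT M (replicate n (unt M))) (xob X n \<otimes> unt M)"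
    by (intro arr_tmor arr_Idn xob_obj lifts_arr[OF lifts_collapseT])
  have hU: "arr (h n \<odot> Idn M (bigT M (replicate n (unt M))))
      (xob X n \<otimes> bigT M (replicate n (unt M))) (xob X n \<otimes> bigT M (replicate n (unt M)))"
    by (intro arr_tmor k arr_Idn U)
  have hu: "arr (h n \<odot> Idn M (unt M)) (xob X n \<otimes> unt M) (xob X n \<otimes> unt M)"
    by (intro arr_tmor k arr_Idn unt_in)
  note run = arr_run[OF xob_obj]
  \<comment> \<open>\<open>h\<close> passes the collapse of unit objects by interchange and the
    right unitor by naturality.\<close>
  have r_h: "unit_right n \<cdot> (h n \<odot> Idn M (bigT M (replicate n (unt M)))) = h n \<cdot> unit_right n"
    using run_nat[OF xob_obj xob_obj arr_Hom[OF k]]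
    by (simp add: cmp_cmp[OF hU c run] cmp_cmp[OF c hu run, symmetric] cmp_cmp[OF c run k]
        tmor_interchange[OF k lifts_arr[OF lifts_collapseT], symmetric])
  have hD: "arr (h n \<odot> Idn M (P_tensor (replicate n 1)))
      (mu_dom M P X (replicate n 1)) (mu_dom M P X (replicate n 1))"
    using arr_act_left[OF h, of "replicate n 1"] by simp
  show ?thesis
    using coboundary_unit[OF arr_cochain1_unit[OF xmu_cochain1] arr_unit_left hD hU k
        arr_unit_right e_h r_h module_unit]
    unfolding Unit diff1.simps diff0_eq[OF h] by (simp add: sum_list_replicate)
qed

lemma B1_subset_Z1: "B1 M P X \<subseteq> Z1 M P X"
  by (auto simp: B1_def Z1_def diff0_cochain1 fun_eq_iff diff1_diff0)

section \<open>Deformations as cocycles, equivalence as cohomology\<close>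

lemma snd_deformation:
  assumes "\<nu> \<in> deformations M P X"
  shows "(\<lambda>ns. snd (\<nu> ns)) \<in> Z1 M P X" "\<nu> = (\<lambda>ns. (xmu X ns, snd (\<nu> ns)))"
proof -
  show "\<nu> = (\<lambda>ns. (xmu X ns, snd (\<nu> ns)))"
    using assms by (auto simp: deformations_def fun_eq_iff prod_eq_iff)
  then show "(\<lambda>ns. snd (\<nu> ns)) \<in> Z1 M P X"
    using assms deformation_iff_cocycle[of "\<lambda>ns. snd (\<nu> ns)"] by simp
qed

lemma bij_betw_Z1_deformations:
  "bij_betw (\<lambda>\<phi> ns. (xmu X ns, \<phi> ns)) (Z1 M P X) (deformations M P X)"
  by (rule bij_betw_byWitness[where f' = "\<lambda>\<nu> ns. snd (\<nu> ns)"])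
    (auto simp: deformation_iff_cocycle snd_deformation(1) snd_deformation(2)[symmetric])

text \<open>By \<open>transport_eq_diff0\<close>, transport along \<open>h\<close> adds the same
  coboundary whatever the starting deformation, so only the difference matters, taken as target
  minus source.\<close>

lemma deformation_equiv_iff:
  assumes "\<phi> \<in> Z1 M P X" "\<psi> \<in> Z1 M P X"
  shows "((\<lambda>ns. (xmu X ns, \<phi> ns)), (\<lambda>ns. (xmu X ns, \<psi> ns))) \<in> deformation_equiv M P X
    \<longleftrightarrow> \<psi> - \<phi> \<in> B1 M P X"
proof -
  have "\<phi> \<in> cochain1 M P X" using assms by (simp add: Z1_def)
  then have "(\<lambda>ns. (xmu X ns, \<psi> ns)) = transport M P X h (\<lambda>ns. (xmu X ns, \<phi> ns))
      \<longleftrightarrow> \<psi> - \<phi> = diff0 M P X h" if "h \<in> cochain0 M X" for h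
    using that by (auto simp: transport_eq_diff0 fun_eq_iff algebra_simps)
  then show ?thesis
    using assms by (auto simp: deformation_equiv_def deformation_iff_cocycle B1_def)
qed

lemma equiv_cohomologous: "equiv (Z1 M P X) (cohomologous M P X)"
proof (rule equivI)
  show "refl_on (Z1 M P X) (cohomologous M P X)"
    using cochains.subspace_0[OF subspace_B1] by (auto simp: refl_on_def cohomologous_def)
  show "sym (cohomologous M P X)"
  proof (rule symI)
    fix \<phi> \<psi> assume "(\<phi>, \<psi>) \<in> cohomologous M P X"
    then show "(\<psi>, \<phi>) \<in> cohomologous M P X"
      using cochains.subspace_neg[OF subspace_B1, of "\<phi> - \<psi>"] by (simp add: cohomologous_def)
  qed
  show "trans (cohomologous M P X)"
  proof (rule transI)
    fix \<phi> \<psi> \<theta> assume "(\<phi>, \<psi>) \<in> cohomologous M P X" "(\<psi>, \<theta>) \<in> cohomologous M P X"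
    then show "(\<phi>, \<theta>) \<in> cohomologous M P X"
      using cochains.subspace_add[OF subspace_B1, of "\<phi> - \<psi>" "\<psi> - \<theta>"]
      by (simp add: cohomologous_def)
  qed
qed (auto simp: cohomologous_def)

end

subsection \<open>Transport of quotients along a bijection\<close>

text \<open>Spares the group law of transports: the laws of an equivalence relation on deformations
  are read off from those for cocycles.\<close>

lemma equiv_bij_betw:
  assumes f: "bij_betw f A B" and R: "R \<subseteq> A \<times> A" and S: "equiv B S"
    and RS: "\<And>x y. x \<in> A \<Longrightarrow> y \<in> A \<Longrightarrow> (x, y) \<in> R \<longleftrightarrow> (f x, f y) \<in> S"
  shows "equiv A R"
proof (rule equivI)
  have fB: "f x \<in> B" if "x \<in> A" for x
    using f that by (auto simp: bij_betw_def)
  show "refl_on A R"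
    using equiv_class_self[OF S] fB by (auto simp: refl_on_def RS)
  show "sym R"
    using R RS symD[of S] S by (intro symI) (auto simp: equiv_def)
  show "trans R"
  proof (rule transI)
    fix x y z assume xy: "(x, y) \<in> R" and yz: "(y, z) \<in> R"
    then have "x \<in> A" "y \<in> A" "z \<in> A" using R by auto
    with xy yz show "(x, z) \<in> R"
      using RS transD[of S "f x" "f y" "f z"] S by (simp add: equiv_def)
  qed
qed (use R in auto)

lemma image_equiv_class:
  assumes f: "bij_betw f A B" and R: "R \<subseteq> A \<times> A" and S: "S \<subseteq> B \<times> B"
    and RS: "\<And>x y. x \<in> A \<Longrightarrow> y \<in> A \<Longrightarrow> (x, y) \<in> R \<longleftrightarrow> (f x, f y) \<in> S" and x: "x \<in> A"
  shows "f ` (R `` {x}) = S `` {f x}"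
proof
  show "f ` (R `` {x}) \<subseteq> S `` {f x}"
    using R RS x by auto
  show "S `` {f x} \<subseteq> f ` (R `` {x})"
  proof
    fix b assume "b \<in> S `` {f x}"
    then have b: "(f x, b) \<in> S" by simp
    then have "b \<in> B" using S by auto
    then obtain y where "y \<in> A" "b = f y" using f by (auto simp: bij_betw_def)
    then show "b \<in> f ` (R `` {x})" using b RS x by auto
  qed
qed

text \<open>The map on classes is the direct image, so no representatives are chosen; it is
  injective because all classes lie in \<open>A\<close>, where \<open>f\<close> is
  injective.\<close>

lemma bij_betw_quotient:
  assumes f: "bij_betw f A B" and R: "R \<subseteq> A \<times> A" and S: "S \<subseteq> B \<times> B"
    and RS: "\<And>x y. x \<in> A \<Longrightarrow> y \<in> A \<Longrightarrow> (x, y) \<in> R \<longleftrightarrow> (f x, f y) \<in> S"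
  shows "bij_betw ((`) f) (A // R) (B // S)"
  unfolding bij_betw_def
proof
  note cls = image_equiv_class[OF f R S RS]
  have "a \<subseteq> A" if "a \<in> A // R" for a
    using that R by (auto simp: quotient_def)
  then show "inj_on ((`) f) (A // R)"
    using f by (auto intro!: inj_onI simp: bij_betw_def inj_on_image_eq_iff)
  show "(`) f ` (A // R) = B // S"
  proof
    show "(`) f ` (A // R) \<subseteq> B // S"
      using f cls by (auto simp: quotient_def bij_betw_def)
    show "B // S \<subseteq> (`) f ` (A // R)"
    proof
      fix b assume "b \<in> B // S"
      then obtain y where "y \<in> B" "b = S `` {y}" by (auto simp: quotient_def)
      then obtain x where "x \<in> A" "b = S `` {f x}" using f by (auto simp: bij_betw_def)
      then show "b \<in> (`) f ` (A // R)"
        using cls by (auto intro!: image_eqI[of _ _ "R `` {x}"] quotientI)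
    qed
  qed
qed

text \<open>An induced operation is a union of classes over the members of its argument, and direct
  image commutes with unions, so compatibility can be checked member by member.\<close>

lemma image_class_op1:
  assumes cls: "\<And>x. x \<in> A \<Longrightarrow> f ` (R `` {x}) = S `` {f x}" and a: "a \<subseteq> A"
    and g: "\<And>x. x \<in> A \<Longrightarrow> g x \<in> A \<and> f (g x) = g' (f x)"
  shows "f ` class_op1 R g a = class_op1 S g' (f ` a)"
proof -
  have "f ` (R `` {g x}) = S `` {g' (f x)}" if "x \<in> a" for x
    using cls[of "g x"] g[of x] subsetD[OF a that] by simp
  then show ?thesis
    unfolding class_op1_def image_UN by auto
qed

lemma image_class_op2:
  assumes cls: "\<And>x. x \<in> A \<Longrightarrow> f ` (R `` {x}) = S `` {f x}" and ab: "a \<subseteq> A" "b \<subseteq> A"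
    and g: "\<And>x y. x \<in> A \<Longrightarrow> y \<in> A \<Longrightarrow> g x y \<in> A \<and> f (g x y) = g' (f x) (f y)"
  shows "f ` class_op2 R g a b = class_op2 S g' (f ` a) (f ` b)"
proof -
  have "f ` (R `` {g x y}) = S `` {g' (f x) (f y)}" if "x \<in> a" "y \<in> b" for x y
    using cls[of "g x y"] g[OF subsetD[OF ab(1) that(1)] subsetD[OF ab(2) that(2)]] by simp
  then show ?thesis
    unfolding class_op2_def image_UN by auto
qed

theorem theorem15:
  fixes M :: "('o, 'm::ab_group_add) nsmcat"
    and P :: "('o, 'm) operad"
    and S :: "('o, 'm) spectral_data"
    and \<mu> :: "('o, 'm) pfun \<Rightarrow> nat list \<Rightarrow> 'm"
    and F :: "('o, 'm) pfun"
    and X :: "('o, 'm) seqmod"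
  assumes "normed_smc M"
    and "is_operad M P"
    and "spec_deriv_equivalence M P S \<mu>"
    and "F \<in> SpecAn M P S"
    and "X = spec_deriv M P \<mu> F"
  shows
    \<comment> \<open>the quotients below are well defined\<close>
    "(diff0 M P X \<in> cochain0 M X \<rightarrow> cochain1 M P X
      \<and> diff1 M P X \<in> cochain1 M P X \<rightarrow> cochain2 M P X
      \<and> module.subspace (cochain_scl M) (Z1 M P X)
      \<and> module.subspace (cochain_scl M) (B1 M P X)
      \<and> B1 M P X \<subseteq> Z1 M P X
      \<and> equiv (Def_eps M P \<mu> F) (Def_equiv M P \<mu> F))
     \<and>
     bij_betw (\<lambda>\<phi> ns. (xmu X ns, \<phi> ns)) (Z1 M P X) (Def_eps M P \<mu> F)
     \<and>
     (\<forall>\<nu> \<in> Def_eps M P \<mu> F. \<forall>\<nu>' \<in> Def_eps M P \<mu> F.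
        (\<nu>, \<nu>') \<in> Def_equiv M P \<mu> F \<longleftrightarrow> (\<lambda>ns. snd (\<nu>' ns) - snd (\<nu> ns)) \<in> B1 M P X)
     \<and> (\<exists>\<Phi>. bij_betw \<Phi> (Def_eps M P \<mu> F // Def_equiv M P \<mu> F) (H1 M P X)
          \<and> (\<forall>\<phi> \<in> Z1 M P X. \<Phi> (Def_equiv M P \<mu> F `` {\<lambda>ns. (xmu X ns, \<phi> ns)})
               = cohomologous M P X `` {\<phi>}))
     \<and>
     (\<exists>\<Theta>. bij_betw \<Theta> (tangent_space M P \<mu> F) (H1 M P X)
          \<and> (\<forall>a \<in> tangent_space M P \<mu> F. \<forall>b \<in> tangent_space M P \<mu> F.
               \<Theta> (class_op2 (Def_equiv M P \<mu> F) (deformation_add X) a b)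
               = class_op2 (cohomologous M P X) (+) (\<Theta> a) (\<Theta> b))
          \<and> (\<forall>c. \<forall>a \<in> tangent_space M P \<mu> F.
               \<Theta> (class_op1 (Def_equiv M P \<mu> F) (deformation_scl M X c) a)
               = class_op1 (cohomologous M P X) (cochain_scl M c) (\<Theta> a)))"
proof -
  interpret normed_smc M by (rule assms(1))
  \<comment> \<open>The equivalence sends \<open>F\<close> to an integrable derivative algebra,
    which contains the right module structure to be deformed.\<close>
  have "right_module M P X"
    using assms(3-5) unfolding spec_deriv_equivalence_def DerAlg_int_def derivative_algebra_def
    by blast
  then interpret module_smc M P X
    using assms(2) by unfold_locales
  \<comment> \<open>Taking the \<epsilon>-part is the inverse of the bijection from cocycles to
    deformations; its direct image serves below as the map on classes.\<close>
  let ?f = "\<lambda>(\<nu> :: nat list \<Rightarrow> 'm \<times> 'm) ns. snd (\<nu> ns)"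
  let ?D = "deformations M P X" and ?R = "deformation_equiv M P X"
    and ?Z = "Z1 M P X" and ?S = "cohomologous M P X"
  have R: "?R \<subseteq> ?D \<times> ?D" by (auto simp: deformation_equiv_def)
  have S: "?S \<subseteq> ?Z \<times> ?Z" by (auto simp: cohomologous_def)
  have inv: "(\<lambda>\<nu> ns. (xmu X ns, snd (\<nu> ns))) \<nu> = \<nu>" if "\<nu> \<in> ?D" for \<nu>
    using snd_deformation(2)[OF that] by simp
  have f: "bij_betw ?f ?D ?Z"
    by (rule bij_betw_byWitness[where f' = "\<lambda>\<phi> ns. (xmu X ns, \<phi> ns)"])
      (auto simp: inv snd_deformation(1) deformation_iff_cocycle)
  have iff: "(\<nu>, \<nu>') \<in> ?R \<longleftrightarrow> ?f \<nu>' - ?f \<nu> \<in> B1 M P X" if "\<nu> \<in> ?D" "\<nu>' \<in> ?D" for \<nu> \<nu>'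
    using deformation_equiv_iff[OF snd_deformation(1)[OF that(1)] snd_deformation(1)[OF that(2)]]
    by (simp only: inv[OF that(1)] inv[OF that(2)])
  \<comment> \<open>Transport produces target minus source, while \<open>cohomologous\<close> uses
    the opposite difference; closure of \<open>B1\<close> under negation reconciles them.\<close>
  have RS: "(\<nu>, \<nu>') \<in> ?R \<longleftrightarrow> (?f \<nu>, ?f \<nu>') \<in> ?S" if "\<nu> \<in> ?D" "\<nu>' \<in> ?D" for \<nu> \<nu>'
  proof -
    have "?f \<nu>' - ?f \<nu> \<in> B1 M P X \<longleftrightarrow> ?f \<nu> - ?f \<nu>' \<in> B1 M P X"
      using cochains.subspace_neg[OF subspace_B1, of "?f \<nu>' - ?f \<nu>"]
        cochains.subspace_neg[OF subspace_B1, of "?f \<nu> - ?f \<nu>'"] by auto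
    then show ?thesis
      using iff[OF that] snd_deformation(1) that by (simp add: cohomologous_def)
  qed
  note cls = image_equiv_class[OF f R S RS]
  have quot: "bij_betw ((`) ?f) (?D // ?R) (H1 M P X)"
    unfolding H1_def by (rule bij_betw_quotient[OF f R S RS])
  have sub: "a \<subseteq> ?D" if "a \<in> ?D // ?R" for a
    using that R by (auto simp: quotient_def)
  have class_eq: "(`) ?f (?R `` {\<lambda>ns. (xmu X ns, \<phi> ns)}) = ?S `` {\<phi>}" if "\<phi> \<in> ?Z" for \<phi>
    using cls[of "\<lambda>ns. (xmu X ns, \<phi> ns)"] that by (simp add: deformation_iff_cocycle)
  have add: "?f ` class_op2 ?R (deformation_add X) a b = class_op2 ?S (+) (?f ` a) (?f ` b)"
    if "a \<in> ?D // ?R" "b \<in> ?D // ?R" for a b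
  proof (rule image_class_op2[OF cls sub[OF that(1)] sub[OF that(2)]])
    fix \<nu> \<nu>' assume "\<nu> \<in> ?D" "\<nu>' \<in> ?D"
    then have "?f \<nu> + ?f \<nu>' \<in> ?Z"
      by (intro cochains.subspace_add[OF subspace_Z1] snd_deformation(1))
    then show "deformation_add X \<nu> \<nu>' \<in> ?D \<and> ?f (deformation_add X \<nu> \<nu>') = ?f \<nu> + ?f \<nu>'"
      by (simp add: deformation_add_def deformation_iff_cocycle plus_fun_def)
  qed
  have scl: "?f ` class_op1 ?R (deformation_scl M X c) a = class_op1 ?S (cochain_scl M c) (?f ` a)"
    if "a \<in> ?D // ?R" for a c
  proof (rule image_class_op1[OF cls sub[OF that]])
    fix \<nu> assume "\<nu> \<in> ?D"
    then have "cochain_scl M c (?f \<nu>) \<in> ?Z"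
      by (intro cochains.subspace_scale[OF subspace_Z1] snd_deformation(1))
    then show "deformation_scl M X c \<nu> \<in> ?D \<and> ?f (deformation_scl M X c \<nu>) = cochain_scl M c (?f \<nu>)"
      by (simp add: deformation_scl_def deformation_iff_cocycle cochain_scl_def)
  qed
  have D: "Def_eps M P \<mu> F = ?D" "Def_equiv M P \<mu> F = ?R" "tangent_space M P \<mu> F = ?D // ?R"
    by (simp_all add: Def_eps_def Def_equiv_def tangent_space_def assms(5))
  show ?thesis
    unfolding D
  proof (intro conjI)
    show "\<exists>\<Phi>. bij_betw \<Phi> (?D // ?R) (H1 M P X) \<and>
        (\<forall>\<phi> \<in> ?Z. \<Phi> (?R `` {\<lambda>ns. (xmu X ns, \<phi> ns)}) = ?S `` {\<phi>})"
      by (intro exI[of _ "(`) ?f"] conjI ballI quot class_eq)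
    \<comment> \<open>The tangent space is this same quotient, so the previous map serves again, now
      with its compatibility with sums and scalar multiples.\<close>
    show "\<exists>\<Theta>. bij_betw \<Theta> (?D // ?R) (H1 M P X) \<and>
        (\<forall>a \<in> ?D // ?R. \<forall>b \<in> ?D // ?R.
           \<Theta> (class_op2 ?R (deformation_add X) a b) = class_op2 ?S (+) (\<Theta> a) (\<Theta> b)) \<and>
        (\<forall>c. \<forall>a \<in> ?D // ?R.
           \<Theta> (class_op1 ?R (deformation_scl M X c) a) = class_op1 ?S (cochain_scl M c) (\<Theta> a))"
      by (intro exI[of _ "(`) ?f"] conjI ballI allI quot add scl)
    show "\<forall>\<nu> \<in> ?D. \<forall>\<nu>' \<in> ?D. (\<nu>, \<nu>') \<in> ?R \<longleftrightarrow> (\<lambda>ns. snd (\<nu>' ns) - snd (\<nu> ns)) \<in> B1 M P X"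
      using iff by (simp add: fun_diff_def)
    show "equiv ?D ?R"
      by (rule equiv_bij_betw[OF f R equiv_cohomologous RS])
  qed (simp_all add: Pi_iff diff0_cochain1 diff1_cochain2 subspace_Z1 subspace_B1 B1_subset_Z1
      bij_betw_Z1_deformations)
qed

end
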